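(* Let $G$ be an abelian compact Hausdorff group, let $\mathcal{A}$ be a semisimple, separable, commutative and unital Banach algebra, and let $1<p<\infty$. Then $L^p(G,\mathcal{A})$ is a type I-BSE algebra if and only if $G$ is finite and $\mathcal{A}$ is a type I-BSE algebra.
   Context: With Haar measure $\lambda$ on $G$, $L^p(G,\mathcal{A})$ is the Banach algebra of (classes of) Borel measurable $f:G\to\mathcal{A}$ with $\|f\|_{p,\mathcal{A}}=\big(\int_G\|f(x)\|_{\mathcal{A}}^p\,d\lambda(x)\big)^{1/p}<\infty$, under the convolution product. For a commutative Banach algebra $\mathcal{B}$, $\Delta(\mathcal{B})$ is the character space (nonzero multiplicative linear functionals) with the Gelfand topology, $C_b(\Delta(\mathcal{B}))$ is the algebra of bounded continuous complex functions on it, and $\hat b(\varphi)=\varphi(b)$. A function $\sigma\in C_b(\Delta(\mathcal{B}))$ is a BSE-function if there is $\beta>0$ such that $\big|\sum_{j=1}^n c_j\sigma(\varphi_j)\big|\le\beta\big\|\sum_{j=1}^n c_j\varphi_j\big\|_{\mathcal{B}^{\ast}}$ for all $n$, all $c_1,\dots,c_n\in\mathbb{C}$ and $\varphi_1,\dots,\varphi_n\in\Delta(\mathcal{B})$; $C_{BSE}(\Delta(\mathcal{B}))$ is the set of BSE-functions. $\mathcal{B}$ is without order if $b\mathcal{B}=\{0\}$ implies $b=0$. For $\mathcal{B}$ commutative and without order, $M(\mathcal{B})$ is the algebra of bounded linear $T:\mathcal{B}\to\mathcal{B}$ with $T(ab)=aT(b)$; for each $T\in M(\mathcal{B})$ there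 is a unique $\widehat T\in C_b(\Delta(\mathcal{B}))$ with $\widehat{T(b)}=\widehat T\,\hat b$ for all $b$, and $\widehat{M(\mathcal{B})}=\{\widehat T:T\in M(\mathcal{B})\}$. $\mathcal{B}$ (commutative, without order) is a BSE-algebra if $C_{BSE}(\Delta(\mathcal{B}))=\widehat{M(\mathcal{B})}$, and a type I-BSE algebra if it is a BSE-algebra and $C_{BSE}(\Delta(\mathcal{B}))=C_b(\Delta(\mathcal{B}))$. *)

theory Defs
  imports "HOL-Analysis.Analysis"
begin

section \<open>Complex Banach algebras as types\<close>

text \<open>The norm is not required to satisfy \<open>norm 1 = 1\<close>: a unital commutative Banach algebra is a type
  in \<open>complex_banach_algebra\<close> and \<open>comm_ring_1\<close>. The latter class contains \<open>0 \<noteq> 1\<close>, so the zero algebra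
  does not count as unital.\<close>

class complex_banach_algebra = real_normed_algebra + banach +
  fixes scaleC :: "complex \<Rightarrow> 'a \<Rightarrow> 'a"
  assumes scaleC_add_right: "scaleC c (x + y) = scaleC c x + scaleC c y"
    and scaleC_add_left: "scaleC (c + d) x = scaleC c x + scaleC d x"
    and scaleC_scaleC: "scaleC c (scaleC d x) = scaleC (c * d) x"
    and scaleR_scaleC: "scaleR r x = scaleC (complex_of_real r) x"
    and mult_scaleC_left: "scaleC c x * y = scaleC c (x * y)"
    and mult_scaleC_right: "x * scaleC c y = scaleC c (x * y)"
    and norm_scaleC: "norm (scaleC c x) = cmod c * norm x"

class separable_metric_space = metric_space +
  assumes ex_countable_dense: "\<exists>D. countable D \<and> (\<forall>x. \<forall>e>0. \<exists>d\<in>D. dist x d < e)"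
begin

text \<open>This makes Borel measurability and the Bochner integral of the library available.\<close>

subclass second_countable_topology
proof
  obtain D where D: "countable D" "\<And>x e. e > 0 \<Longrightarrow> \<exists>d\<in>D. dist x d < e"
    using ex_countable_dense by blast
  define B where "B = (\<lambda>(d, n). {y. dist d y < 1 / real (Suc n)}) ` (D \<times> UNIV)"
  have cB: "countable B"
    unfolding B_def using D(1) by (intro countable_image countable_SIGMA) auto
  have opB: "open U" if U: "U \<in> B" for U
  proof -
    obtain d n where U: "U = {y. dist d y < 1 / real (Suc n)}"
      using U unfolding B_def by auto
    show ?thesis
      unfolding open_dist U
    proof
      fix x assume x: "x \<in> {y. dist d y < 1 / real (Suc n)}"
      show "\<exists>e>0. \<forall>y. dist y x < e \<longrightarrow> y \<in> {y. dist d y < 1 / real (Suc n)}"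
      proof (intro exI[of _ "1 / real (Suc n) - dist d x"] conjI allI impI)
        show "0 < 1 / real (Suc n) - dist d x" using x by simp
        fix y assume "dist y x < 1 / real (Suc n) - dist d x"
        then show "y \<in> {y. dist d y < 1 / real (Suc n)}"
          using dist_triangle[of d y x] dist_commute[of x y] by simp
      qed
    qed
  qed
  have ex: "\<exists>V\<in>B. x \<in> V \<and> V \<subseteq> U" if U: "open U" "x \<in> U" for U x
  proof -
    obtain e where e: "e > 0" "\<And>y. dist y x < e \<Longrightarrow> y \<in> U"
      using U unfolding open_dist by blast
    obtain n where n: "1 / real (Suc n) < e / 2"
      using reals_Archimedean[of "e / 2"] e(1) by (auto simp: inverse_eq_divide)
    obtain d where d: "d \<in> D" "dist x d < 1 / real (Suc n)"
      using D(2)[of "1 / real (Suc n)" x] by auto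
    have "{y. dist d y < 1 / real (Suc n)} \<subseteq> U"
    proof
      fix y assume "y \<in> {y. dist d y < 1 / real (Suc n)}"
      then have "dist y x < e"
        using d(2) n dist_triangle[of y x d] dist_commute[of x d] dist_commute[of y d] by auto
      then show "y \<in> U" by (rule e(2))
    qed
    moreover have "x \<in> {y. dist d y < 1 / real (Suc n)}"
      using d(2) dist_commute[of x d] by simp
    moreover have "{y. dist d y < 1 / real (Suc n)} \<in> B"
      unfolding B_def using d(1) by (intro image_eqI[of _ _ "(d, n)"]) auto
    ultimately show ?thesis by (intro bexI[of _ "{y. dist d y < 1 / real (Suc n)}"] conjI)
  qed
  have "open U = generate_topology B U" for U
  proof
    assume U: "open U"
    have "U = \<Union>{V \<in> B. V \<subseteq> U}" using ex[OF U] by blast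
    moreover have "generate_topology B (\<Union>{V \<in> B. V \<subseteq> U})"
      by (intro generate_topology.UN) (auto intro: generate_topology.Basis)
    ultimately show "generate_topology B U" by simp
  next
    assume "generate_topology B U"
    then show "open U" by induction (auto intro: opB)
  qed
  then have "open = generate_topology B" by (intro ext)
  with cB show "\<exists>B. countable B \<and> open = generate_topology B" by (intro exI[of _ B] conjI)
qed

end

section \<open>Banach algebras with explicit carrier\<close>

text \<open>\<open>L\<^sup>p(G, A)\<close> depends on the real number \<open>p\<close> and on the measure, so it cannot be a type; the notions
  below are therefore stated for algebras with an explicit carrier set. Functions on a carrier (or on
  a character space) are normalised to be \<open>extensional\<close>, so that equal functions are equal terms.\<close>

record 'b calgebra =
  ba_carrier :: "'b set"
  ba_zero :: 'b
  ba_add :: "'b \<Rightarrow> 'b \<Rightarrow> 'b"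
  ba_mult :: "'b \<Rightarrow> 'b \<Rightarrow> 'b"
  ba_scale :: "complex \<Rightarrow> 'b \<Rightarrow> 'b"
  ba_norm :: "'b \<Rightarrow> real"

definition ba_diff :: "'b calgebra \<Rightarrow> 'b \<Rightarrow> 'b \<Rightarrow> 'b" where
  "ba_diff B x y = ba_add B x (ba_scale B (-1) y)"

text \<open>Banach algebras are taken up to equivalence of norms: multiplication is only required to be bounded,
  \<open>\<parallel>xy\<parallel> \<le> C \<parallel>x\<parallel> \<parallel>y\<parallel>\<close>. For a Haar measure \<open>\<lambda>\<close> on a compact group \<open>G\<close> the constant needed for
  \<open>L\<^sup>p(G, A)\<close> is in general not \<open>1\<close> but \<open>\<lambda>(G)\<close> to the power \<open>1 - 1/p\<close>, unless \<open>\<lambda>\<close> is normalised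
  by \<open>\<lambda>(G) = 1\<close>.\<close>

locale comm_banach_algebra =
  fixes B :: "'b calgebra"
  assumes zero_closed: "ba_zero B \<in> ba_carrier B"
    and add_closed: "\<lbrakk>x \<in> ba_carrier B; y \<in> ba_carrier B\<rbrakk> \<Longrightarrow> ba_add B x y \<in> ba_carrier B"
    and mult_closed: "\<lbrakk>x \<in> ba_carrier B; y \<in> ba_carrier B\<rbrakk> \<Longrightarrow> ba_mult B x y \<in> ba_carrier B"
    and scale_closed: "x \<in> ba_carrier B \<Longrightarrow> ba_scale B c x \<in> ba_carrier B"
    and add_assoc: "\<lbrakk>x \<in> ba_carrier B; y \<in> ba_carrier B; z \<in> ba_carrier B\<rbrakk>
      \<Longrightarrow> ba_add B (ba_add B x y) z = ba_add B x (ba_add B y z)"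
    and add_commute: "\<lbrakk>x \<in> ba_carrier B; y \<in> ba_carrier B\<rbrakk> \<Longrightarrow> ba_add B x y = ba_add B y x"
    and add_zero: "x \<in> ba_carrier B \<Longrightarrow> ba_add B (ba_zero B) x = x"
    and add_inverse: "x \<in> ba_carrier B \<Longrightarrow> ba_diff B x x = ba_zero B"
    and scale_add_right: "\<lbrakk>x \<in> ba_carrier B; y \<in> ba_carrier B\<rbrakk>
      \<Longrightarrow> ba_scale B c (ba_add B x y) = ba_add B (ba_scale B c x) (ba_scale B c y)"
    and scale_add_left: "x \<in> ba_carrier B
      \<Longrightarrow> ba_scale B (c + d) x = ba_add B (ba_scale B c x) (ba_scale B d x)"
    and scale_scale: "x \<in> ba_carrier B \<Longrightarrow> ba_scale B c (ba_scale B d x) = ba_scale B (c * d) x"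
    and scale_one: "x \<in> ba_carrier B \<Longrightarrow> ba_scale B 1 x = x"
    and mult_assoc: "\<lbrakk>x \<in> ba_carrier B; y \<in> ba_carrier B; z \<in> ba_carrier B\<rbrakk>
      \<Longrightarrow> ba_mult B (ba_mult B x y) z = ba_mult B x (ba_mult B y z)"
    and mult_commute: "\<lbrakk>x \<in> ba_carrier B; y \<in> ba_carrier B\<rbrakk> \<Longrightarrow> ba_mult B x y = ba_mult B y x"
    and mult_add: "\<lbrakk>x \<in> ba_carrier B; y \<in> ba_carrier B; z \<in> ba_carrier B\<rbrakk>
      \<Longrightarrow> ba_mult B x (ba_add B y z) = ba_add B (ba_mult B x y) (ba_mult B x z)"
    and mult_scale: "\<lbrakk>x \<in> ba_carrier B; y \<in> ba_carrier B\<rbrakk>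
      \<Longrightarrow> ba_mult B x (ba_scale B c y) = ba_scale B c (ba_mult B x y)"
    and norm_nonneg: "x \<in> ba_carrier B \<Longrightarrow> 0 \<le> ba_norm B x"
    and norm_eq_zero: "x \<in> ba_carrier B \<Longrightarrow> ba_norm B x = 0 \<longleftrightarrow> x = ba_zero B"
    and norm_triangle: "\<lbrakk>x \<in> ba_carrier B; y \<in> ba_carrier B\<rbrakk>
      \<Longrightarrow> ba_norm B (ba_add B x y) \<le> ba_norm B x + ba_norm B y"
    and norm_scale: "x \<in> ba_carrier B \<Longrightarrow> ba_norm B (ba_scale B c x) = cmod c * ba_norm B x"
    and norm_mult: "\<exists>C. \<forall>x\<in>ba_carrier B. \<forall>y\<in>ba_carrier B.
      ba_norm B (ba_mult B x y) \<le> C * ba_norm B x * ba_norm B y"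
    and complete: "\<lbrakk>\<And>n. s n \<in> ba_carrier B;
        \<And>e. e > 0 \<Longrightarrow> \<exists>N. \<forall>m\<ge>N. \<forall>n\<ge>N. ba_norm B (ba_diff B (s m) (s n)) < e\<rbrakk>
      \<Longrightarrow> \<exists>x\<in>ba_carrier B. (\<lambda>n. ba_norm B (ba_diff B (s n) x)) \<longlonglongrightarrow> 0"

definition type_algebra :: "'a::complex_banach_algebra calgebra" where
  "type_algebra = \<lparr>ba_carrier = UNIV, ba_zero = 0, ba_add = (+), ba_mult = (*),
     ba_scale = scaleC, ba_norm = norm\<rparr>"

lemma comm_banach_algebra_type_algebra:
  "comm_banach_algebra (type_algebra :: 'a::{complex_banach_algebra, comm_ring_1} calgebra)"
proof -
  have one: "scaleC 1 x = x" for x :: 'a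
    using scaleR_scaleC[of 1 x] by simp
  have minus: "scaleC (-1) x = - x" for x :: 'a
    using scaleR_scaleC[of "-1" x] by simp
  have complete: "\<exists>x. (\<lambda>n. norm (s n - x)) \<longlonglongrightarrow> 0"
    if "\<And>e. e > 0 \<Longrightarrow> \<exists>N. \<forall>m\<ge>N. \<forall>n\<ge>N. norm (s m - s n) < e" for s :: "nat \<Rightarrow> 'a"
  proof -
    have "Cauchy s" unfolding Cauchy_def dist_norm using that by simp
    then obtain x where "s \<longlonglongrightarrow> x" using Cauchy_convergent convergent_def by blast
    then have "(\<lambda>n. norm (s n - x)) \<longlonglongrightarrow> 0" by (intro tendsto_norm_zero LIM_zero)
    then show ?thesis ..
  qed
  have bounded: "\<exists>C. \<forall>x y :: 'a. norm (x * y) \<le> norm y * (C * norm x)"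
    by (intro exI[of _ 1] allI) (use norm_mult_ineq in \<open>metis mult.commute mult_1\<close>)
  show ?thesis
    unfolding comm_banach_algebra_def type_algebra_def ba_diff_def
    by (simp add: one minus scaleC_add_right scaleC_add_left scaleC_scaleC mult_scaleC_right
        norm_scaleC distrib_left add.assoc add.commute mult.assoc mult.commute
        norm_triangle_ineq)
      (use bounded complete in blast)
qed

section \<open>Characters, multipliers and BSE-algebras\<close>

definition characters :: "'b calgebra \<Rightarrow> ('b \<Rightarrow> complex) set" where
  "characters B = {\<phi> \<in> extensional (ba_carrier B).
     (\<forall>x\<in>ba_carrier B. \<forall>y\<in>ba_carrier B. \<phi> (ba_add B x y) = \<phi> x + \<phi> y) \<and>
     (\<forall>c. \<forall>x\<in>ba_carrier B. \<phi> (ba_scale B c x) = c * \<phi> x) \<and>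
     (\<forall>x\<in>ba_carrier B. \<forall>y\<in>ba_carrier B. \<phi> (ba_mult B x y) = \<phi> x * \<phi> y) \<and>
     (\<exists>x\<in>ba_carrier B. \<phi> x \<noteq> 0)}"

text \<open>The Gelfand topology is the topology of pointwise convergence on the algebra.\<close>

definition gelfand_topology :: "'b calgebra \<Rightarrow> ('b \<Rightarrow> complex) topology" where
  "gelfand_topology B =
     subtopology (product_topology (\<lambda>_. euclidean) (ba_carrier B)) (characters B)"

definition semisimple_algebra :: "'b calgebra \<Rightarrow> bool" where
  "semisimple_algebra B \<longleftrightarrow> {b \<in> ba_carrier B. \<forall>\<phi>\<in>characters B. \<phi> b = 0} = {ba_zero B}"

definition without_order :: "'b calgebra \<Rightarrow> bool" where
  "without_order B \<longleftrightarrow> (\<forall>b\<in>ba_carrier B.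
     (\<forall>x\<in>ba_carrier B. ba_mult B b x = ba_zero B) \<longrightarrow> b = ba_zero B)"

definition Cb :: "'b calgebra \<Rightarrow> (('b \<Rightarrow> complex) \<Rightarrow> complex) set" where
  "Cb B = {\<sigma> \<in> extensional (characters B).
     continuous_map (gelfand_topology B) euclidean \<sigma> \<and> bounded (\<sigma> ` characters B)}"

definition dual_norm :: "'b calgebra \<Rightarrow> ('b \<Rightarrow> complex) \<Rightarrow> real" where
  "dual_norm B F = (SUP b\<in>{b \<in> ba_carrier B. ba_norm B b \<le> 1}. cmod (F b))"

definition BSE_function :: "'b calgebra \<Rightarrow> (('b \<Rightarrow> complex) \<Rightarrow> complex) \<Rightarrow> bool" where
  "BSE_function B \<sigma> \<longleftrightarrow> (\<exists>\<beta>>0. \<forall>(n::nat) (c :: nat \<Rightarrow> complex) \<phi>.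
     (\<forall>j\<in>{1..n}. \<phi> j \<in> characters B) \<longrightarrow>
     cmod (\<Sum>j=1..n. c j * \<sigma> (\<phi> j)) \<le> \<beta> * dual_norm B (\<lambda>b. \<Sum>j=1..n. c j * \<phi> j b))"

definition C_BSE :: "'b calgebra \<Rightarrow> (('b \<Rightarrow> complex) \<Rightarrow> complex) set" where
  "C_BSE B = {\<sigma> \<in> Cb B. BSE_function B \<sigma>}"

definition multipliers :: "'b calgebra \<Rightarrow> ('b \<Rightarrow> 'b) set" where
  "multipliers B = {T \<in> ba_carrier B \<rightarrow>\<^sub>E ba_carrier B.
     (\<forall>x\<in>ba_carrier B. \<forall>y\<in>ba_carrier B. T (ba_add B x y) = ba_add B (T x) (T y)) \<and>
     (\<forall>c. \<forall>x\<in>ba_carrier B. T (ba_scale B c x) = ba_scale B c (T x)) \<and>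
     (\<exists>K. \<forall>x\<in>ba_carrier B. ba_norm B (T x) \<le> K * ba_norm B x) \<and>
     (\<forall>a\<in>ba_carrier B. \<forall>b\<in>ba_carrier B. T (ba_mult B a b) = ba_mult B a (T b))}"

text \<open>\<open>is_hat B T \<sigma>\<close> says that \<open>\<sigma>\<close> is the (unique) function \<open>T^\<close> in \<open>Cb B\<close> with \<open>(T b)^ = T^ b^\<close> for all \<open>b\<close>.\<close>

definition is_hat :: "'b calgebra \<Rightarrow> ('b \<Rightarrow> 'b) \<Rightarrow> (('b \<Rightarrow> complex) \<Rightarrow> complex) \<Rightarrow> bool" where
  "is_hat B T \<sigma> \<longleftrightarrow> \<sigma> \<in> Cb B \<and>
     (\<forall>b\<in>ba_carrier B. \<forall>\<phi>\<in>characters B. \<phi> (T b) = \<sigma> \<phi> * \<phi> b)"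

lemma is_hat_unique:
  assumes "is_hat B T \<sigma>" "is_hat B T \<tau>"
  shows "\<sigma> = \<tau>"
proof (rule extensionalityI[of _ "characters B"])
  show "\<sigma> \<in> extensional (characters B)" "\<tau> \<in> extensional (characters B)"
    using assms by (auto simp: is_hat_def Cb_def)
  fix \<phi> assume \<phi>: "\<phi> \<in> characters B"
  then obtain b where "b \<in> ba_carrier B" "\<phi> b \<noteq> 0" by (auto simp: characters_def)
  then show "\<sigma> \<phi> = \<tau> \<phi>"
    using assms \<phi> unfolding is_hat_def by (metis mult_right_cancel)
qed

definition multipliers_hat :: "'b calgebra \<Rightarrow> (('b \<Rightarrow> complex) \<Rightarrow> complex) set" where
  "multipliers_hat B = {\<sigma>. \<exists>T\<in>multipliers B. is_hat B T \<sigma>}"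

definition BSE_algebra :: "'b calgebra \<Rightarrow> bool" where
  "BSE_algebra B \<longleftrightarrow> comm_banach_algebra B \<and> without_order B \<and> C_BSE B = multipliers_hat B"

definition type_I_BSE_algebra :: "'b calgebra \<Rightarrow> bool" where
  "type_I_BSE_algebra B \<longleftrightarrow> BSE_algebra B \<and> C_BSE B = Cb B"

section \<open>Haar measure and \<open>L\<^sup>p(G, A)\<close>\<close>

text \<open>Haar measures of an abelian (additively written) topological group: non-zero translation-invariant
  Radon measures on the Borel sets. No normalisation is imposed.\<close>

definition haar_measure :: "'g::topological_ab_group_add measure \<Rightarrow> bool" where
  "haar_measure \<mu> \<longleftrightarrow> sets \<mu> = sets borel \<and> emeasure \<mu> UNIV \<noteq> 0 \<and>
     (\<forall>a. \<forall>S\<in>sets borel. emeasure \<mu> ((+) a ` S) = emeasure \<mu> S) \<and>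
     (\<forall>K. compact K \<and> K \<in> sets borel \<longrightarrow> emeasure \<mu> K < \<infinity>) \<and>
     (\<forall>S\<in>sets borel. emeasure \<mu> S = (INF U\<in>{U. open U \<and> S \<subseteq> U}. emeasure \<mu> U)) \<and>
     (\<forall>U. open U \<longrightarrow> emeasure \<mu> U = (SUP K\<in>{K. compact K \<and> K \<in> sets borel \<and> K \<subseteq> U}. emeasure \<mu> K))"

definition Lp_functions ::
    "real \<Rightarrow> 'g::topological_ab_group_add measure \<Rightarrow> ('g \<Rightarrow> 'a::complex_banach_algebra) set" where
  "Lp_functions p \<mu> = {f \<in> borel_measurable \<mu>. integrable \<mu> (\<lambda>x. norm (f x) powr p)}"

definition Lp_norm ::
    "real \<Rightarrow> 'g::topological_ab_group_add measure \<Rightarrow> ('g \<Rightarrow> 'a::complex_banach_algebra) \<Rightarrow> real" where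
  "Lp_norm p \<mu> f = (LINT x|\<mu>. norm (f x) powr p) powr (1 / p)"

definition Lp_class ::
    "real \<Rightarrow> 'g::topological_ab_group_add measure \<Rightarrow> ('g \<Rightarrow> 'a::complex_banach_algebra) \<Rightarrow> ('g \<Rightarrow> 'a) set"
  where "Lp_class p \<mu> f = {g \<in> Lp_functions p \<mu>. AE x in \<mu>. g x = f x}"

definition rep :: "'c set \<Rightarrow> 'c" where
  "rep X = (SOME f. f \<in> X)"

definition convolution ::
    "'g::topological_ab_group_add measure \<Rightarrow> ('g \<Rightarrow> 'a::{complex_banach_algebra, second_countable_topology})
      \<Rightarrow> ('g \<Rightarrow> 'a) \<Rightarrow> 'g \<Rightarrow> 'a" where
  "convolution \<mu> f g = (\<lambda>x. LINT y|\<mu>. f y * g (x - y))"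

text \<open>The elements are equivalence classes; the operations are computed on representatives and do not
  depend on their choice.\<close>

definition Lp_algebra ::
    "real \<Rightarrow> 'g::topological_ab_group_add measure
      \<Rightarrow> ('g \<Rightarrow> 'a::{complex_banach_algebra, second_countable_topology}) set calgebra" where
  "Lp_algebra p \<mu> = \<lparr>ba_carrier = Lp_class p \<mu> ` Lp_functions p \<mu>,
     ba_zero = Lp_class p \<mu> (\<lambda>_. 0),
     ba_add = (\<lambda>X Y. Lp_class p \<mu> (\<lambda>x. rep X x + rep Y x)),
     ba_mult = (\<lambda>X Y. Lp_class p \<mu> (convolution \<mu> (rep X) (rep Y))),
     ba_scale = (\<lambda>c X. Lp_class p \<mu> (\<lambda>x. scaleC c (rep X x))),
     ba_norm = (\<lambda>X. Lp_norm p \<mu> (rep X))\<rparr>"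

end

(* Convolution with a continuous self-adjoint function on a compact abelian group has a nonzero spectral
   projection of finite rank, and a minimal such projection is convolution with a multiple of a
   character; so an infinite group has infinitely many characters. For n characters with sum D, the
   trigonometric polynomial F = |D|^2 has F(0) = n^2 but norm o(n^2) in the dual of L^p, as p > 1; hence the
   constant function 1 on the character space of L^p(G, A) is not a BSE-function when G is infinite.
   Since A is unital, it is type I exactly if every function in C_b(\<Delta>(A)) is a Gelfand transform. This
   passes from L^p(G, A) to A along the idempotent 1 / mass, which cuts a clopen copy of \<Delta>(A) out of the
   character space; for finite G the converse is Fourier inversion, the character space being the
   product of the dual group and \<Delta>(A). *)

theory Submission
  imports Defs
begin

section \<open>Haar measure on a compact abelian group\<close>

text \<open>\<open>G\<close> need not have a countable base, so Borel functions on G x G may fail to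
  be measurable for the product sigma-algebra. This shapes the proof twice. The harmonic analysis
  takes place in the convolution algebra of continuous functions, where iterated integrals are
  exchanged by a compactness argument. For classes in L^p, the product with an elementary tensor of
  a character is computed by hand, and associativity does the rest. The Banach algebra axioms of
  L^p(G, A) are part of being type I, so they are given in one direction; in the other,
  \<open>G\<close> is finite and they are statements about finite sums. The dual norm of F is
  estimated by cutting functions of the unit ball at a height t: below it F contributes its
  integral, of order n, and above it a multiple t^(1-p) of n^2. Since p > 1, this factor becomes as
  small as desired for a t that does not depend on n. For infinite \<open>G\<close> the algebra has
  no unit. Hence the passage to \<open>A\<close> evaluates a multiplier at an idempotent, whereas
  for unital algebras a multiplier is multiplication by its value at the unit.\<close>

lemma t2_space_Hausdorff: "Hausdorff_space (euclidean :: 'a::t2_space topology)"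
  unfolding Hausdorff_space_def by (metis disjnt_def hausdorff open_openin)

lemma compact_t2_Urysohn:
  fixes S T :: "'a::t2_space set"
  assumes "compact (UNIV :: 'a set)" "closed S" "closed T" "S \<inter> T = {}"
  obtains f :: "'a \<Rightarrow> real" where "continuous_on UNIV f" "\<And>x. 0 \<le> f x" "\<And>x. f x \<le> 1"
    "\<And>x. x \<in> S \<Longrightarrow> f x = 0" "\<And>x. x \<in> T \<Longrightarrow> f x = 1"
proof -
  have "normal_space (euclidean :: 'a topology)"
    using assms(1) t2_space_Hausdorff
    by (intro compact_Hausdorff_or_regular_imp_normal_space) (auto simp: compact_space_def)
  then obtain f where f: "continuous_map euclidean (top_of_set {0..1::real}) f" "f ` S \<subseteq> {0}" "f ` T \<subseteq> {1}"
    using Urysohn_lemma[of "euclidean :: 'a topology" S T 0 1] assms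
    by (auto simp: disjnt_def)
  have "continuous_on UNIV f" "\<And>x. f x \<in> {0..1}"
    using f(1) by (auto simp: continuous_map_in_subtopology)
  moreover have "\<And>x. x \<in> S \<Longrightarrow> f x = 0" "\<And>x. x \<in> T \<Longrightarrow> f x = 1"
    using f(2,3) by blast+
  ultimately show ?thesis using that[of f] by simp
qed

lemma continuous_on_UNIV_compose:
  "continuous_on UNIV f \<Longrightarrow> continuous_on UNIV g \<Longrightarrow> continuous_on UNIV (\<lambda>x. f (g x))"
  by (rule continuous_on_compose2) auto

lemma continuous_on_UNIV_compose_Pair:
  assumes "continuous_on UNIV (\<lambda>(x, y). F x y)"
  shows "continuous_on UNIV (F x)" "continuous_on UNIV (\<lambda>x. F x y)"
proof -
  have "continuous_on UNIV (\<lambda>y. (\<lambda>(x, y). F x y) (x, y))"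
    by (rule continuous_on_UNIV_compose[OF assms]) (intro continuous_intros)
  then show "continuous_on UNIV (F x)" by simp
  have "continuous_on UNIV (\<lambda>x. (\<lambda>(x, y). F x y) (x, y))"
    by (rule continuous_on_UNIV_compose[OF assms]) (intro continuous_intros)
  then show "continuous_on UNIV (\<lambda>x. F x y)" by simp
qed

section \<open>Integration of continuous functions over a compact space of finite measure\<close>

locale compact_borel_measure = finite_measure M for M :: "'x::topological_space measure" +
  assumes compact_UNIV: "compact (UNIV :: 'x set)" and sets_borel: "sets M = sets borel"
begin

lemma space_UNIV [simp]: "space M = UNIV"
  using sets_eq_imp_space_eq[OF sets_borel] by simp

lemma continuous_measurable:
  fixes f :: "'x \<Rightarrow> 'b::topological_space"
  shows "continuous_on UNIV f \<Longrightarrow> f \<in> borel_measurable M"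
  using borel_measurable_continuous_onI measurable_cong_sets[OF sets_borel refl] by blast

lemma continuous_measurable_self:
  "continuous_on UNIV f \<Longrightarrow> f \<in> measurable M M"
  using continuous_measurable[of f] by (simp add: measurable_cong_sets[OF refl sets_borel, of M])

lemma continuous_bounded:
  fixes f :: "'x \<Rightarrow> 'b::real_normed_vector"
  assumes "continuous_on UNIV f"
  obtains K where "0 \<le> K" "\<And>x. norm (f x) \<le> K"
proof -
  have "bounded (range f)"
    using compact_continuous_image[OF assms compact_UNIV] by (rule compact_imp_bounded)
  then obtain K where "\<And>x. norm (f x) \<le> K" by (auto simp: bounded_iff)
  then show ?thesis using that[of K] by (meson norm_ge_zero order_trans)
qed

lemma continuous_integrable:
  fixes f :: "'x \<Rightarrow> 'b::{banach, second_countable_topology}"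
  assumes "continuous_on UNIV f"
  shows "integrable M f"
proof -
  obtain K where "\<And>x. norm (f x) \<le> K" using continuous_bounded[OF assms] by metis
  then show ?thesis
    by (intro integrable_const_bound[of _ K] continuous_measurable assms) auto
qed

lemma norm_integral_le_const:
  fixes f :: "'x \<Rightarrow> 'b::{banach, second_countable_topology}"
  assumes "\<And>x. norm (f x) \<le> K"
  shows "norm (LINT x|M. f x) \<le> measure M UNIV * K"
proof (cases "integrable M f")
  case True
  have "norm (LINT x|M. f x) \<le> (LINT x|M. K)"
    using True assms by (intro order_trans[OF integral_norm_bound] integral_mono) auto
  then show ?thesis by simp
next
  case False
  have "0 \<le> K" using assms order_trans[OF norm_ge_zero] by blast
  with False show ?thesis by (simp add: not_integrable_integral_eq)
qed

lemma norm_integral_diff_le: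
  fixes f g :: "'x \<Rightarrow> 'b::{banach, second_countable_topology}"
  assumes "integrable M f" "integrable M g" "\<And>x. norm (f x - g x) \<le> K"
  shows "norm ((LINT x|M. f x) - (LINT x|M. g x)) \<le> measure M UNIV * K"
  using norm_integral_le_const[of "\<lambda>x. f x - g x", OF assms(3)] assms(1,2) by simp

text \<open>Compactness in the variable of integration makes the sections at y close to the section
  at y0 uniformly, for y near y0.\<close>

lemma continuous_on_integral_section:
  fixes F :: "'y::topological_space \<Rightarrow> 'x \<Rightarrow> complex"
  assumes F: "continuous_on UNIV (\<lambda>(y, x). F y x)"
  shows "continuous_on UNIV (\<lambda>y. LINT x|M. F y x)"
  unfolding continuous_on_def
proof (intro ballI tendstoI)
  fix y0 :: 'y and e :: real assume e: "e > 0"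
  \<comment> \<open>The \<open>+ 1\<close> keeps the divisor positive for measure zero and makes the
    final inequality strict.\<close>
  define d where "d = e / (measure M UNIV + 1)"
  have mp: "measure M UNIV + 1 > 0" using measure_nonneg[of M UNIV] by linarith
  have d: "d > 0" using e mp by (simp add: d_def)
  obtain Y where Y: "y0 \<in> Y" "open Y" "\<forall>y\<in>Y \<inter> UNIV. \<forall>x\<in>UNIV. dist ((\<lambda>(y, x). F y x) (y, x)) ((\<lambda>(y, x). F y x) (y0, x)) \<le> d"
    by (rule continuous_on_prod_compactE[of UNIV UNIV "\<lambda>(y, x). F y x" y0 d])
      (use F compact_UNIV d in auto)
  have "dist (LINT x|M. F y x) (LINT x|M. F y0 x) < e" if "y \<in> Y" for y
  proof -
    have "norm ((LINT x|M. F y x) - (LINT x|M. F y0 x)) \<le> measure M UNIV * d"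
      using Y that by (intro norm_integral_diff_le continuous_integrable continuous_on_UNIV_compose_Pair[OF F])
        (auto simp: dist_norm)
    also have "\<dots> < (measure M UNIV + 1) * d" using d by simp
    also have "\<dots> = e" using mp by (simp add: d_def)
    finally show ?thesis by (simp add: dist_norm)
  qed
  then show "\<forall>\<^sub>F y in at y0 within UNIV. dist (LINT x|M. F y x) (LINT x|M. F y0 x) < e"
    using Y(1,2) by (auto simp: eventually_at_topological)
qed

text \<open>Near each x0 the sections F x are uniformly close to F x0, as the second space is
  compact. Finitely many such neighbourhoods cover the first space, and on the piece assigned to
  each of them F is replaced by the section at its centre.\<close>

lemma uniform_simple_approximation:
  fixes F :: "'x \<Rightarrow> 'y::topological_space \<Rightarrow> complex"
  assumes F: "continuous_on UNIV (\<lambda>(x, y). F x y)" and Y: "compact (UNIV :: 'y set)" and e: "e > 0"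
  obtains n :: nat and s P where "range P \<subseteq> sets M"
    "\<forall>x y. norm (F x y - (\<Sum>i<n. indicator (P i) x *\<^sub>R F (s i) y)) \<le> e"
proof -
  have "\<exists>U. open U \<and> x0 \<in> U \<and> (\<forall>x\<in>U. \<forall>y. norm (F x y - F x0 y) \<le> e)" for x0
  proof -
    obtain Y where "x0 \<in> Y" "open Y"
      "\<forall>x\<in>Y \<inter> UNIV. \<forall>y\<in>UNIV. dist ((\<lambda>(x, y). F x y) (x, y)) ((\<lambda>(x, y). F x y) (x0, y)) \<le> e"
      by (rule continuous_on_prod_compactE[of UNIV UNIV "\<lambda>(x, y). F x y" x0 e])
        (use F Y e in auto)
    then show ?thesis by (intro exI[of _ Y]) (auto simp: dist_norm)
  qed
  then obtain U where U: "\<And>x0. open (U x0)" "\<And>x0. x0 \<in> U x0"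
    "\<And>x0 x y. x \<in> U x0 \<Longrightarrow> norm (F x y - F x0 y) \<le> e" by metis
  obtain T where T: "finite T" "UNIV \<subseteq> (\<Union>t\<in>T. U t)"
  proof (rule compactE_image[OF compact_UNIV, of UNIV U])
    show "UNIV \<subseteq> (\<Union>x. U x)" using U(2) by auto
  qed (use U(1) in auto)
  obtain s where s: "bij_betw s {..<card T} T"
    using ex_bij_betw_nat_finite[OF T(1)] by (auto simp: atLeast0LessThan)
  \<comment> \<open>Sending x to the first neighbourhood that contains it makes the cover disjoint;
    the pieces are differences of open sets, hence Borel.\<close>
  define k where "k x = (LEAST i. i < card T \<and> x \<in> U (s i))" for x
  have ex: "\<exists>i. i < card T \<and> x \<in> U (s i)" for x
  proof -
    obtain t where t: "t \<in> T" "x \<in> U t" using T(2) by blast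
    moreover have "t \<in> s ` {..<card T}" using t(1) s by (simp add: bij_betw_def)
    ultimately show ?thesis by blast
  qed
  have k: "k x < card T" "x \<in> U (s (k x))" for x
    using LeastI_ex[OF ex[of x]] by (auto simp: k_def)
  define P where "P i = {x. k x = i}" for i
  have P: "P i \<in> sets M" for i
  proof (cases "i < card T")
    case True
    have "P i = U (s i) - (\<Union>j<i. U (s j))"
      unfolding P_def k_def
    proof (intro set_eqI iffI, goal_cases)
      case (1 x)
      then have i: "(LEAST i. i < card T \<and> x \<in> U (s i)) = i" by simp
      show ?case using LeastI_ex[OF ex[of x]] not_less_Least[of _ "\<lambda>i. i < card T \<and> x \<in> U (s i)"] True
        unfolding i by auto
    next
      case (2 x)
      then show ?case using True by (auto intro!: Least_equality)
    qed
    then show ?thesis using U(1) by (auto simp: sets_borel)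
  next
    case False
    then have "P i = {}" using k(1) by (auto simp: P_def)
    then show ?thesis by simp
  qed
  have "norm (F x y - (\<Sum>i<card T. indicator (P i) x *\<^sub>R F (s i) y)) \<le> e" for x y
  proof -
    have "(\<Sum>i<card T. indicator (P i) x *\<^sub>R F (s i) y) = F (s (k x)) y"
      using k(1)[of x]
      by (subst sum.remove[of _ "k x"]) (auto simp: P_def indicator_def intro!: sum.neutral)
    then show ?thesis using U(3)[OF k(2)] by simp
  qed
  with that[of P s "card T"] P show ?thesis by blast
qed

text \<open>Fubini's theorem for continuous integrands needs no product measurability: by compactness the
  integrand is uniformly close to a function that is simple in the first variable.\<close>

lemma integral_swap:
  fixes F :: "'x \<Rightarrow> 'x \<Rightarrow> complex"
  assumes F: "continuous_on UNIV (\<lambda>(x, y). F x y)"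
  shows "(LINT x|M. LINT y|M. F x y) = (LINT y|M. LINT x|M. F x y)"
proof -
  note Fx = continuous_on_UNIV_compose_Pair(1)[OF F] and Fy = continuous_on_UNIV_compose_Pair(2)[OF F]
  have swap: "continuous_on UNIV (\<lambda>(y, x). F x y)"
    using continuous_on_UNIV_compose[OF F, of "\<lambda>z. (snd z, fst z)"]
    by (simp add: case_prod_beta continuous_on_Pair continuous_on_fst continuous_on_snd)
  let ?m = "measure M UNIV"
  \<comment> \<open>Each of the two iterated integrals differs by at most
    \<open>?m * (?m * e)\<close> from that of the simple kernel, for which the order is irrelevant
    by linearity.\<close>
  have *: "norm ((LINT x|M. LINT y|M. F x y) - (LINT y|M. LINT x|M. F x y)) \<le> 2 * ?m * ?m * e"
    if e: "e > 0" for e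
  proof -
    obtain n :: nat and s P where range: "range P \<subseteq> sets M"
      and near0: "\<forall>x y. norm (F x y - (\<Sum>i<n. indicator (P i) x *\<^sub>R F (s i) y)) \<le> e"
      by (rule uniform_simple_approximation[OF F compact_UNIV e])
    have P: "P i \<in> sets M" for i using range by auto
    define S where "S x y = (\<Sum>i<n. indicator (P i) x *\<^sub>R F (s i) y)" for x y
    have near: "norm (F x y - S x y) \<le> e" for x y
      using near0 by (simp add: S_def)
    have PI: "integrable M (indicator (P i) :: 'x \<Rightarrow> real)" for i
      using P by (simp add: integrable_indicator_iff emeasure_eq_measure)
    have Sint: "integrable M (\<lambda>x. S x y)" "integrable M (\<lambda>y. S x y)" for x y
    proof -
      show "integrable M (\<lambda>x. S x y)"
        unfolding S_def by (intro Bochner_Integration.integrable_sum integrable_scaleR_left PI)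
      show "integrable M (\<lambda>y. S x y)"
        unfolding S_def
        by (intro Bochner_Integration.integrable_sum integrable_scaleR_right continuous_integrable[OF Fx])
    qed
    have S1: "(LINT y|M. S x y) = (\<Sum>i<n. indicator (P i) x *\<^sub>R (LINT y|M. F (s i) y))" for x
      unfolding S_def by (subst Bochner_Integration.integral_sum) (auto intro!: integrable_scaleR_right continuous_integrable[OF Fx])
    have S2: "(LINT x|M. S x y) = (\<Sum>i<n. measure M (P i) *\<^sub>R F (s i) y)" for y
      unfolding S_def using P
      by (subst Bochner_Integration.integral_sum)
        (auto simp: integrable_indicator_iff emeasure_eq_measure)
    have S3: "(LINT x|M. LINT y|M. S x y) = (\<Sum>i<n. measure M (P i) *\<^sub>R (LINT y|M. F (s i) y))"
      unfolding S1 using P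
      by (subst Bochner_Integration.integral_sum)
        (auto simp: integrable_indicator_iff emeasure_eq_measure)
    have S4: "(LINT y|M. LINT x|M. S x y) = (\<Sum>i<n. measure M (P i) *\<^sub>R (LINT y|M. F (s i) y))"
      unfolding S2 by (subst Bochner_Integration.integral_sum) (auto intro!: integrable_scaleR_right continuous_integrable[OF Fx])
    have SI1: "integrable M (\<lambda>x. LINT y|M. S x y)"
      unfolding S1 by (intro Bochner_Integration.integrable_sum integrable_scaleR_left PI)
    have SI2: "integrable M (\<lambda>y. LINT x|M. S x y)"
      unfolding S2 by (auto intro!: integrable_scaleR_right continuous_integrable[OF Fx])
    have A: "norm ((LINT x|M. LINT y|M. F x y) - (LINT x|M. LINT y|M. S x y)) \<le> ?m * (?m * e)"
      using near
      by (intro norm_integral_diff_le SI1 Sint continuous_integrable Fx continuous_on_integral_section[OF F])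
    have B: "norm ((LINT y|M. LINT x|M. F x y) - (LINT y|M. LINT x|M. S x y)) \<le> ?m * (?m * e)"
      using near
      by (intro norm_integral_diff_le SI2 Sint continuous_integrable Fy continuous_on_integral_section[OF swap])
    show ?thesis
      using norm_triangle_ineq4[of "(LINT x|M. LINT y|M. F x y) - (LINT x|M. LINT y|M. S x y)"
          "(LINT y|M. LINT x|M. F x y) - (LINT y|M. LINT x|M. S x y)"] A B S3 S4 by simp
  qed
  show ?thesis
  proof (rule ccontr)
    assume ne: "\<not> ?thesis"
    define d where "d = norm ((LINT x|M. LINT y|M. F x y) - (LINT y|M. LINT x|M. F x y))"
    have d: "d > 0" using ne by (simp add: d_def)
    \<comment> \<open>This choice of e is positive even for measure zero and yields a bound below
      d.\<close>
    have "d \<le> 2 * ?m * ?m * (d / (4 * ?m * ?m + 1))"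
      unfolding d_def by (rule *, fold d_def) (use d in \<open>simp add: add_nonneg_pos\<close>)
    moreover have "0 < 4 * ?m * ?m + 1" by (simp add: add_nonneg_pos)
    ultimately have "d * (4 * ?m * ?m + 1) \<le> 2 * ?m * ?m * d"
      by (simp add: field_simps)
    then have "d * (2 * ?m * ?m + 1) \<le> 0" by (simp add: algebra_simps)
    moreover have "d * (2 * ?m * ?m + 1) > 0" using d by (simp add: add_nonneg_pos)
    ultimately show False by linarith
  qed
qed

end

section \<open>Haar measure: translations, reflection, open sets and points\<close>

locale compact_haar = compact_borel_measure \<mu>
  for \<mu> :: "'g::{topological_ab_group_add, t2_space} measure" +
  assumes haar: "haar_measure \<mu>"
begin

abbreviation mass :: real where "mass \<equiv> measure \<mu> UNIV"

lemma mass_pos: "mass > 0"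
  using haar by (simp add: haar_measure_def emeasure_eq_measure zero_less_measure_iff)

lemma measure_translate:
  "S \<in> sets borel \<Longrightarrow> emeasure \<mu> ((+) a ` S) = emeasure \<mu> S"
  using haar[unfolded haar_measure_def, THEN conjunct2, THEN conjunct2, THEN conjunct1] by simp

lemma borel_vimage:
  fixes f :: "'g \<Rightarrow> 'g"
  assumes "continuous_on UNIV f" "S \<in> sets borel"
  shows "f -` S \<in> sets borel"
  using measurable_sets[OF borel_measurable_continuous_onI[OF assms(1)] assms(2)] by simp

lemma distr_translate: "distr \<mu> \<mu> (\<lambda>x. x + a) = \<mu>"
proof (rule measure_eqI)
  fix S assume "S \<in> sets (distr \<mu> \<mu> (\<lambda>x. x + a))"
  then have S: "S \<in> sets borel" by (simp add: sets_borel)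
  have c: "continuous_on UNIV (\<lambda>x::'g. x + a)" by (intro continuous_intros)
  have m: "(\<lambda>x. x + a) \<in> measurable \<mu> \<mu>"
    by (rule continuous_measurable_self[OF c])
  have "(\<lambda>x. x + a) -` S = (+) (- a) ` S"
  proof (intro set_eqI iffI)
    fix x assume "x \<in> (\<lambda>x. x + a) -` S"
    then show "x \<in> (+) (- a) ` S" by (intro image_eqI[of _ _ "x + a"]) auto
  qed auto
  then show "emeasure (distr \<mu> \<mu> (\<lambda>x. x + a)) S = emeasure \<mu> S"
    using measure_translate[OF S, of "- a"] S m by (simp add: emeasure_distr sets_borel)
qed simp

lemma measurable_translate: "(\<lambda>x. x + a) \<in> measurable \<mu> \<mu>"
  by (intro continuous_measurable_self continuous_intros)

lemma integral_translate:
  fixes f :: "'g \<Rightarrow> 'b::{banach, second_countable_topology}"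
  assumes "f \<in> borel_measurable \<mu>"
  shows "(LINT x|\<mu>. f (x + a)) = (LINT x|\<mu>. f x)"
  using integral_distr[OF measurable_translate[of a] assms] distr_translate by simp

text \<open>The double integral of \<open>f (y - x)\<close> is the mass times the left side or the
  mass times the right side, according to the order of integration; both inner integrals use
  translation invariance alone.\<close>

lemma integral_reflect_continuous:
  fixes f :: "'g \<Rightarrow> complex"
  assumes f: "continuous_on UNIV f"
  shows "(LINT x|\<mu>. f (- x)) = (LINT x|\<mu>. f x)"
proof -
  have cont: "continuous_on UNIV (\<lambda>(x, y). f (y - x))"
    using continuous_on_UNIV_compose[OF f, of "\<lambda>z. snd z - fst z"]
    by (simp add: case_prod_beta continuous_on_diff continuous_on_fst continuous_on_snd)
  have c: "continuous_on UNIV (\<lambda>x. f (- x))"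
    by (intro continuous_on_UNIV_compose[OF f] continuous_intros)
  have "mass * (LINT x|\<mu>. f (- x)) = (LINT y|\<mu>. LINT x|\<mu>. f (- x))" by (simp add: scaleR_conv_of_real)
  also have "\<dots> = (LINT y|\<mu>. LINT x|\<mu>. f (y - x))"
    using integral_translate[OF continuous_measurable[OF c], of "- _"] by simp
  also have "\<dots> = (LINT x|\<mu>. LINT y|\<mu>. f (y - x))"
    using integral_swap[OF cont] by simp
  also have "\<dots> = (LINT x|\<mu>. LINT y|\<mu>. f y)"
    using integral_translate[OF continuous_measurable[OF f], of "- _"] by simp
  also have "\<dots> = mass * (LINT y|\<mu>. f y)" by (simp add: scaleR_conv_of_real)
  finally show ?thesis using mass_pos by simp
qed

lemma uminus_image_eq_vimage: "uminus ` S = uminus -` (S :: 'a::group_add set)"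
proof (intro set_eqI iffI)
  fix x assume "x \<in> uminus -` S"
  then show "x \<in> uminus ` S" by (intro image_eqI[of _ _ "- x"]) auto
qed auto

lemma open_reflect: "open U \<Longrightarrow> open (uminus ` (U :: 'g set))"
  unfolding uminus_image_eq_vimage by (intro open_vimage continuous_intros)

text \<open>By inner regularity it suffices to bound the measure of compact K inside U. A Urysohn
  function that is 1 on K and 0 off U carries the invariance from continuous functions to
  sets.\<close>

lemma measure_reflect_open_le:
  assumes U: "open U"
  shows "emeasure \<mu> U \<le> emeasure \<mu> (uminus ` U)"
proof -
  have op: "open (uminus ` U)" by (rule open_reflect[OF U])
  have "emeasure \<mu> K \<le> emeasure \<mu> (uminus ` U)" if K: "compact K" "K \<in> sets borel" "K \<subseteq> U" for K
  proof -
    have "closed K" using K(1) by (rule compact_imp_closed)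
    then obtain f :: "'g \<Rightarrow> real" where f: "continuous_on UNIV f" "\<And>x. 0 \<le> f x" "\<And>x. f x \<le> 1"
      "\<And>x. x \<in> - U \<Longrightarrow> f x = 0" "\<And>x. x \<in> K \<Longrightarrow> f x = 1"
      using compact_t2_Urysohn[of "- U" K] compact_UNIV U K(3) by (auto simp: closed_def)
    have c: "continuous_on UNIV (\<lambda>x. f (- x))"
      by (intro continuous_on_UNIV_compose[OF f(1)] continuous_intros)
    have "complex_of_real (LINT x|\<mu>. f (- x)) = complex_of_real (LINT x|\<mu>. f x)"
      using integral_reflect_continuous[of "\<lambda>x. complex_of_real (f x)"] f(1)
      by (simp add: continuous_on_of_real)
    then have eq: "(LINT x|\<mu>. f (- x)) = (LINT x|\<mu>. f x)" by simp
    have "measure \<mu> K = (LINT x|\<mu>. indicator K x)" using K(2) by (simp add: sets_borel)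
    also have "\<dots> \<le> (LINT x|\<mu>. f x)"
      using K(2) f
      by (intro integral_mono continuous_integrable[OF f(1)])
        (auto simp: sets_borel integrable_indicator_iff emeasure_eq_measure split: split_indicator)
    also have "\<dots> = (LINT x|\<mu>. f (- x))" by (simp add: eq)
    also have "\<dots> \<le> (LINT x|\<mu>. indicator (uminus ` U) x)"
    proof (intro integral_mono continuous_integrable[OF c])
      show "integrable \<mu> (indicator (uminus ` U) :: 'g \<Rightarrow> real)"
        using op by (auto simp: sets_borel integrable_indicator_iff emeasure_eq_measure)
      fix x
      show "f (- x) \<le> indicator (uminus ` U) x"
        using f(3)[of "- x"] f(4)[of "- x"] by (cases "- x \<in> U") (auto simp: uminus_image_eq_vimage)
    qed
    also have "\<dots> = measure \<mu> (uminus ` U)" using op by (simp add: sets_borel)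
    finally show ?thesis by (simp add: emeasure_eq_measure)
  qed
  moreover have "emeasure \<mu> U = (SUP K\<in>{K. compact K \<and> K \<in> sets borel \<and> K \<subseteq> U}. emeasure \<mu> K)"
    using haar U unfolding haar_measure_def by blast
  ultimately show ?thesis by (auto intro!: SUP_least)
qed


lemma measure_reflect_le:
  assumes "S \<in> sets borel"
  shows "emeasure \<mu> S \<le> emeasure \<mu> (uminus ` S)"
proof -
  have S': "uminus ` S \<in> sets borel"
    using borel_vimage[OF _ assms, of uminus] by (simp add: continuous_on_minus uminus_image_eq_vimage)
  have "emeasure \<mu> S \<le> emeasure \<mu> U" if U: "open U" "uminus ` S \<subseteq> U" for U
  proof -
    have "S \<subseteq> uminus ` U" using U(2) by (auto simp: uminus_image_eq_vimage[of U])
    then have "emeasure \<mu> S \<le> emeasure \<mu> (uminus ` U)"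
      using open_reflect[OF U(1)] by (intro emeasure_mono) (auto simp: sets_borel)
    also have "\<dots> \<le> emeasure \<mu> (uminus ` uminus ` U)"
      by (intro measure_reflect_open_le open_reflect U)
    finally show ?thesis by (simp add: image_image)
  qed
  moreover have "emeasure \<mu> (uminus ` S) = (INF U\<in>{U. open U \<and> uminus ` S \<subseteq> U}. emeasure \<mu> U)"
    using haar S' unfolding haar_measure_def by blast
  ultimately show ?thesis by (auto intro!: INF_greatest)
qed

lemma measurable_reflect: "uminus \<in> measurable \<mu> \<mu>"
  by (intro continuous_measurable_self continuous_intros)

lemma distr_reflect: "distr \<mu> \<mu> uminus = \<mu>"
proof (rule measure_eqI)
  fix S assume "S \<in> sets (distr \<mu> \<mu> uminus)"
  then have S: "S \<in> sets borel" by (simp add: sets_borel)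
  note v = uminus_image_eq_vimage[symmetric, of S]
  have S': "uminus ` S \<in> sets borel"
    using borel_vimage[OF _ S, of uminus] by (simp add: continuous_on_minus v)
  show "emeasure (distr \<mu> \<mu> uminus) S = emeasure \<mu> S"
    using measure_reflect_le[OF S] measure_reflect_le[OF S'] S measurable_reflect
    by (simp add: emeasure_distr sets_borel v image_image)
qed simp

lemma measurable_point_reflect: "(\<lambda>x. a - x) \<in> measurable \<mu> \<mu>"
  using measurable_comp[OF measurable_reflect measurable_translate[of a]] by (simp add: o_def)

lemma distr_point_reflect: "distr \<mu> \<mu> (\<lambda>x. a - x) = \<mu>"
  using distr_distr[OF measurable_translate[of a] measurable_reflect]
  by (simp add: distr_reflect distr_translate o_def)

lemma integral_point_reflect:
  fixes f :: "'g \<Rightarrow> 'b::{banach, second_countable_topology}"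
  assumes "f \<in> borel_measurable \<mu>"
  shows "(LINT x|\<mu>. f (a - x)) = (LINT x|\<mu>. f x)"
  using integral_distr[OF measurable_point_reflect[of a] assms] distr_point_reflect by simp

lemma AE_point_reflect:
  assumes "AE x in \<mu>. P x"
  shows "AE x in \<mu>. P (a - x)"
  using AE_distrD[OF measurable_point_reflect[of a], of P] assms unfolding distr_point_reflect .

text \<open>Finitely many translates of U cover the compact group, so a null set U would make the
  whole group null.\<close>

lemma open_measure_pos:
  assumes U: "open U" "U \<noteq> {}"
  shows "measure \<mu> U > 0"
proof (rule ccontr)
  assume "\<not> measure \<mu> U > 0"
  then have 0: "emeasure \<mu> U = 0" by (simp add: emeasure_eq_measure order.antisym not_less)
  have op: "open ((+) a ` U)" for a
  proof -
    have "(+) a ` U = (\<lambda>x. x - a) -` U"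
    proof (intro set_eqI iffI)
      fix x assume "x \<in> (\<lambda>x. x - a) -` U"
      then show "x \<in> (+) a ` U" by (intro image_eqI[of _ _ "x - a"]) auto
    qed auto
    then show ?thesis using open_vimage[OF U(1), of "\<lambda>x. x - a"]
      by (simp add: continuous_on_diff)
  qed
  obtain u where u: "u \<in> U" using U(2) by auto
  have "UNIV \<subseteq> (\<Union>a. (+) a ` U)"
  proof
    fix x
    have "x = (x - u) + u" by simp
    then show "x \<in> (\<Union>a. (+) a ` U)" using u by blast
  qed
  then obtain T where T: "finite T" "UNIV \<subseteq> (\<Union>a\<in>T. (+) a ` U)"
    by (rule compactE_image[OF compact_UNIV, of UNIV "\<lambda>a. (+) a ` U", rotated]) (use op in auto)
  have "emeasure \<mu> (\<Union>a\<in>T. (+) a ` U) \<le> (\<Sum>a\<in>T. emeasure \<mu> ((+) a ` U))"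
    using T(1) op by (intro emeasure_subadditive_finite) (auto simp: sets_borel)
  also have "\<dots> = 0"
    using 0 U(1) measure_translate[of U] by (intro sum.neutral) (metis borel_open)
  finally have "emeasure \<mu> (\<Union>a\<in>T. (+) a ` U) = 0" by simp
  then have "emeasure \<mu> UNIV = 0" using T(2) by (simp add: top.extremum_unique)
  then show False using mass_pos by (simp add: emeasure_eq_measure)
qed

text \<open>The set where f is positive is open, so it would have positive measure if it were
  nonempty. This gives the definiteness of \<open>sqnorm\<close> on continuous functions.\<close>

lemma continuous_zero_if_integral_zero:
  fixes f :: "'g \<Rightarrow> real"
  assumes f: "continuous_on UNIV f" "\<And>x. 0 \<le> f x" "(LINT x|\<mu>. f x) = 0"
  shows "f x = 0"
proof (rule ccontr)
  assume "f x \<noteq> 0"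
  then have pos: "f x > 0" using f(2)[of x] by simp
  have "AE x in \<mu>. f x = 0"
    using integral_nonneg_eq_0_iff_AE[OF continuous_integrable[OF f(1)]] f by simp
  moreover have op: "open {x. f x > 0}"
    using open_Collect_less[OF continuous_on_const f(1)] .
  ultimately have "emeasure \<mu> {x. f x > 0} = 0"
    by (subst (asm) AE_iff_measurable[of "{x. f x > 0}"]) 
       (use f(2) in \<open>auto simp: sets_borel order_less_le\<close>)
  moreover have "measure \<mu> {x. f x > 0} > 0" using open_measure_pos[OF op] pos by blast
  ultimately show False by (simp add: emeasure_eq_measure)
qed

text \<open>All points have the same measure, which must vanish because infinitely many of them fit
  into a finite mass; outer regularity at 0 gives U. A bump function on U will have uniformly small
  Fourier coefficients.\<close>

lemma infinite_small_neighbourhood: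
  assumes inf: "infinite (UNIV :: 'g set)" and e: "e > 0"
  obtains U where "open U" "0 \<in> U" "measure \<mu> U < e"
proof -
  have single: "measure \<mu> {x} = measure \<mu> {0}" for x
    using measure_translate[of "{0}" x] by (simp add: emeasure_eq_measure)
  have "measure \<mu> {0} = 0"
  proof (rule ccontr)
    assume "measure \<mu> {0} \<noteq> 0"
    then have c: "measure \<mu> {0} > 0" by (simp add: zero_less_measure_iff)
    obtain n where n: "mass < real n * measure \<mu> {0}" using reals_Archimedean3[OF c] by blast
    obtain F :: "'g set" where F: "finite F" "card F = n"
      using infinite_arbitrarily_large[OF inf] by blast
    have "measure \<mu> F = (\<Sum>x\<in>F. measure \<mu> {x})"
      by (rule finite_measure_eq_sum_singleton[OF F(1)]) (simp add: sets_borel)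
    also have "\<dots> = (\<Sum>x\<in>F. measure \<mu> {0})" by (intro sum.cong refl single)
    also have "\<dots> = real n * measure \<mu> {0}" using F by simp
    finally have "measure \<mu> F > mass" using n by simp
    then show False using bounded_measure[of F] by simp
  qed
  moreover have "emeasure \<mu> {0} = (INF U\<in>{U. open U \<and> {0} \<subseteq> U}. emeasure \<mu> U)"
    using haar unfolding haar_measure_def by auto
  ultimately have "(INF U\<in>{U. open U \<and> {0} \<subseteq> U}. emeasure \<mu> U) = 0"
    using emeasure_eq_measure[of "{0}"] by simp
  then have "(INF U\<in>{U. open U \<and> {0} \<subseteq> U}. emeasure \<mu> U) < ennreal e" using e by simp
  then obtain U where "open U" "0 \<in> U" "emeasure \<mu> U < ennreal e"
    by (auto simp: INF_less_iff)
  then show ?thesis using that e by (simp add: emeasure_eq_measure ennreal_less_iff)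
qed

end

section \<open>Convolution and characters of a compact abelian group\<close>

text \<open>Meant for the squared norms of convolution powers. Log-convexity makes the ratios
  \<open>a (Suc n) / a n\<close> increase to a limit l, so that \<open>a n / l ^ n\<close>
  decreases. Submultiplicativity keeps the ratios bounded and, divided by \<open>a k\<close> with k
  tending to infinity, bounds the powers of l; the last bound later keeps the normalised limit away
  from zero.\<close>

lemma log_convex_seq_limit:
  fixes a :: "nat \<Rightarrow> real"
  assumes pos: "\<And>n. a n > 0"
    and lc: "\<And>n. (a (Suc n))\<^sup>2 \<le> a n * a (Suc (Suc n))"
    and sub: "\<And>n k. a (n + k + 1) \<le> m * a n * a k"
  obtains l where "l > 0" "convergent (\<lambda>n. a n / l ^ n)" "\<And>n. l ^ (n + 1) \<le> m * a n"
proof -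
  define r where "r n = a (Suc n) / a n" for n
  have rpos: "r n > 0" for n using pos by (simp add: r_def)
  have "r n \<le> r (Suc n)" for n
    unfolding r_def using lc[of n] pos[of n] pos[of "Suc n"]
    by (simp add: field_simps power2_eq_square)
  then have inc: "incseq r" by (rule incseq_SucI)
  have "r n \<le> m * a 0" for n
    using sub[of 0 n] pos[of n] by (simp add: r_def field_simps)
  then obtain l where l: "r \<longlonglongrightarrow> l" "\<And>n. r n \<le> l"
    using incseq_convergent[OF inc] by metis
  have lpos: "l > 0" using rpos[of 0] l(2)[of 0] by linarith
  define d where "d n = a n / l ^ n" for n
  have "d (Suc n) \<le> d n" for n
  proof -
    have "a (Suc n) \<le> l * a n" using l(2)[of n] pos[of n] by (simp add: r_def field_simps)
    then show ?thesis using lpos by (simp add: d_def field_simps)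
  qed
  then have "decseq d" by (rule decseq_SucI)
  moreover have "0 \<le> d n" for n using pos[of n] lpos by (simp add: d_def less_imp_le)
  ultimately have conv: "convergent d" unfolding convergent_def by (metis decseq_convergent)
  \<comment> \<open>The quotient is a product of n consecutive ratios, each tending to l.\<close>
  have lim: "(\<lambda>k. a (n + k) / a k) \<longlonglongrightarrow> l ^ n" for n
  proof (induction n)
    case 0
    then show ?case using pos by (simp add: less_imp_neq[symmetric])
  next
    case (Suc n)
    have "(\<lambda>k. r (k + n) * (a (n + k) / a k)) \<longlonglongrightarrow> l * l ^ n"
      by (intro tendsto_mult Suc LIMSEQ_ignore_initial_segment l(1))
    moreover have "r (k + n) * (a (n + k) / a k) = a (Suc n + k) / a k" for k
      using pos[of "n + k"] by (simp add: r_def add.commute)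
    ultimately show ?case by (simp only: power_Suc)
  qed
  have "l ^ (n + 1) \<le> m * a n" for n
  proof (rule LIMSEQ_le_const2[OF lim[of "n + 1"]])
    show "\<exists>N. \<forall>k\<ge>N. a (n + 1 + k) / a k \<le> m * a n"
      using sub[of n] pos by (auto simp: field_simps add.commute add.left_commute)
  qed
  with that lpos conv show ?thesis unfolding d_def by blast
qed

section \<open>Unitary characters of the group and their orthogonality\<close>

definition group_char :: "('g::topological_ab_group_add \<Rightarrow> complex) \<Rightarrow> bool" where
  "group_char \<gamma> \<longleftrightarrow> continuous_on UNIV \<gamma> \<and> (\<forall>x y. \<gamma> (x + y) = \<gamma> x * \<gamma> y) \<and> (\<forall>x. cmod (\<gamma> x) = 1)"

lemma group_char_cont: "group_char \<gamma> \<Longrightarrow> continuous_on UNIV \<gamma>"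
  and group_char_add: "group_char \<gamma> \<Longrightarrow> \<gamma> (x + y) = \<gamma> x * \<gamma> y"
  and group_char_norm: "group_char \<gamma> \<Longrightarrow> cmod (\<gamma> x) = 1"
  by (auto simp: group_char_def)

lemma group_char_cnj_mult: "group_char \<gamma> \<Longrightarrow> cnj (\<gamma> x) * \<gamma> x = 1"
  by (simp add: group_char_norm mult.commute complex_norm_square[symmetric])

lemma group_char_zero:
  assumes "group_char \<gamma>"
  shows "\<gamma> 0 = 1"
  using group_char_add[OF assms, of 0 0] group_char_norm[OF assms, of 0] by auto

lemma group_char_minus:
  assumes "group_char \<gamma>"
  shows "\<gamma> (- x) = cnj (\<gamma> x)"
proof -
  have "\<gamma> (- x) * \<gamma> x = cnj (\<gamma> x) * \<gamma> x"
    using group_char_add[OF assms, of "- x" x] group_char_zero[OF assms] group_char_cnj_mult[OF assms]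
    by simp
  then show ?thesis using group_char_norm[OF assms, of x] by auto
qed

lemma group_char_diff: "group_char \<gamma> \<Longrightarrow> \<gamma> (x - y) = \<gamma> x * cnj (\<gamma> y)"
  using group_char_add[of \<gamma> x "- y"] group_char_minus[of \<gamma> y] by simp

lemma group_char_mult_cnj:
  "group_char \<gamma> \<Longrightarrow> group_char \<psi> \<Longrightarrow> group_char (\<lambda>x. \<gamma> x * cnj (\<psi> x))"
  by (auto simp: group_char_def norm_mult intro!: continuous_intros)

context compact_haar
begin

text \<open>Translation by a preserves the integral and also multiplies it by
  \<open>\<gamma> a\<close>.\<close>

lemma group_char_integral_eq_0:
  assumes \<gamma>: "group_char \<gamma>" and ne: "\<gamma> a \<noteq> 1"
  shows "(LINT x|\<mu>. \<gamma> x) = 0"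
proof -
  have "(LINT x|\<mu>. \<gamma> x) = (LINT x|\<mu>. \<gamma> (x + a))"
    by (intro integral_translate[symmetric] continuous_measurable group_char_cont \<gamma>)
  also have "\<dots> = (LINT x|\<mu>. \<gamma> x) * \<gamma> a" by (simp add: group_char_add[OF \<gamma>])
  finally show ?thesis using ne by simp
qed

lemma group_char_orthogonal:
  assumes "group_char \<gamma>" "group_char \<psi>"
  shows "(LINT x|\<mu>. \<gamma> x * cnj (\<psi> x)) = (if \<gamma> = \<psi> then of_real mass else 0)"
proof (cases "\<gamma> = \<psi>")
  case True
  then show ?thesis
    using group_char_cnj_mult[OF assms(1)] by (simp add: mult.commute scaleR_conv_of_real)
next
  case False
  then obtain a where "\<gamma> a \<noteq> \<psi> a" by auto
  then have "\<gamma> a * cnj (\<psi> a) \<noteq> 1"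
    using group_char_cnj_mult[OF assms(2), of a] by (metis mult.assoc mult.right_neutral mult_1)
  then show ?thesis
    using group_char_integral_eq_0[OF group_char_mult_cnj[OF assms]] False by simp
qed

section \<open>The involutive convolution algebra of continuous scalar functions\<close>

definition conv :: "('g \<Rightarrow> complex) \<Rightarrow> ('g \<Rightarrow> complex) \<Rightarrow> 'g \<Rightarrow> complex" (infixr "\<star>" 70) where
  "(f \<star> g) = (\<lambda>x. LINT y|\<mu>. f y * g (x - y))"

text \<open>The involution of the group algebra: convolution with \<open>adj f\<close> is the L^2
  adjoint of convolution with \<open>f\<close>.\<close>

definition adj :: "('g \<Rightarrow> complex) \<Rightarrow> 'g \<Rightarrow> complex" where
  "adj f = (\<lambda>x. cnj (f (- x)))"

definition sqnorm :: "('g \<Rightarrow> complex) \<Rightarrow> real" where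
  "sqnorm f = (LINT x|\<mu>. (cmod (f x))\<^sup>2)"

abbreviation cont :: "('g \<Rightarrow> complex) \<Rightarrow> bool" where "cont f \<equiv> continuous_on UNIV f"

lemma conv_integrand_cont:
  assumes "cont f" "cont g"
  shows "continuous_on UNIV (\<lambda>(x, y). f y * g (x - y))"
  unfolding case_prod_beta
  by (intro continuous_intros continuous_on_UNIV_compose[OF assms(1)] continuous_on_UNIV_compose[OF assms(2)])

lemma conv_cont: "cont f \<Longrightarrow> cont g \<Longrightarrow> cont (f \<star> g)"
  unfolding conv_def by (rule continuous_on_integral_section[OF conv_integrand_cont])

lemma conv_integrable: "cont f \<Longrightarrow> cont g \<Longrightarrow> integrable \<mu> (\<lambda>y. f y * g (x - y))"
  by (intro continuous_integrable continuous_on_UNIV_compose_Pair(1)[OF conv_integrand_cont])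

lemma conv_commute:
  assumes "cont f" "cont g"
  shows "f \<star> g = g \<star> f"
proof
  fix x
  have "(LINT y|\<mu>. f (x - y) * g (x - (x - y))) = (LINT y|\<mu>. f y * g (x - y))"
    by (rule integral_point_reflect[of "\<lambda>y. f y * g (x - y)"])
      (intro continuous_measurable continuous_on_UNIV_compose_Pair(1)[OF conv_integrand_cont] assms)
  then show "(f \<star> g) x = (g \<star> f) x" by (simp add: conv_def mult.commute)
qed

lemma conv_lin_left:
  assumes "cont f" "cont g" "cont h"
  shows "((\<lambda>x. a * f x + b * g x) \<star> h) x = a * (f \<star> h) x + b * (g \<star> h) x"
proof -
  have "(LINT y|\<mu>. (a * f y + b * g y) * h (x - y))
      = (LINT y|\<mu>. a * (f y * h (x - y)) + b * (g y * h (x - y)))"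
    by (simp add: algebra_simps)
  also have "\<dots> = a * (f \<star> h) x + b * (g \<star> h) x"
    unfolding conv_def using conv_integrable assms by simp
  finally show ?thesis by (simp add: conv_def)
qed

lemma conv_lin_right:
  assumes "cont f" "cont g" "cont h"
  shows "(h \<star> (\<lambda>x. a * f x + b * g x)) x = a * (h \<star> f) x + b * (h \<star> g) x"
  using conv_lin_left[OF assms, of a b x] assms
  by (simp add: conv_commute[of h] continuous_intros)

lemma conv_scale_left: "((\<lambda>x. a * f x) \<star> h) x = a * (f \<star> h) x"
  by (simp add: conv_def mult.assoc)

lemma conv_scale_right: "(h \<star> (\<lambda>x. a * f x)) x = a * (h \<star> f) x"
  by (simp add: conv_def mult.left_commute)

lemma conv_zero: "(\<lambda>x. 0) \<star> h = (\<lambda>x. 0)" "h \<star> (\<lambda>x. 0) = (\<lambda>x. 0)"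
  by (simp_all add: conv_def)

text \<open>Exchange the integrals over y and z, and translate y by z in the inner one.\<close>

lemma conv_assoc:
  assumes f: "cont f" and g: "cont g" and h: "cont h"
  shows "(f \<star> g) \<star> h = f \<star> (g \<star> h)"
proof
  fix x
  have c: "continuous_on UNIV (\<lambda>(y, z). f z * g (y - z) * h (x - y))"
    unfolding case_prod_beta
    by (intro continuous_intros continuous_on_UNIV_compose[OF f] continuous_on_UNIV_compose[OF g]
        continuous_on_UNIV_compose[OF h])
  have "((f \<star> g) \<star> h) x = (LINT y|\<mu>. LINT z|\<mu>. f z * g (y - z) * h (x - y))"
    by (simp add: conv_def)
  also have "\<dots> = (LINT z|\<mu>. LINT y|\<mu>. f z * g (y - z) * h (x - y))"
    by (rule integral_swap[OF c])
  also have "\<dots> = (LINT z|\<mu>. f z * (LINT y|\<mu>. g y * h (x - z - y)))"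
  proof (intro Bochner_Integration.integral_cong refl)
    fix z
    have "cont (\<lambda>y. g y * h (x - z - y))"
      by (intro continuous_intros g continuous_on_UNIV_compose[OF h])
    then have "(LINT y|\<mu>. g (y + - z) * h (x - z - (y + - z))) = (LINT y|\<mu>. g y * h (x - z - y))"
      by (intro integral_translate[of "\<lambda>y. g y * h (x - z - y)"] continuous_measurable)
    then show "(LINT y|\<mu>. f z * g (y - z) * h (x - y)) = f z * (LINT y|\<mu>. g y * h (x - z - y))"
      by (simp add: mult.assoc)
  qed
  also have "\<dots> = (f \<star> (g \<star> h)) x" by (simp add: conv_def)
  finally show "((f \<star> g) \<star> h) x = (f \<star> (g \<star> h)) x" .
qed

lemma adj_cont:
  assumes "cont f"
  shows "cont (adj f)"
  unfolding adj_def by (intro continuous_on_cnj continuous_on_UNIV_compose[OF assms] continuous_intros)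

lemma adj_eqD: "adj f = f \<Longrightarrow> cnj (f (- x)) = f x"
  unfolding adj_def by (rule fun_cong)

lemma adj_adj [simp]: "adj (adj f) = f"
  by (simp add: adj_def)

lemma adj_conv:
  assumes "cont f" "cont g"
  shows "adj (f \<star> g) = adj f \<star> adj g"
proof
  fix x
  let ?k = "\<lambda>y. cnj (f y) * cnj (g (- x - y))"
  have k: "cont ?k"
    by (intro continuous_intros continuous_on_UNIV_compose[OF assms(2)] assms(1))
  have "adj (f \<star> g) x = (LINT y|\<mu>. ?k y)"
    unfolding adj_def conv_def by (subst Bochner_Integration.integral_cnj[symmetric]) simp
  also have "\<dots> = (LINT y|\<mu>. ?k (0 - y))"
    by (intro integral_point_reflect[symmetric] continuous_measurable k)
  also have "\<dots> = (adj f \<star> adj g) x" by (simp add: adj_def conv_def add.commute)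
  finally show "adj (f \<star> g) x = (adj f \<star> adj g) x" .
qed

lemma sqnorm_nonneg: "0 \<le> sqnorm f"
  by (simp add: sqnorm_def)

lemma cont_cmod_power2: "cont f \<Longrightarrow> continuous_on UNIV (\<lambda>x. (cmod (f x))\<^sup>2)"
  by (intro continuous_intros)

lemma sqnorm_eq_0: "cont f \<Longrightarrow> sqnorm f = 0 \<Longrightarrow> f x = 0"
  unfolding sqnorm_def using continuous_zero_if_integral_zero[OF cont_cmod_power2, of f x] by simp

lemma sqnorm_pos: "cont f \<Longrightarrow> f x \<noteq> 0 \<Longrightarrow> sqnorm f > 0"
  using sqnorm_eq_0 sqnorm_nonneg[of f] by (metis order_le_less)

text \<open>Evaluation at 0 turns products into inner products; this is how norms of powers and of
  idempotents are read off from single values.\<close>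

lemma conv_adj_zero: "(f \<star> adj f) 0 = of_real (sqnorm f)"
  unfolding conv_def adj_def sqnorm_def
  by (simp add: complex_norm_square[symmetric] flip: of_real_power integral_complex_of_real)

lemma conv_self_zero: "adj f = f \<Longrightarrow> (f \<star> f) 0 = of_real (sqnorm f)"
  using conv_adj_zero[of f] by simp

lemma cmod_conv_le:
  assumes f: "cont f" and g: "cont g"
  shows "cmod ((f \<star> g) x) \<le> sqrt (sqnorm f * sqnorm g)"
proof (cases "sqnorm f = 0 \<or> sqnorm g = 0")
  case True
  then have "f = (\<lambda>_. 0) \<or> g = (\<lambda>_. 0)" using sqnorm_eq_0[OF f] sqnorm_eq_0[OF g] by auto
  then show ?thesis by (auto simp: conv_zero sqnorm_nonneg)
next
  case False
  then have pos: "sqnorm f > 0" "sqnorm g > 0" using sqnorm_nonneg order_le_less by metis+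
  \<comment> \<open>Cauchy-Schwarz is derived from |ab| \<le> t |a|^2 / 2 + |b|^2 / (2 t); this t
    minimises the integrated right side.\<close>
  define t where "t = sqrt (sqnorm g / sqnorm f)"
  have t: "t > 0" using pos by (simp add: t_def)
  have gc: "continuous_on UNIV (\<lambda>y. (cmod (g (x - y)))\<^sup>2)"
    by (intro continuous_intros continuous_on_UNIV_compose[OF g])
  have "cmod ((f \<star> g) x) \<le> (LINT y|\<mu>. cmod (f y * g (x - y)))"
    unfolding conv_def by (rule integral_norm_bound)
  also have "\<dots> \<le> (LINT y|\<mu>. t / 2 * (cmod (f y))\<^sup>2 + 1 / (2 * t) * (cmod (g (x - y)))\<^sup>2)"
  proof (intro integral_mono)
    show "integrable \<mu> (\<lambda>y. cmod (f y * g (x - y)))" using conv_integrable[OF f g] by simp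
    show "integrable \<mu> (\<lambda>y. t / 2 * (cmod (f y))\<^sup>2 + 1 / (2 * t) * (cmod (g (x - y)))\<^sup>2)"
      by (intro Bochner_Integration.integrable_add integrable_mult_right continuous_integrable gc cont_cmod_power2 f)
    fix y
    have "0 \<le> (t * cmod (f y) - cmod (g (x - y)))\<^sup>2" by simp
    then show "cmod (f y * g (x - y)) \<le> t / 2 * (cmod (f y))\<^sup>2 + 1 / (2 * t) * (cmod (g (x - y)))\<^sup>2"
      using t by (simp add: norm_mult field_simps power2_eq_square)
  qed
  also have "\<dots> = t / 2 * sqnorm f + 1 / (2 * t) * (LINT y|\<mu>. (cmod (g (x - y)))\<^sup>2)"
    unfolding sqnorm_def
    by (subst Bochner_Integration.integral_add)
      (auto intro!: integrable_mult_right continuous_integrable[OF gc] continuous_integrable[OF cont_cmod_power2[OF f]])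
  also have "(LINT y|\<mu>. (cmod (g (x - y)))\<^sup>2) = sqnorm g"
    unfolding sqnorm_def
    by (rule integral_point_reflect[OF continuous_measurable[OF cont_cmod_power2[OF g]]])
  also have "t / 2 * sqnorm f + 1 / (2 * t) * sqnorm g = sqrt (sqnorm f * sqnorm g)"
  proof -
    define u v where "u = sqrt (sqnorm f)" and "v = sqrt (sqnorm g)"
    have uv: "u > 0" "v > 0" "sqnorm f = u * u" "sqnorm g = v * v"
      using pos by (auto simp: u_def v_def)
    have "t = v / u" by (simp add: t_def u_def v_def real_sqrt_divide)
    moreover have "(v / u) / 2 * (u * u) + 1 / (2 * (v / u)) * (v * v) = u * v"
      using uv(1,2) by (simp add: field_simps)
    ultimately have "t / 2 * (u * u) + 1 / (2 * t) * (v * v) = u * v" by simp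
    then show ?thesis using uv by (simp add: real_sqrt_mult)
  qed
  finally show ?thesis .
qed

lemma sqnorm_le_const:
  assumes "cont f" "\<And>x. cmod (f x) \<le> K"
  shows "sqnorm f \<le> mass * K\<^sup>2"
proof -
  have "sqnorm f \<le> (LINT x|\<mu>. K\<^sup>2)"
    unfolding sqnorm_def
    by (intro integral_mono continuous_integrable[OF cont_cmod_power2[OF assms(1)]])
      (auto intro!: power_mono assms(2))
  then show ?thesis by simp
qed

lemma sqnorm_conv_le:
  assumes "cont f" "cont g"
  shows "sqnorm (f \<star> g) \<le> mass * sqnorm f * sqnorm g"
  using sqnorm_le_const[OF conv_cont[OF assms] cmod_conv_le[OF assms]]
  by (simp add: sqnorm_nonneg mult.assoc)

lemma sqnorm_diff_self_adjoint:
  assumes "cont f" "cont g" "adj f = f" "adj g = g"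
  shows "sqnorm (\<lambda>x. f x - g x) = sqnorm f + sqnorm g - 2 * Re ((f \<star> g) 0)"
proof -
  have 1: "(\<lambda>x. f x - g x) = (\<lambda>x. 1 * f x + (- 1) * g x)" by simp
  have c: "cont (\<lambda>x. f x - g x)" by (intro continuous_intros assms)
  have "adj (\<lambda>x. f x - g x) = (\<lambda>x. f x - g x)"
    using fun_cong[OF assms(3)] fun_cong[OF assms(4)] by (auto simp: adj_def)
  from conv_self_zero[OF this]
  have "of_real (sqnorm (\<lambda>x. f x - g x)) = ((\<lambda>x. f x - g x) \<star> (\<lambda>x. f x - g x)) 0" by simp
  also have "\<dots> = (f \<star> (\<lambda>x. f x - g x)) 0 - (g \<star> (\<lambda>x. f x - g x)) 0"
    using conv_lin_left[OF assms(1,2) c, of 1 "- 1"] by simp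
  also have "\<dots> = (f \<star> f) 0 - (f \<star> g) 0 - ((g \<star> f) 0 - (g \<star> g) 0)"
    using conv_lin_right[OF assms(1,2,1), of 1 "- 1"] conv_lin_right[OF assms(1,2,2), of 1 "- 1"] by simp
  also have "\<dots> = of_real (sqnorm f) + of_real (sqnorm g) - 2 * (f \<star> g) 0"
    using conv_commute[OF assms(1,2)] by (simp add: conv_self_zero assms)
  finally show ?thesis by (simp add: complex_eq_iff)
qed

text \<open>Expanding the product around the limits leaves three error terms, each small by
  Cauchy-Schwarz; so convergence of both factors in L^2 gives pointwise convergence of the
  product.\<close>

lemma conv_tendsto:
  assumes F: "\<And>n. cont (F n)" "cont f" "(\<lambda>n. sqnorm (\<lambda>x. F n x - f x)) \<longlonglongrightarrow> 0"
    and G: "\<And>n. cont (G n)" "cont g" "(\<lambda>n. sqnorm (\<lambda>x. G n x - g x)) \<longlonglongrightarrow> 0"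
  shows "(\<lambda>n. (F n \<star> G n) x) \<longlonglongrightarrow> (f \<star> g) x"
proof -
  define A where "A n = (\<lambda>x. F n x - f x)" for n
  define C where "C n = (\<lambda>x. G n x - g x)" for n
  have c: "cont (A n)" "cont (C n)" for n
    unfolding A_def C_def by (intro continuous_intros F G)+
  have eq: "(F n \<star> G n) x - (f \<star> g) x = (A n \<star> C n) x + (A n \<star> g) x + (f \<star> C n) x" for n
  proof -
    have "F n = (\<lambda>x. 1 * A n x + 1 * f x)" "G n = (\<lambda>x. 1 * C n x + 1 * g x)"
      by (auto simp: A_def C_def)
    then have "(F n \<star> G n) x = (A n \<star> G n) x + (f \<star> G n) x"
      using conv_lin_left[OF c(1)[of n] F(2) G(1)[of n], of 1 1 x] by simp
    also have "\<dots> = (A n \<star> C n) x + (A n \<star> g) x + ((f \<star> C n) x + (f \<star> g) x)"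
      using \<open>G n = _\<close> conv_lin_right[OF c(2)[of n] G(2) c(1)[of n], of 1 1 x]
        conv_lin_right[OF c(2)[of n] G(2) F(2), of 1 1 x] by simp
    finally show ?thesis by simp
  qed
  have AC: "(\<lambda>n. sqnorm (A n)) \<longlonglongrightarrow> 0" "(\<lambda>n. sqnorm (C n)) \<longlonglongrightarrow> 0"
    using F(3) G(3) by (simp_all add: A_def C_def)
  have "(\<lambda>n. sqrt (sqnorm (A n) * sqnorm (C n)) + sqrt (sqnorm (A n) * sqnorm g) + sqrt (sqnorm f * sqnorm (C n)))
      \<longlonglongrightarrow> sqrt (0 * 0) + sqrt (0 * sqnorm g) + sqrt (sqnorm f * 0)"
    by (intro tendsto_intros AC)
  then have lim: "(\<lambda>n. sqrt (sqnorm (A n) * sqnorm (C n)) + sqrt (sqnorm (A n) * sqnorm g) + sqrt (sqnorm f * sqnorm (C n)))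
      \<longlonglongrightarrow> 0" by simp
  have "cmod ((F n \<star> G n) x - (f \<star> g) x)
      \<le> sqrt (sqnorm (A n) * sqnorm (C n)) + sqrt (sqnorm (A n) * sqnorm g) + sqrt (sqnorm f * sqnorm (C n))" for n
    unfolding eq
    by (intro order_trans[OF norm_triangle_ineq] add_mono cmod_conv_le c F(2) G(2))
  then have "(\<lambda>n. (F n \<star> G n) x - (f \<star> g) x) \<longlonglongrightarrow> 0"
    by (intro Lim_null_comparison[OF _ lim]) auto
  then show ?thesis by (rule LIM_zero_cancel)
qed

section \<open>Powers of a self-adjoint function and their spectral limit\<close>

primrec conv_power :: "('g \<Rightarrow> complex) \<Rightarrow> nat \<Rightarrow> 'g \<Rightarrow> complex" where
  "conv_power f 0 = f"
| "conv_power f (Suc n) = f \<star> conv_power f n"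

lemma conv_power_cont: "cont f \<Longrightarrow> cont (conv_power f n)"
  by (induction n) (auto intro: conv_cont)

lemma conv_power_adj: "cont f \<Longrightarrow> adj f = f \<Longrightarrow> adj (conv_power f n) = conv_power f n"
  by (induction n) (simp_all add: adj_conv conv_power_cont)

text \<open>The \<open>+ 1\<close> appears because index n stands for the (n+1)-fold power:
  convolution of continuous functions need not have a unit that could serve as a zeroth
  power.\<close>

lemma conv_power_add:
  "cont f \<Longrightarrow> conv_power f i \<star> conv_power f j = conv_power f (i + j + 1)"
  by (induction i) (simp_all add: conv_assoc conv_power_cont)

text \<open>The spectral projection onto the eigenspaces of largest modulus of the convolution operator
  \<open>f \<star> _\<close> is the limit of the normalised even powers of \<open>f\<close>. That the limit does not vanish is
  a form of the compactness of the operator; here it comes from \<open>\<parallel>f \<star> g\<parallel>\<^sup>2 \<le> mass * \<parallel>f\<parallel>\<^sup>2 * \<parallel>g\<parallel>\<^sup>2\<close>.\<close>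

lemma spectral_idempotent:
  assumes f: "cont f" and sa: "adj f = f" and pos: "sqnorm f > 0"
  obtains l e where "l > 0" "cont e" "adj e = e" "e \<star> e = e" "sqnorm e > 0"
    "f \<star> f \<star> e = (\<lambda>x. of_real l * e x)"
proof -
  define P where "P = conv_power f"
  have Pc: "cont (P n)" for n unfolding P_def by (rule conv_power_cont[OF f])
  have Pa: "adj (P n) = P n" for n unfolding P_def by (rule conv_power_adj[OF f sa])
  have Padd: "P i \<star> P j = P (i + j + 1)" for i j unfolding P_def by (rule conv_power_add[OF f])
  define a where "a n = sqnorm (P n)" for n
  have Pa0: "P (2 * n + 1) 0 = of_real (a n)" for n
    using conv_self_zero[OF Pa, of n] Padd[of n n] by (simp add: a_def mult_2)
  have lc0: "cmod (P (i + j + 1) 0) \<le> sqrt (a i * a j)" for i j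
    using cmod_conv_le[OF Pc Pc, of i j 0] by (simp add: Padd a_def)
  have a0: "a n \<ge> 0" for n by (simp add: a_def sqnorm_nonneg)
  \<comment> \<open>Cauchy-Schwarz for the splitting of \<open>P (2 * Suc n + 1)\<close> into the
    factors \<open>P n\<close> and \<open>P (n + 2)\<close>.\<close>
  have lc: "(a (Suc n))\<^sup>2 \<le> a n * a (Suc (Suc n))" for n
  proof -
    have "a (Suc n) = cmod (P (n + Suc (Suc n) + 1) 0)"
      using Pa0[of "Suc n"] a0[of "Suc n"] by (simp add: mult_2)
    also have "\<dots> \<le> sqrt (a n * a (Suc (Suc n)))" by (rule lc0)
    finally have "(a (Suc n))\<^sup>2 \<le> (sqrt (a n * a (Suc (Suc n))))\<^sup>2"
      using a0 by (intro power_mono) auto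
    then show ?thesis using a0 by simp
  qed
  \<comment> \<open>No power vanishes: \<open>P 1\<close> has the value \<open>sqnorm f\<close> at
    0, and log-convexity carries positivity from one index to the next.\<close>
  have apos: "a n > 0 \<and> a (Suc n) > 0" for n
  proof (induction n)
    case 0
    have "a 0 > 0" using pos by (simp add: a_def P_def)
    then have "P 1 0 \<noteq> 0" using Pa0[of 0] by simp
    with \<open>a 0 > 0\<close> show ?case using sqnorm_pos[OF Pc, of 1 0] by (simp add: a_def)
  next
    case (Suc n)
    then have "a n * a (Suc (Suc n)) > 0"
      using lc[of n] by (smt (verit) zero_less_power)
    then show ?case using Suc a0[of "Suc (Suc n)"] by (simp add: zero_less_mult_iff)
  qed
  have sub: "a (n + k + 1) \<le> mass * a n * a k" for n k
    using sqnorm_conv_le[OF Pc Pc, of n k] unfolding Padd a_def .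
  obtain l where l: "l > 0" "convergent (\<lambda>n. a n / l ^ n)" "\<And>n. l ^ (n + 1) \<le> mass * a n"
    by (rule log_convex_seq_limit[of a mass]) (use apos lc sub in auto)
  \<comment> \<open>\<open>P (2 * n + 1)\<close> is the (n+1)-fold power of
    \<open>f \<star> f\<close>, normalised here by its largest eigenvalue l. Even powers treat the
    eigenvalues sqrt l and - sqrt l of \<open>f\<close> alike and so cannot oscillate in
    sign.\<close>
  define Q where "Q n = (\<lambda>x. P (2 * n + 1) x / of_real (l ^ (n + 1)))" for n
  have Q_eq: "Q n = (\<lambda>x. of_real (1 / l ^ (n + 1)) * P (2 * n + 1) x)" for n
    by (auto simp: Q_def)
  have Qc: "cont (Q n)" for n unfolding Q_eq by (intro continuous_intros Pc)
  have Qa: "adj (Q n) = Q n" for n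
    using fun_cong[OF Pa[of "2 * n + 1"]] by (auto simp: Q_def adj_def)
  have QQ: "(Q n \<star> Q k) x = Q (n + k + 1) x" for n k x
    unfolding Q_eq conv_scale_left conv_scale_right Padd by (simp add: power_add mult_2 add.commute add.left_commute algebra_simps)
  have Q0: "Q n 0 = of_real (a n / l ^ (n + 1))" for n
    using Pa0[of n] by (simp add: Q_def)
  have QN: "sqnorm (Q n) = a (2 * n + 1) / l ^ (2 * n + 2)" for n
  proof -
    have "complex_of_real (sqnorm (Q n)) = Q (n + n + 1) 0" using conv_self_zero[OF Qa, of n] QQ by simp
    also have "\<dots> = of_real (a (2 * n + 1) / l ^ (2 * n + 2))" unfolding Q0 by (simp add: mult_2)
    finally show ?thesis using of_real_eq_iff by blast
  qed
  define b where "b n = a n / l ^ (n + 1)" for n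
  have "convergent (\<lambda>n. inverse l * (a n / l ^ n))"
    using l(2) by (intro convergent_mult convergent_const)
  then have "convergent b" using l(1) by (simp add: b_def[abs_def] field_simps)
  then obtain L where L: "b \<longlonglongrightarrow> L" by (auto simp: convergent_def)
  \<comment> \<open>The coefficients 1, 1, -2 add up to 0, so convergence of \<open>b\<close> makes
    \<open>Q\<close> a Cauchy sequence in L^2.\<close>
  have dist: "sqnorm (\<lambda>x. Q n x - Q k x) = b (2 * n + 1) + b (2 * k + 1) - 2 * b (n + k + 1)" for n k
    unfolding sqnorm_diff_self_adjoint[OF Qc Qc Qa Qa] QN QQ Q0 by (simp add: b_def)
  have cauchy: "\<exists>M. \<forall>n\<ge>M. \<forall>k\<ge>M. sqnorm (\<lambda>x. Q n x - Q k x) < d" if d: "d > 0" for d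
  proof -
    obtain M where M: "\<And>n. n \<ge> M \<Longrightarrow> \<bar>b n - L\<bar> < d / 4"
      using L d unfolding LIMSEQ_iff by (metis divide_pos_pos real_norm_def zero_less_numeral)
    have "sqnorm (\<lambda>x. Q n x - Q k x) < d" if "n \<ge> M" "k \<ge> M" for n k
      using M[of "2 * n + 1"] M[of "2 * k + 1"] M[of "n + k + 1"] that unfolding dist by linarith
    then show ?thesis by blast
  qed
  have step: "(P 1 \<star> Q n) x = of_real l * Q (n + 1) x" for n x
    unfolding Q_eq conv_scale_right Padd using l(1) by (simp add: add.commute)
  \<comment> \<open>One more convolution with \<open>P 1\<close> improves the L^2 Cauchy property to
    a uniform one, by Cauchy-Schwarz and \<open>step\<close>. Thus the limit exists as a continuous
    function.\<close>
  have "uniformly_Cauchy_on UNIV (\<lambda>n. Q (n + 1))"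
    unfolding uniformly_Cauchy_on_def
  proof (intro allI impI)
    fix \<epsilon> :: real assume \<epsilon>: "\<epsilon> > 0"
    \<comment> \<open>Chosen so that \<open>sqrt (a 1 * d)\<close> equals \<epsilon> times
      l.\<close>
    define d where "d = (\<epsilon> * l)\<^sup>2 / a 1"
    have "d > 0" using \<epsilon> l(1) apos[of 0] by (simp add: d_def)
    from cauchy[OF this] obtain M where M: "\<And>n k. n \<ge> M \<Longrightarrow> k \<ge> M \<Longrightarrow> sqnorm (\<lambda>x. Q n x - Q k x) < d"
      by blast
    have "dist (Q (n + 1) x) (Q (k + 1) x) < \<epsilon>" if nk: "n \<ge> M" "k \<ge> M" for n k x
    proof -
      have c: "cont (\<lambda>x. Q n x - Q k x)" by (intro continuous_intros Qc)
      have "l * dist (Q (n + 1) x) (Q (k + 1) x) = cmod (of_real l * Q (n + 1) x - of_real l * Q (k + 1) x)"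
        using l(1) by (simp add: dist_norm norm_mult flip: right_diff_distrib)
      also have "\<dots> = cmod ((P 1 \<star> (\<lambda>x. Q n x - Q k x)) x)"
        using conv_lin_right[OF Qc[of n] Qc[of k] Pc[of 1], of 1 "- 1" x] unfolding step by simp
      also have "\<dots> \<le> sqrt (a 1 * sqnorm (\<lambda>x. Q n x - Q k x))"
        using cmod_conv_le[OF Pc c] by (simp add: a_def)
      also have "\<dots> < sqrt (a 1 * d)"
        using M[OF nk] apos[of 0] by simp
      also have "a 1 * d = (\<epsilon> * l)\<^sup>2" using apos[of 0] by (simp add: d_def)
      also have "sqrt ((\<epsilon> * l)\<^sup>2) = l * \<epsilon>" using \<epsilon> l(1) by (simp add: mult.commute)
      finally show ?thesis using l(1) by simp
    qed
    then show "\<exists>M. \<forall>x\<in>UNIV. \<forall>m\<ge>M. \<forall>n\<ge>M. dist (Q (m + 1) x) (Q (n + 1) x) < \<epsilon>" by blast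
  qed
  then obtain e where e: "uniform_limit UNIV (\<lambda>n. Q (n + 1)) e sequentially"
    using Cauchy_uniformly_convergent uniformly_convergent_on_def by blast
  have ec: "cont e"
    by (rule uniform_limit_theorem[OF _ e]) (auto intro: always_eventually Qc)
  have lim: "(\<lambda>n. Q (n + 1) x) \<longlonglongrightarrow> e x" for x
    using tendsto_uniform_limitI[OF e] by simp
  have "(\<lambda>n. sqnorm (\<lambda>x. Q (n + 1) x - e x)) \<longlonglongrightarrow> 0"
  proof (rule tendstoI)
    fix \<epsilon> :: real assume \<epsilon>: "\<epsilon> > 0"
    define \<delta> where "\<delta> = sqrt (\<epsilon> / (2 * mass))"
    have \<delta>: "\<delta> > 0" "mass * \<delta>\<^sup>2 = \<epsilon> / 2" using \<epsilon> mass_pos by (auto simp: \<delta>_def)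
    have "\<forall>\<^sub>F n in sequentially. \<forall>x\<in>UNIV. dist (Q (n + 1) x) (e x) < \<delta>"
      using e \<delta>(1) by (auto simp: uniform_limit_iff)
    then show "\<forall>\<^sub>F n in sequentially. dist (sqnorm (\<lambda>x. Q (n + 1) x - e x)) 0 < \<epsilon>"
    proof eventually_elim
      case (elim n)
      have "sqnorm (\<lambda>x. Q (n + 1) x - e x) \<le> mass * \<delta>\<^sup>2"
        using elim by (intro sqnorm_le_const continuous_intros Qc ec) (auto simp: dist_norm less_imp_le)
      then show ?case using \<delta>(2) \<epsilon> sqnorm_nonneg[of "\<lambda>x. Q (n + 1) x - e x"] by simp
    qed
  qed
  then have limN: "(\<lambda>n. sqnorm (\<lambda>x. Q n x - e x)) \<longlonglongrightarrow> 0"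
    by (rule LIMSEQ_offset)
  have lim': "(\<lambda>n. Q n x) \<longlonglongrightarrow> e x" for x by (rule LIMSEQ_offset[OF lim])
  have ea: "adj e = e"
  proof
    fix x
    have "(\<lambda>n. adj (Q n) x) \<longlonglongrightarrow> adj e x" unfolding adj_def by (intro tendsto_cnj lim')
    then have "(\<lambda>n. Q n x) \<longlonglongrightarrow> adj e x" by (simp add: Qa)
    then show "adj e x = e x" using lim' LIMSEQ_unique by blast
  qed
  have ee: "e \<star> e = e"
  proof
    fix x
    have "(\<lambda>n. (Q n \<star> Q n) x) \<longlonglongrightarrow> (e \<star> e) x"
      by (intro conv_tendsto Qc ec limN)
    moreover have "(\<lambda>n. (Q n \<star> Q n) x) \<longlonglongrightarrow> e x"
    proof -
      have "strict_mono (\<lambda>n::nat. n + n + 1)" by (auto simp: strict_mono_def)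
      from LIMSEQ_subseq_LIMSEQ[OF lim' this] show ?thesis by (simp add: QQ o_def)
    qed
    ultimately show "(e \<star> e) x = e x" using LIMSEQ_unique by blast
  qed
  have eN: "sqnorm e > 0"
  proof -
    have "(\<lambda>n. Re ((Q n \<star> Q n) 0)) \<longlonglongrightarrow> Re ((e \<star> e) 0)"
      by (intro tendsto_Re conv_tendsto Qc ec limN)
    then have "(\<lambda>n. sqnorm (Q n)) \<longlonglongrightarrow> sqnorm e" by (simp add: conv_self_zero Qa ea)
    \<comment> \<open>The lower bound is the third property of l at index 2 n + 1, and it survives
      in the limit.\<close>
    moreover have "sqnorm (Q n) \<ge> 1 / mass" for n
      unfolding QN using l(3)[of "2 * n + 1"] l(1) mass_pos by (simp add: field_simps)
    ultimately have "sqnorm e \<ge> 1 / mass" by (intro LIMSEQ_le_const) auto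
    then show ?thesis using mass_pos by (smt (verit) zero_less_divide_1_iff)
  qed
  have fe: "f \<star> f \<star> e = (\<lambda>x. of_real l * e x)"
  proof
    fix x
    have "(\<lambda>n. (P 1 \<star> Q n) x) \<longlonglongrightarrow> (P 1 \<star> e) x"
      by (intro conv_tendsto Qc Pc ec limN) (simp add: sqnorm_def)
    moreover have "(\<lambda>n. (P 1 \<star> Q n) x) \<longlonglongrightarrow> of_real l * e x"
      unfolding step by (intro tendsto_mult tendsto_const lim)
    ultimately have "(P 1 \<star> e) x = of_real l * e x" using LIMSEQ_unique by blast
    moreover have "P 1 = f \<star> f" by (simp add: P_def)
    ultimately show "(f \<star> f \<star> e) x = of_real l * e x" using conv_assoc[OF f f ec] by simp
  qed
  show ?thesis by (rule that[OF l(1) ec ea ee eN fe])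
qed

section \<open>Self-adjoint idempotents and the characters below them\<close>

definition idempotent :: "('g \<Rightarrow> complex) \<Rightarrow> bool" where
  "idempotent e \<longleftrightarrow> cont e \<and> adj e = e \<and> e \<star> e = e"

lemma idempotent_zero: "idempotent e \<Longrightarrow> e 0 = of_real (sqnorm e)"
  using conv_self_zero[of e] by (simp add: idempotent_def)

text \<open>Convolution with e is an orthogonal projection of rank \<open>mass * sqnorm e\<close>,
  so the rank is at least one. The proof applies \<open>sqnorm_conv_le\<close> to the equation
  \<open>e \<star> e = e\<close>.\<close>

lemma idempotent_sqnorm_ge:
  assumes e: "idempotent e" and pos: "sqnorm e > 0"
  shows "1 / mass \<le> sqnorm e"
proof -
  have "sqnorm e \<le> mass * sqnorm e * sqnorm e"
    using sqnorm_conv_le[of e e] e by (simp add: idempotent_def)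
  then have "1 \<le> mass * sqnorm e" using pos by simp
  then show ?thesis using mass_pos by (simp add: field_simps)
qed

text \<open>The difference is again a nonzero idempotent, hence of rank at least one, and ranks add
  because they are proportional to the values at 0.\<close>

lemma sub_idempotent_sqnorm:
  assumes e: "idempotent e" and e': "idempotent e'" and sub: "e \<star> e' = e'" and ne: "e' \<noteq> e"
  shows "sqnorm e' + 1 / mass \<le> sqnorm e"
proof -
  note ec = e[unfolded idempotent_def] and ec' = e'[unfolded idempotent_def]
  define g where "g = (\<lambda>x. 1 * e x + (- 1) * e' x)"
  have sub': "e' \<star> e = e'" using conv_commute[of e' e] sub ec ec' by simp
  have gc: "cont g" unfolding g_def using ec ec' by (intro continuous_intros) auto
  have "adj g x = g x" for x
    using adj_eqD[of e x] adj_eqD[of e' x] ec ec' by (simp add: g_def adj_def)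
  moreover have "(g \<star> g) x = g x" for x
  proof -
    have "(g \<star> g) x = 1 * (e \<star> g) x + (- 1) * (e' \<star> g) x"
      using conv_lin_left[of e e' g 1 "- 1" x] ec ec' gc by (simp add: g_def)
    also have "(e \<star> g) x = e x - e' x"
      using conv_lin_right[of e e' e 1 "- 1" x] ec ec' sub by (simp add: g_def)
    also have "(e' \<star> g) x = 0"
      using conv_lin_right[of e e' e' 1 "- 1" x] ec ec' sub' by (simp add: g_def)
    finally show ?thesis by (simp add: g_def)
  qed
  ultimately have g: "idempotent g" using gc by (auto simp: idempotent_def)
  obtain x where "e x \<noteq> e' x" using ne by (metis ext)
  then have "sqnorm g > 0" using sqnorm_pos[OF gc, of x] by (simp add: g_def)
  then have "1 / mass \<le> sqnorm g" by (rule idempotent_sqnorm_ge[OF g])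
  moreover have "complex_of_real (sqnorm g) = of_real (sqnorm e - sqnorm e')"
    using idempotent_zero[OF g] idempotent_zero[OF e] idempotent_zero[OF e'] by (simp add: g_def)
  ultimately show ?thesis unfolding of_real_eq_iff by linarith
qed

text \<open>Evaluating at 0 identifies the factor c as \<open>e a / e 0\<close>, so e divided by
  \<open>e 0\<close> is multiplicative; self-adjointness makes it unitary.\<close>

lemma idempotent_translates_group_char:
  assumes e: "idempotent e" and pos: "sqnorm e > 0"
    and mult: "\<And>a. \<exists>c. \<forall>x. e (x + a) = c * e x"
  obtains \<gamma> where "group_char \<gamma>" "e \<star> \<gamma> = \<gamma>"
proof -
  note ec = e[unfolded idempotent_def]
  define \<gamma> where "\<gamma> = (\<lambda>x. inverse (e 0) * e x)"
  have e0: "e 0 \<noteq> 0" "cnj (e 0) = e 0" using idempotent_zero[OF e] pos by auto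
  have tr: "e (x + a) = e 0 * \<gamma> a * \<gamma> x" for x a
  proof -
    obtain c where c: "\<And>x. e (x + a) = c * e x" using mult[of a] by blast
    from c[of 0] c[of x] show ?thesis using e0 by (simp add: \<gamma>_def field_simps)
  qed
  have add: "\<gamma> (x + a) = \<gamma> x * \<gamma> a" for x a
    using tr[of x a] e0 by (simp add: \<gamma>_def)
  have \<gamma>0: "\<gamma> 0 = 1" using e0 by (simp add: \<gamma>_def)
  have cnj: "\<gamma> (- x) = cnj (\<gamma> x)" for x
    using adj_eqD[of e "- x"] ec e0 by (simp add: \<gamma>_def)
  have "cmod (\<gamma> x) = 1" for x
  proof -
    have "complex_of_real ((cmod (\<gamma> x))\<^sup>2) = \<gamma> x * cnj (\<gamma> x)" by (rule complex_norm_square)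
    also have "\<dots> = 1" using add[of x "- x"] \<gamma>0 cnj by simp
    finally have "(cmod (\<gamma> x))\<^sup>2 = 1" using of_real_eq_1_iff by blast
    then show ?thesis by (metis norm_ge_zero one_power2 power2_eq_iff_nonneg zero_le_one)
  qed
  moreover have "cont \<gamma>" unfolding \<gamma>_def using ec by (intro continuous_intros) auto
  ultimately have "group_char \<gamma>" using add by (auto simp: group_char_def)
  moreover have "(e \<star> \<gamma>) x = \<gamma> x" for x
    unfolding \<gamma>_def conv_scale_right using ec by simp
  ultimately show ?thesis using that[of \<gamma>] by blast
qed

text \<open>Every nonzero idempotent dominates a minimal one, since \<open>mass * sqnorm e\<close> (the dimension of its
  range) drops by at least one when the idempotent is split. The translates of a minimal idempotent
  are multiples of it, so that it is a character up to a factor.\<close>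

lemma idempotent_dominates_group_char:
  assumes "idempotent e" "sqnorm e > 0"
  obtains \<gamma> where "group_char \<gamma>" "e \<star> \<gamma> = \<gamma>"
proof -
  \<comment> \<open>The induction runs over a strict integer bound for the rank, which itself is
    only known as a real number.\<close>
  have "\<exists>\<gamma>. group_char \<gamma> \<and> e \<star> \<gamma> = \<gamma>"
    if "idempotent e" "sqnorm e > 0" "mass * sqnorm e < real n" for n
    using that
  proof (induction n arbitrary: e)
    case 0
    then show ?case using mass_pos by (simp add: mult_less_0_iff)
  next
    case (Suc n)
    note ec = Suc.prems(1)[unfolded idempotent_def]
    have descend: ?case if e': "idempotent e'" "sqnorm e' > 0" "e \<star> e' = e'" "e' \<noteq> e" for e'
    proof -
      have "mass * (sqnorm e' + 1 / mass) \<le> mass * sqnorm e"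
        using sub_idempotent_sqnorm[OF Suc.prems(1) e'(1,3,4)] mass_pos by (intro mult_left_mono) auto
      then have "mass * sqnorm e' < real n" using Suc.prems(3) mass_pos by (simp add: distrib_left)
      from Suc.IH[OF e'(1,2) this] obtain \<gamma> where \<gamma>: "group_char \<gamma>" "e' \<star> \<gamma> = \<gamma>" by blast
      have "e \<star> \<gamma> = e \<star> (e' \<star> \<gamma>)" by (simp add: \<gamma>)
      also have "\<dots> = (e \<star> e') \<star> \<gamma>"
        using ec e'(1) group_char_cont[OF \<gamma>(1)] by (intro conv_assoc[symmetric]) (auto simp: idempotent_def)
      finally show ?thesis using \<gamma> e'(3) by metis
    qed
    show ?case
    proof (cases "\<forall>a. \<exists>c. \<forall>x. e (x + a) = c * e x")
      case True
      show ?thesis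
        by (rule idempotent_translates_group_char[OF Suc.prems(1,2)]) (use True in blast)+
    next
      case False
      then obtain a where a: "\<And>c. \<exists>x. e (x + a) \<noteq> c * e x" by blast
      \<comment> \<open>A translate that is not proportional to e; it stays in the range of e
        because convolution commutes with translation.\<close>
      define t where "t = (\<lambda>x. e (x + a))"
      have tc: "cont t"
        unfolding t_def by (rule continuous_on_UNIV_compose) (use ec in \<open>auto intro!: continuous_intros\<close>)
      have at: "adj t = (\<lambda>x. e (x + - a))"
        using adj_eqD[of e "_ - a"] ec by (auto simp: t_def adj_def)
      have atc: "cont (adj t)" by (rule adj_cont[OF tc])
      have et0: "(e \<star> (\<lambda>x. e (x + b))) x = e (x + b)" for b x
      proof -
        have "(e \<star> (\<lambda>x. e (x + b))) x = (e \<star> e) (x + b)" by (simp add: conv_def algebra_simps)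
        then show ?thesis using ec by simp
      qed
      have et: "(e \<star> t) x = t x" "(e \<star> adj t) x = adj t x" for x
        using et0[of a x] et0[of "- a" x] unfolding at by (simp_all add: t_def)
      \<comment> \<open>Twice the self-adjoint part of t and, up to sign, twice the skew part
        divided by \<i>. As \<open>t = (u - \<i> * v) / 2\<close>, the functions u and v cannot both
        be multiples of e.\<close>
      define u where "u = (\<lambda>x. 1 * t x + 1 * adj t x)"
      define v where "v = (\<lambda>x. \<i> * t x + (- \<i>) * adj t x)"
      have uc: "cont u" "cont v" unfolding u_def v_def by (intro continuous_intros tc atc)+
      have ua: "adj u = u" "adj v = v"
        by (auto simp: u_def v_def adj_def fun_eq_iff)
      have elin: "(e \<star> (\<lambda>x. b * t x + d * adj t x)) x = b * t x + d * adj t x" for b d x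
        using conv_lin_right[OF tc atc, of e b d x] ec et by simp
      have eu: "e \<star> u = u" "e \<star> v = v"
        unfolding u_def v_def by (rule ext, rule elin)+
      have "\<exists>f. cont f \<and> adj f = f \<and> e \<star> f = f \<and> (\<forall>c. \<exists>x. f x \<noteq> c * e x)"
      proof (rule ccontr)
        assume neg: "\<not> ?thesis"
        then obtain c where c: "\<And>x. u x = c * e x" using uc ua eu by metis
        obtain d where d: "\<And>x. v x = d * e x" using neg uc ua eu by metis
        have "t x = (u x - \<i> * v x) / 2" for x by (simp add: u_def v_def algebra_simps)
        then have "t x = ((c - \<i> * d) / 2) * e x" for x by (simp add: c d field_simps)
        then show False using a[of "(c - \<i> * d) / 2"] unfolding t_def by blast
      qed
      then obtain f where f: "cont f" "adj f = f" "e \<star> f = f" "\<And>c. \<exists>x. f x \<noteq> c * e x" by blast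
      obtain x0 where "f x0 \<noteq> 0" using f(4)[of 0] by auto
      then have "sqnorm f > 0" by (rule sqnorm_pos[OF f(1)])
      from spectral_idempotent[OF f(1,2) this] obtain l e' where
        e': "l > 0" "cont e'" "adj e' = e'" "e' \<star> e' = e'" "sqnorm e' > 0"
        "f \<star> f \<star> e' = (\<lambda>x. of_real l * e' x)" by metis
      have i': "idempotent e'" using e' by (simp add: idempotent_def)
      show ?thesis
      proof (cases "e' = e")
        case False
        \<comment> \<open>The idempotent \<open>e'\<close> lies below e, because l times it is
          \<open>f \<star> f \<star> e'\<close> and e fixes \<open>f\<close>.\<close>
        have "of_real l * (e \<star> e') x = of_real l * e' x" for x
        proof -
          have "of_real l * (e \<star> e') x = (e \<star> (f \<star> f \<star> e')) x"
            unfolding e'(6) conv_scale_right ..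
          also have "\<dots> = ((e \<star> f) \<star> f \<star> e') x"
            using conv_assoc[of e f "f \<star> e'"] ec f(1) conv_cont[OF f(1) e'(2)] by simp
          finally show ?thesis using f(3) e'(6) by simp
        qed
        then have "e \<star> e' = e'" using e'(1) by auto
        then show ?thesis using descend[OF i' e'(5) _ False] by blast
      next
        case True
        have fe: "f \<star> e = f" using conv_commute[of f e] f ec by simp
        have ff: "(f \<star> f) x = of_real l * e x" for x
          using fun_cong[OF e'(6), of x] fe True by simp
        define s where "s = complex_of_real (sqrt l)"
        have s: "s \<noteq> 0" "s * s = of_real l" "cnj s = s"
          using e'(1) by (auto simp: s_def simp flip: of_real_mult)
        \<comment> \<open>Now \<open>f \<star> f\<close> is l times e, so on the range of e the only
          possible eigenvalues of \<open>f\<close> are s and -s. This is the projection onto the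
          eigenspace of s; it is neither 0 nor e because \<open>f\<close> is not a multiple of
          e.\<close>
        define p where "p = (\<lambda>x. (1 / 2) * e x + (1 / (2 * s)) * f x)"
        have pc: "cont p" unfolding p_def using ec f by (intro continuous_intros) auto
        have "adj p x = p x" for x
          using adj_eqD[of e x] adj_eqD[of f x] ec f s by (simp add: p_def adj_def)
        moreover have "(p \<star> p) x = p x" for x
        proof -
          have "(p \<star> p) x = (1 / 2) * (e \<star> p) x + (1 / (2 * s)) * (f \<star> p) x"
            using conv_lin_left[of e f p "1 / 2" "1 / (2 * s)" x] ec f pc by (simp add: p_def)
          also have "(e \<star> p) x = (1 / 2) * e x + (1 / (2 * s)) * f x"
            using conv_lin_right[of e f e "1 / 2" "1 / (2 * s)" x] ec f by (simp add: p_def)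
          also have "(f \<star> p) x = (1 / 2) * f x + (1 / (2 * s)) * (of_real l * e x)"
            using conv_lin_right[of e f f "1 / 2" "1 / (2 * s)" x] ec f fe ff by (simp add: p_def)
          finally have "(p \<star> p) x = (1 / 2) * ((1 / 2) * e x + (1 / (2 * s)) * f x)
              + (1 / (2 * s)) * ((1 / 2) * f x + (1 / (2 * s)) * (s * s * e x))" by (simp only: s(2))
          also have "\<dots> = (1 / 2) * e x + (1 / (2 * s)) * f x" using s(1) by (simp add: field_simps)
          finally show ?thesis by (simp only: p_def)
        qed
        ultimately have p: "idempotent p" using pc by (auto simp: idempotent_def)
        have "e \<star> p = p"
          using conv_lin_right[of e f e "1 / 2" "1 / (2 * s)"] ec f by (auto simp: p_def fun_eq_iff)
        moreover have "sqnorm p > 0"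
        proof -
          obtain x where "f x \<noteq> (- s) * e x" using f(4) by blast
          then have "p x \<noteq> 0" using s(1) by (auto simp: p_def field_simps add_eq_0_iff)
          then show ?thesis by (rule sqnorm_pos[OF pc])
        qed
        moreover have "p \<noteq> e"
        proof -
          obtain x where "f x \<noteq> s * e x" using f(4) by blast
          then have "p x \<noteq> e x" using s(1) by (auto simp: p_def field_simps)
          then show ?thesis by auto
        qed
        ultimately show ?thesis using descend[OF p] by blast
      qed
    qed
  qed
  then show ?thesis using reals_Archimedean2[of "mass * sqnorm e"] assms that by blast
qed

lemma conv_group_char:
  assumes "group_char \<gamma>"
  shows "(k \<star> \<gamma>) x = (LINT y|\<mu>. k y * cnj (\<gamma> y)) * \<gamma> x"
proof -
  have "(k \<star> \<gamma>) x = (LINT y|\<mu>. (k y * cnj (\<gamma> y)) * \<gamma> x)"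
    unfolding conv_def group_char_diff[OF assms] by (simp only: mult_ac)
  then show ?thesis by simp
qed

text \<open>A bump function at 0 of small support has Fourier coefficients too small for finitely
  many characters to reproduce its value 1 at 0. What remains after projecting them away is a
  nonzero function orthogonal to S, and a character in its spectral part lies outside S.\<close>

lemma new_group_char:
  assumes inf: "infinite (UNIV :: 'g set)" and fin: "finite S" and S: "\<And>\<gamma>. \<gamma> \<in> S \<Longrightarrow> group_char \<gamma>"
  obtains \<gamma> :: "'g \<Rightarrow> complex" where "group_char \<gamma>" "\<gamma> \<notin> S"
proof -
  \<comment> \<open>With \<open>card S\<close> coefficients below this bound, their sum divided by
    the mass stays below 1.\<close>
  define \<epsilon> where "\<epsilon> = mass / (real (card S) + 1)"
  have "\<epsilon> > 0" using mass_pos by (simp add: \<epsilon>_def)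
  from infinite_small_neighbourhood[OF inf this] obtain U where U: "open U" "0 \<in> U" "measure \<mu> U < \<epsilon>"
    by blast
  obtain k :: "'g \<Rightarrow> real" where k: "continuous_on UNIV k" "\<And>x. 0 \<le> k x" "\<And>x. k x \<le> 1"
    "\<And>x. x \<in> - U \<Longrightarrow> k x = 0" "\<And>x. x \<in> {0} \<Longrightarrow> k x = 1"
    by (rule compact_t2_Urysohn[OF compact_UNIV, of "- U" "{0}"]) (use U in auto)
  define c where "c \<gamma> = (LINT y|\<mu>. of_real (k y) * cnj (\<gamma> y))" for \<gamma>
  have c: "cmod (c \<gamma>) \<le> measure \<mu> U" if \<gamma>: "\<gamma> \<in> S" for \<gamma>
  proof -
    have "cmod (c \<gamma>) \<le> (LINT y|\<mu>. cmod (of_real (k y) * cnj (\<gamma> y)))"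
      unfolding c_def by (rule integral_norm_bound)
    also have "\<dots> = (LINT y|\<mu>. k y)" using S[OF \<gamma>] k(2) by (simp add: norm_mult group_char_norm)
    also have "\<dots> \<le> (LINT y|\<mu>. indicator U y)"
    proof (intro integral_mono continuous_integrable[OF k(1)])
      show "integrable \<mu> (indicator U :: 'g \<Rightarrow> real)"
        using U(1) by (simp add: sets_borel integrable_indicator_iff emeasure_eq_measure)
      show "k y \<le> indicator U y" for y using k(3,4)[of y] by (auto simp: indicator_def)
    qed
    also have "\<dots> = measure \<mu> U" using U(1) by (simp add: sets_borel)
    finally show ?thesis .
  qed
  \<comment> \<open>The bump function minus its orthogonal projection onto the span of S; each
    character has squared norm \<open>mass\<close>.\<close>
  define h where "h = (\<lambda>x. of_real (k x) - (\<Sum>\<gamma>\<in>S. c \<gamma> / of_real mass * \<gamma> x))"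
  have hc: "cont h" unfolding h_def by (intro continuous_intros k(1)) (auto simp: group_char_cont S)
  have h0: "h 0 \<noteq> 0"
  proof
    assume "h 0 = 0"
    then have "1 = (\<Sum>\<gamma>\<in>S. c \<gamma> / of_real mass)"
      using k(5)[of 0] by (simp add: h_def group_char_zero S)
    then have "1 = cmod (\<Sum>\<gamma>\<in>S. c \<gamma> / of_real mass)" by (metis norm_one)
    also have "\<dots> \<le> (\<Sum>\<gamma>\<in>S. measure \<mu> U / mass)"
      using c mass_pos by (intro sum_norm_le) (simp add: norm_divide divide_right_mono)
    also have "\<dots> = real (card S) * measure \<mu> U / mass" by simp
    also have "\<dots> \<le> real (card S) * \<epsilon> / mass"
      using U(3) mass_pos by (intro divide_right_mono mult_left_mono) auto
    also have "\<dots> = real (card S) / (real (card S) + 1)" using mass_pos by (simp add: \<epsilon>_def)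
    also have "\<dots> < 1" by simp
    finally show False by simp
  qed
  have h\<gamma>: "h \<star> \<gamma> = (\<lambda>x. 0)" if \<gamma>: "\<gamma> \<in> S" for \<gamma>
  proof -
    have int: "integrable \<mu> (\<lambda>y. of_real (k y) * cnj (\<gamma> y))"
      by (intro continuous_integrable continuous_intros k(1)) (auto simp: group_char_cont S[OF \<gamma>])
    have int': "integrable \<mu> (\<lambda>y. c \<psi> / of_real mass * (\<psi> y * cnj (\<gamma> y)))" if "\<psi> \<in> S" for \<psi>
      using \<gamma> that by (intro continuous_integrable continuous_intros) (auto simp: group_char_cont S)
    have "(LINT y|\<mu>. h y * cnj (\<gamma> y))
        = (LINT y|\<mu>. of_real (k y) * cnj (\<gamma> y) - (\<Sum>\<psi>\<in>S. c \<psi> / of_real mass * (\<psi> y * cnj (\<gamma> y))))"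
      unfolding h_def by (simp add: left_diff_distrib sum_distrib_right mult.assoc)
    also have "\<dots> = (LINT y|\<mu>. of_real (k y) * cnj (\<gamma> y))
        - (LINT y|\<mu>. (\<Sum>\<psi>\<in>S. c \<psi> / of_real mass * (\<psi> y * cnj (\<gamma> y))))"
      by (intro Bochner_Integration.integral_diff int Bochner_Integration.integrable_sum int')
    also have "\<dots> = c \<gamma> - (\<Sum>\<psi>\<in>S. c \<psi> / of_real mass * (LINT y|\<mu>. \<psi> y * cnj (\<gamma> y)))"
      unfolding c_def[of \<gamma>] by (subst Bochner_Integration.integral_sum) (erule int', simp)
    also have "(\<Sum>\<psi>\<in>S. c \<psi> / of_real mass * (LINT y|\<mu>. \<psi> y * cnj (\<gamma> y)))
        = (\<Sum>\<psi>\<in>S. if \<gamma> = \<psi> then c \<psi> else 0)"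
      using \<gamma> mass_pos by (intro sum.cong refl) (auto simp: group_char_orthogonal S)
    also have "\<dots> = c \<gamma>" using \<gamma> fin by simp
    finally have "(LINT y|\<mu>. h y * cnj (\<gamma> y)) = 0" by simp
    then show ?thesis using S[OF \<gamma>] by (auto simp: conv_group_char)
  qed
  \<comment> \<open>Self-adjoint as the spectral construction requires, with \<open>sqnorm h\<close>
    as its value at 0, and still annihilated by S.\<close>
  define f where "f = h \<star> adj h"
  have fc: "cont f" unfolding f_def by (intro conv_cont adj_cont hc)
  have fa: "adj f = f"
    unfolding f_def using adj_conv[OF hc adj_cont[OF hc]] conv_commute[OF hc adj_cont[OF hc]] by simp
  have "f 0 \<noteq> 0" unfolding f_def conv_adj_zero using sqnorm_pos[OF hc h0] by simp
  then have "sqnorm f > 0" by (rule sqnorm_pos[OF fc])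
  from spectral_idempotent[OF fc fa this] obtain l e where e: "l > 0" "cont e" "adj e = e" "e \<star> e = e"
    "sqnorm e > 0" "f \<star> f \<star> e = (\<lambda>x. of_real l * e x)" by metis
  have "idempotent e" using e by (simp add: idempotent_def)
  from idempotent_dominates_group_char[OF this e(5)] obtain \<gamma> where \<gamma>: "group_char \<gamma>" "e \<star> \<gamma> = \<gamma>"
    by blast
  note \<gamma>c = group_char_cont[OF \<gamma>(1)]
  have f\<gamma>: "\<gamma> \<star> f = (\<lambda>x. 0)" if "\<gamma> \<in> S"
  proof -
    have "\<gamma> \<star> f = (\<gamma> \<star> h) \<star> adj h"
      unfolding f_def by (rule conv_assoc[symmetric]) (intro hc adj_cont \<gamma>c)+
    also have "\<gamma> \<star> h = (\<lambda>x. 0)" using h\<gamma>[OF that] conv_commute[OF hc \<gamma>c] by simp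
    finally show ?thesis by (simp add: conv_zero)
  qed
  \<comment> \<open>The idempotent fixes \<open>\<gamma>\<close> and is a multiple of
    \<open>f \<star> f \<star> e\<close>, so a character annihilated by \<open>f\<close> would
    vanish at 0.\<close>
  have "of_real l * \<gamma> 0 = of_real l * (\<gamma> \<star> e) 0" using \<gamma>(2) conv_commute[OF e(2) \<gamma>c] by simp
  also have "\<dots> = (\<gamma> \<star> (f \<star> f \<star> e)) 0" unfolding e(6) conv_scale_right ..
  also have "\<dots> = ((\<gamma> \<star> f) \<star> (f \<star> e)) 0"
    using conv_assoc[OF \<gamma>c fc conv_cont[OF fc e(2)]] by simp
  finally have "\<gamma> \<notin> S" using f\<gamma> e(1) group_char_zero[OF \<gamma>(1)] by (auto simp: conv_zero)
  with \<gamma>(1) show ?thesis by (rule that)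
qed

lemma infinite_group_chars: "infinite (UNIV :: 'g set) \<Longrightarrow> infinite {\<gamma> :: 'g \<Rightarrow> complex. group_char \<gamma>}"
  by (metis mem_Collect_eq new_group_char)

end

section \<open>Characters and multipliers of Banach algebras\<close>

lemma character_add:
  "\<phi> \<in> characters B \<Longrightarrow> x \<in> ba_carrier B \<Longrightarrow> y \<in> ba_carrier B \<Longrightarrow> \<phi> (ba_add B x y) = \<phi> x + \<phi> y"
  and character_scale: "\<phi> \<in> characters B \<Longrightarrow> x \<in> ba_carrier B \<Longrightarrow> \<phi> (ba_scale B c x) = c * \<phi> x"
  and character_mult:
  "\<phi> \<in> characters B \<Longrightarrow> x \<in> ba_carrier B \<Longrightarrow> y \<in> ba_carrier B \<Longrightarrow> \<phi> (ba_mult B x y) = \<phi> x * \<phi> y"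
  and character_nonzero: "\<phi> \<in> characters B \<Longrightarrow> \<exists>x\<in>ba_carrier B. \<phi> x \<noteq> 0"
  and character_extensional: "\<phi> \<in> characters B \<Longrightarrow> \<phi> \<in> extensional (ba_carrier B)"
  by (auto simp: characters_def)

lemma topspace_gelfand: "topspace (gelfand_topology B) = characters B"
  by (auto simp: gelfand_topology_def characters_def PiE_def)

lemma continuous_map_gelfand_eval:
  "x \<in> ba_carrier B \<Longrightarrow> continuous_map (gelfand_topology B) euclidean (\<lambda>\<phi>. \<phi> x)"
  unfolding gelfand_topology_def
  by (intro continuous_map_from_subtopology continuous_map_product_projection)

lemma continuous_map_into_gelfand:
  assumes "\<And>t. t \<in> topspace T \<Longrightarrow> h t \<in> characters B"
    and "\<And>x. x \<in> ba_carrier B \<Longrightarrow> continuous_map T euclidean (\<lambda>t. h t x)"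
  shows "continuous_map T (gelfand_topology B) h"
  unfolding gelfand_topology_def continuous_map_in_subtopology continuous_map_componentwise
  using assms character_extensional by blast

lemma (in comm_banach_algebra) character_zero:
  assumes "\<phi> \<in> characters B"
  shows "\<phi> (ba_zero B) = 0"
proof -
  have "\<phi> (ba_diff B (ba_zero B) (ba_zero B)) = 0"
    unfolding ba_diff_def
    by (simp add: character_add[OF assms] character_scale[OF assms] zero_closed scale_closed)
  then show ?thesis by (simp add: add_inverse zero_closed)
qed

lemma (in comm_banach_algebra) character_unit:
  assumes "\<phi> \<in> characters B" "u \<in> ba_carrier B" "\<And>x. x \<in> ba_carrier B \<Longrightarrow> ba_mult B u x = x"
  shows "\<phi> u = 1"
proof -
  obtain x where "x \<in> ba_carrier B" "\<phi> x \<noteq> 0" using character_nonzero[OF assms(1)] by blast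
  then show ?thesis using character_mult[OF assms(1,2), of x] assms(3)[of x] by simp
qed

text \<open>The supremum in \<open>dual_norm\<close> is taken in the reals and bounds its members
  only when the set is bounded above; \<open>bdd\<close> guarantees this. Nonnegativity comes from
  the zero element, and the estimate for a from rescaling it into the unit ball.\<close>

lemma (in comm_banach_algebra) cmod_character_sum_le_dual_norm:
  assumes \<phi>: "\<And>j. j \<in> {1..n} \<Longrightarrow> \<phi> j \<in> characters B"
    and bdd: "\<And>\<phi>. \<phi> \<in> characters B \<Longrightarrow> \<exists>K. \<forall>x\<in>ba_carrier B. cmod (\<phi> x) \<le> K * ba_norm B x"
    and a: "a \<in> ba_carrier B"
  shows "cmod (\<Sum>j=1..n. c j * \<phi> j a) \<le> ba_norm B a * dual_norm B (\<lambda>b. \<Sum>j=1..n. c j * \<phi> j b)"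
    and "0 \<le> dual_norm B (\<lambda>b. \<Sum>j=1..n. c j * \<phi> j b)"
proof -
  define F where "F b = (\<Sum>j=1..n. c j * \<phi> j b)" for b
  obtain K where K: "\<And>j x. j \<in> {1..n} \<Longrightarrow> x \<in> ba_carrier B \<Longrightarrow> cmod (\<phi> j x) \<le> K j * ba_norm B x"
  proof -
    have "\<forall>j\<in>{1..n}. \<exists>K. \<forall>x\<in>ba_carrier B. cmod (\<phi> j x) \<le> K * ba_norm B x" using bdd \<phi> by blast
    from bchoice[OF this] show ?thesis using that by blast
  qed
  have "cmod (F b) \<le> (\<Sum>j=1..n. cmod (c j) * \<bar>K j\<bar>)" if "b \<in> ba_carrier B" "ba_norm B b \<le> 1" for b
    unfolding F_def
  proof (rule sum_norm_le)
    fix j assume j: "j \<in> {1..n}"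
    have "cmod (\<phi> j b) \<le> K j * ba_norm B b" by (rule K[OF j that(1)])
    also have "\<dots> \<le> \<bar>K j\<bar> * 1"
      using that norm_nonneg[OF that(1)] by (intro mult_mono) auto
    finally show "cmod (c j * \<phi> j b) \<le> cmod (c j) * \<bar>K j\<bar>"
      unfolding Real_Vector_Spaces.norm_mult by (simp add: mult_left_mono)
  qed
  then have "bdd_above ((\<lambda>b. cmod (F b)) ` {b \<in> ba_carrier B. ba_norm B b \<le> 1})"
    by (intro bdd_aboveI[of _ "\<Sum>j=1..n. cmod (c j) * \<bar>K j\<bar>"]) auto
  then have le: "cmod (F b) \<le> dual_norm B F" if "b \<in> ba_carrier B" "ba_norm B b \<le> 1" for b
    unfolding dual_norm_def using that by (intro cSUP_upper) auto
  have F0: "F (ba_zero B) = 0" unfolding F_def using \<phi> character_zero by (intro sum.neutral) auto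
  have n0: "ba_norm B (ba_zero B) = 0" using norm_eq_zero zero_closed by blast
  have nonneg: "0 \<le> dual_norm B F" using le[OF zero_closed] by (simp add: n0 F0)
  have "cmod (F a) \<le> ba_norm B a * dual_norm B F"
  proof (cases "ba_norm B a = 0")
    case True
    then have "a = ba_zero B" using norm_eq_zero[OF a] by simp
    then show ?thesis using F0 n0 by simp
  next
    case False
    then have pos: "ba_norm B a > 0" using norm_nonneg[OF a] by simp
    define b where "b = ba_scale B (of_real (1 / ba_norm B a)) a"
    have b: "b \<in> ba_carrier B" unfolding b_def by (rule scale_closed[OF a])
    have "ba_norm B b \<le> 1" unfolding b_def norm_scale[OF a] using pos by (simp add: norm_divide)
    from le[OF b this] have "cmod (F b) \<le> dual_norm B F" .
    moreover have "F b = F a / of_real (ba_norm B a)"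
      unfolding F_def b_def using \<phi> a
      by (auto simp: character_scale sum_divide_distrib intro!: sum.cong)
    ultimately show ?thesis using pos by (simp add: norm_divide field_simps)
  qed
  then show "cmod (\<Sum>j=1..n. c j * \<phi> j a) \<le> ba_norm B a * dual_norm B (\<lambda>b. \<Sum>j=1..n. c j * \<phi> j b)"
    "0 \<le> dual_norm B (\<lambda>b. \<Sum>j=1..n. c j * \<phi> j b)"
    using nonneg by (simp_all add: F_def[abs_def])
qed

text \<open>In a unital algebra a multiplier is multiplication by its value at the unit u, so its
  hat is the Gelfand transform of \<open>T u\<close>.\<close>

lemma (in comm_banach_algebra) type_I_imp_gelfand_onto:
  assumes "type_I_BSE_algebra B" "u \<in> ba_carrier B" "\<And>x. x \<in> ba_carrier B \<Longrightarrow> ba_mult B u x = x"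
    and "\<sigma> \<in> Cb B"
  shows "\<exists>a\<in>ba_carrier B. \<forall>\<phi>\<in>characters B. \<sigma> \<phi> = \<phi> a"
proof -
  have "\<sigma> \<in> multipliers_hat B"
    using assms(1,4) unfolding type_I_BSE_algebra_def BSE_algebra_def by metis
  then obtain T where T: "T \<in> multipliers B" "is_hat B T \<sigma>" by (auto simp: multipliers_hat_def)
  have "T u \<in> ba_carrier B" using T(1) assms(2) by (auto simp: multipliers_def)
  moreover have "\<sigma> \<phi> = \<phi> (T u)" if "\<phi> \<in> characters B" for \<phi>
    using T(2) assms(2) that character_unit[OF that assms(2,3)] unfolding is_hat_def
    by (metis mult.right_neutral)
  ultimately show ?thesis by blast
qed

lemma (in comm_banach_algebra) multiplier_of_element:
  assumes a: "a \<in> ba_carrier B"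
  obtains T where "T \<in> multipliers B" "\<And>x. x \<in> ba_carrier B \<Longrightarrow> T x = ba_mult B a x"
proof -
  define T where "T = (\<lambda>x\<in>ba_carrier B. ba_mult B a x)"
  obtain C where C: "\<And>x y. x \<in> ba_carrier B \<Longrightarrow> y \<in> ba_carrier B \<Longrightarrow>
      ba_norm B (ba_mult B x y) \<le> C * ba_norm B x * ba_norm B y" using norm_mult by blast
  have "T \<in> multipliers B"
    unfolding multipliers_def
  proof (intro CollectI conjI ballI allI)
    show "T \<in> ba_carrier B \<rightarrow>\<^sub>E ba_carrier B" using a mult_closed by (auto simp: T_def)
    show "\<exists>K. \<forall>x\<in>ba_carrier B. ba_norm B (T x) \<le> K * ba_norm B x"
      using C[OF a] by (intro exI[of _ "C * ba_norm B a"]) (simp add: T_def)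
  next
    fix x y assume xy: "x \<in> ba_carrier B" "y \<in> ba_carrier B"
    show "T (ba_add B x y) = ba_add B (T x) (T y)"
      using xy a by (simp add: T_def add_closed mult_add)
    have "ba_mult B a (ba_mult B x y) = ba_mult B (ba_mult B a x) y"
      using xy a by (simp add: mult_assoc)
    also have "\<dots> = ba_mult B (ba_mult B x a) y" using xy a by (simp add: mult_commute)
    finally show "T (ba_mult B x y) = ba_mult B x (T y)"
      using xy a by (simp add: T_def mult_closed mult_assoc)
  next
    fix c x assume "x \<in> ba_carrier B"
    then show "T (ba_scale B c x) = ba_scale B c (T x)"
      using a by (simp add: T_def scale_closed mult_scale)
  qed
  then show ?thesis using that[of T] by (simp add: T_def)
qed

text \<open>A Gelfand transform of a is a BSE-function with constant essentially the norm of a, and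
  it is the hat of multiplication by a. If all of \<open>Cb B\<close> consists of such transforms,
  the three function sets coincide.\<close>

lemma (in comm_banach_algebra) gelfand_onto_imp_type_I:
  assumes u: "u \<in> ba_carrier B" "\<And>x. x \<in> ba_carrier B \<Longrightarrow> ba_mult B u x = x"
    and bdd: "\<And>\<phi>. \<phi> \<in> characters B \<Longrightarrow> \<exists>K. \<forall>x\<in>ba_carrier B. cmod (\<phi> x) \<le> K * ba_norm B x"
    and onto: "\<And>\<sigma>. \<sigma> \<in> Cb B \<Longrightarrow> \<exists>a\<in>ba_carrier B. \<forall>\<phi>\<in>characters B. \<sigma> \<phi> = \<phi> a"
  shows "type_I_BSE_algebra B"
proof -
  have "without_order B"
    unfolding without_order_def
  proof (intro ballI impI)
    fix b assume b: "b \<in> ba_carrier B" "\<forall>x\<in>ba_carrier B. ba_mult B b x = ba_zero B"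
    then show "b = ba_zero B" using u mult_commute[OF b(1) u(1)] by metis
  qed
  moreover have "\<sigma> \<in> C_BSE B" if \<sigma>: "\<sigma> \<in> Cb B" for \<sigma>
  proof -
    obtain a where a: "a \<in> ba_carrier B" "\<And>\<phi>. \<phi> \<in> characters B \<Longrightarrow> \<sigma> \<phi> = \<phi> a"
      using onto[OF \<sigma>] by blast
    have "BSE_function B \<sigma>"
      unfolding BSE_function_def
    \<comment> \<open>The \<open>+ 1\<close> makes the constant positive when a is zero.\<close>
    proof (intro exI[of _ "ba_norm B a + 1"] conjI allI impI)
      show "0 < ba_norm B a + 1" using norm_nonneg[OF a(1)] by simp
      fix n :: nat and c :: "nat \<Rightarrow> complex" and \<phi>
      assume "\<forall>j\<in>{1..n}. \<phi> j \<in> characters B"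
      then have \<phi>: "\<And>j. j \<in> {1..n} \<Longrightarrow> \<phi> j \<in> characters B" by blast
      let ?D = "dual_norm B (\<lambda>b. \<Sum>j=1..n. c j * \<phi> j b)"
      have "(\<Sum>j=1..n. c j * \<sigma> (\<phi> j)) = (\<Sum>j=1..n. c j * \<phi> j a)"
        using \<phi> a(2) by (intro sum.cong) auto
      moreover have "ba_norm B a * ?D \<le> (ba_norm B a + 1) * ?D"
        using cmod_character_sum_le_dual_norm(2)[where n = n and c = c and \<phi> = \<phi>, OF \<phi> bdd a(1)]
        by (simp add: mult_right_mono)
      ultimately show "cmod (\<Sum>j=1..n. c j * \<sigma> (\<phi> j)) \<le> (ba_norm B a + 1) * ?D"
        using cmod_character_sum_le_dual_norm(1)[where n = n and c = c and \<phi> = \<phi>, OF \<phi> bdd a(1)]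
        by simp
    qed
    with \<sigma> show ?thesis by (simp add: C_BSE_def)
  qed
  moreover have "\<sigma> \<in> multipliers_hat B" if \<sigma>: "\<sigma> \<in> Cb B" for \<sigma>
  proof -
    obtain a where a: "a \<in> ba_carrier B" "\<And>\<phi>. \<phi> \<in> characters B \<Longrightarrow> \<sigma> \<phi> = \<phi> a"
      using onto[OF \<sigma>] by blast
    from multiplier_of_element[OF a(1)] obtain T where T: "T \<in> multipliers B"
      "\<And>x. x \<in> ba_carrier B \<Longrightarrow> T x = ba_mult B a x" by blast
    have "is_hat B T \<sigma>"
      unfolding is_hat_def using \<sigma> a by (auto simp: T character_mult)
    with T(1) show ?thesis by (auto simp: multipliers_hat_def)
  qed
  ultimately show ?thesis
    using comm_banach_algebra_axioms
    by (auto simp: type_I_BSE_algebra_def BSE_algebra_def C_BSE_def multipliers_hat_def is_hat_def)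
qed

section \<open>The coefficient algebra: complex scalars, measurability, continuity of
  characters\<close>

lemma type_algebra_simps [simp]:
  "ba_carrier type_algebra = UNIV" "ba_zero type_algebra = 0" "ba_add type_algebra = (+)"
  "ba_mult type_algebra = (*)" "ba_scale type_algebra = scaleC" "ba_norm type_algebra = norm"
  by (simp_all add: type_algebra_def)

lemma scaleC_one: "scaleC 1 (x :: 'a::complex_banach_algebra) = x"
  using scaleR_scaleC[of 1 x] by simp

lemma scaleC_zero: "scaleC 0 (x :: 'a::complex_banach_algebra) = 0"
  using scaleR_scaleC[of 0 x] by simp

text \<open>Reduces variable complex scalars to real scaling and the single bounded operator
  \<open>scaleC \<i>\<close>, which settles measurability.\<close>

lemma scaleC_eq_scaleR:
  "scaleC c (x :: 'a::complex_banach_algebra) = Re c *\<^sub>R x + Im c *\<^sub>R scaleC \<i> x"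
  unfolding scaleR_scaleC scaleC_scaleC scaleC_add_left[symmetric]
  by (rule arg_cong[of _ _ "\<lambda>c. scaleC c x"]) (simp add: complex_eq_iff)

lemma bounded_linear_scaleC: "bounded_linear (scaleC c :: 'a::complex_banach_algebra \<Rightarrow> 'a)"
  by (rule bounded_linear_intro[of _ "cmod c"])
    (simp_all add: scaleC_add_right scaleR_scaleC scaleC_scaleC norm_scaleC mult.commute)

lemma bounded_linear_scaleC_left: "bounded_linear (\<lambda>c. scaleC c (x :: 'a::complex_banach_algebra))"
  by (rule bounded_linear_intro[of _ "norm x"])
    (simp_all add: scaleC_add_left scaleR_scaleC scaleC_scaleC norm_scaleC scaleR_conv_of_real)

lemma borel_measurable_scaleC [measurable]:
  fixes f :: "'x \<Rightarrow> 'a::{complex_banach_algebra, second_countable_topology}"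
  assumes [measurable]: "c \<in> borel_measurable M" "f \<in> borel_measurable M"
  shows "(\<lambda>x. scaleC (c x) (f x)) \<in> borel_measurable M"
proof -
  have [measurable]: "(\<lambda>x. scaleC \<i> (f x)) \<in> borel_measurable M"
    using borel_measurable_continuous_onI[of "scaleC \<i> :: 'a \<Rightarrow> 'a"]
      bounded_linear.continuous_on[OF bounded_linear_scaleC continuous_on_id, of UNIV \<i>]
      measurable_compose[OF assms(2)] by blast
  show ?thesis by (subst scaleC_eq_scaleR) measurable
qed

text \<open>If the bound failed, x could be rescaled to y of norm below 1 with
  \<open>\<phi> y = 1\<close>. The Neumann series z = y + y^2 + ... then satisfies z = y + y z, and
  applying \<phi> gives 0 = 1. The series starts at y since the unit may have norm above 1.\<close>

lemma character_type_algebra_le_norm: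
  fixes x :: "'a::{complex_banach_algebra, comm_ring_1}"
  assumes \<phi>: "\<phi> \<in> characters type_algebra"
  shows "cmod (\<phi> x) \<le> norm x"
proof (rule ccontr)
  assume "\<not> ?thesis"
  then have gt: "norm x < cmod (\<phi> x)" by simp
  then have nz: "\<phi> x \<noteq> 0" by auto
  define y where "y = scaleC (1 / \<phi> x) x"
  have \<phi>y: "\<phi> y = 1" using character_scale[OF \<phi>, of x "1 / \<phi> x"] nz by (simp add: y_def)
  have ny: "norm y < 1" using gt nz by (simp add: y_def norm_scaleC norm_divide field_simps)
  have pow: "norm (y ^ Suc n) \<le> norm y ^ Suc n" for n
  proof (induction n)
    case (Suc n)
    have "norm (y ^ Suc (Suc n)) \<le> norm y * norm (y ^ Suc n)"
      unfolding power_Suc[of y "Suc n"] by (rule norm_mult_ineq)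
    also have "\<dots> \<le> norm y * norm y ^ Suc n" by (intro mult_left_mono Suc) simp
    finally show ?case by simp
  qed simp
  have "summable (\<lambda>n. norm y ^ Suc n)"
    using summable_geometric[of "norm y"] ny by (subst summable_Suc_iff) simp
  then have sm: "summable (\<lambda>n. y ^ Suc n)"
    by (rule summable_comparison_test'[of _ 0]) (rule pow)
  define z where "z = (\<Sum>n. y ^ Suc n)"
  have "y * z = (\<Sum>n. y * y ^ Suc n)" unfolding z_def by (rule suminf_mult[OF sm, symmetric])
  moreover have "z = y + (\<Sum>n. y * y ^ Suc n)"
    unfolding z_def using suminf_split_head[OF sm] by (simp add: algebra_simps)
  ultimately have "z = y + y * z" by simp
  then have "\<phi> z = \<phi> y + \<phi> y * \<phi> z"
    using character_add[OF \<phi>, of y "y * z"] character_mult[OF \<phi>, of y z] by simp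
  then show False using \<phi>y by simp
qed

section \<open>The convolution algebra \<open>L\<^sup>p(G, A)\<close>\<close>

locale Lp_setting = compact_haar \<mu>
  for \<mu> :: "'g::{topological_ab_group_add, t2_space} measure" +
  fixes p :: real
    and B :: "('g \<Rightarrow> 'a::{complex_banach_algebra, comm_ring_1, separable_metric_space}) set calgebra"
  assumes p: "1 < p" and B_eq: "B = Lp_algebra p \<mu>"
begin

abbreviation "L \<equiv> Lp_functions p \<mu> :: ('g \<Rightarrow> 'a) set"
abbreviation "cls \<equiv> Lp_class p \<mu> :: ('g \<Rightarrow> 'a) \<Rightarrow> ('g \<Rightarrow> 'a) set"

lemma B_simps:
  "ba_carrier B = cls ` L" "ba_zero B = cls (\<lambda>_. 0)"
  "ba_add B X Y = cls (\<lambda>x. rep X x + rep Y x)"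
  "ba_mult B X Y = cls (convolution \<mu> (rep X) (rep Y))"
  "ba_scale B c X = cls (\<lambda>x. scaleC c (rep X x))"
  "ba_norm B X = Lp_norm p \<mu> (rep X)"
  by (simp_all add: B_eq Lp_algebra_def)

lemma L_measurable: "f \<in> L \<Longrightarrow> f \<in> borel_measurable \<mu>"
  by (simp add: Lp_functions_def)

lemma L_integrable:
  assumes "f \<in> L"
  shows "integrable \<mu> f"
proof (rule Bochner_Integration.integrable_bound)
  show "integrable \<mu> (\<lambda>x. 1 + norm (f x) powr p)"
    using assms by (auto simp: Lp_functions_def)
  show "f \<in> borel_measurable \<mu>" using assms by (rule L_measurable)
  have "norm (f x) \<le> 1 + norm (f x) powr p" for x
  proof (cases "norm (f x) \<le> 1")
    case True
    then show ?thesis by (simp add: add_increasing2)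
  next
    case False
    then have "norm (f x) powr 1 \<le> norm (f x) powr p" using p by (intro powr_mono) auto
    then show ?thesis using False by simp
  qed
  then show "AE x in \<mu>. norm (f x) \<le> norm (1 + norm (f x) powr p)" by simp
qed

lemma bounded_in_L:
  assumes "f \<in> borel_measurable \<mu>" "\<And>x. norm (f x) \<le> K"
  shows "f \<in> L"
proof -
  have "norm (f x) powr p \<le> K powr p" for x
    using assms(2) p by (intro powr_mono2) auto
  then have "integrable \<mu> (\<lambda>x. norm (f x) powr p)"
    using assms(1) by (intro integrable_const_bound[of _ "K powr p"]) auto
  then show ?thesis using assms(1) by (simp add: Lp_functions_def)
qed

lemma cls_cong: "AE x in \<mu>. f x = g x \<Longrightarrow> cls f = cls g"
  unfolding Lp_class_def by (auto elim: AE_mp)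

lemma self_in_cls: "f \<in> L \<Longrightarrow> f \<in> cls f"
  by (simp add: Lp_class_def)

text \<open>The hypothesis concerns the class: membership in the carrier already provides a function
  of L that equals f almost everywhere. Closure of \<open>B\<close> under an operation therefore
  gives control of the representative of its result.\<close>

lemma rep_cls:
  assumes "cls f \<in> ba_carrier B"
  shows "rep (cls f) \<in> L" "AE x in \<mu>. rep (cls f) x = f x"
proof -
  have "\<exists>g. g \<in> cls f" using assms self_in_cls by (auto simp: B_simps)
  then have "rep (cls f) \<in> cls f" unfolding rep_def by (rule someI_ex)
  then show "rep (cls f) \<in> L" "AE x in \<mu>. rep (cls f) x = f x" by (auto simp: Lp_class_def)
qed

lemma rep_in_L: "X \<in> ba_carrier B \<Longrightarrow> rep X \<in> L"
  using rep_cls(1) by (auto simp: B_simps)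

text \<open>The elementary tensor of a scalar function and a coefficient.\<close>

definition elem :: "('g \<Rightarrow> complex) \<Rightarrow> 'a \<Rightarrow> ('g \<Rightarrow> 'a) set" where
  "elem \<gamma> a = cls (\<lambda>x. scaleC (\<gamma> x) a)"

text \<open>The Fourier coefficient with values in the coefficient algebra. It is not divided by the
  mass, which makes it multiplicative for the unnormalised convolution.\<close>

definition fourier :: "('g \<Rightarrow> complex) \<Rightarrow> ('g \<Rightarrow> 'a) set \<Rightarrow> 'a" where
  "fourier \<gamma> X = (LINT y|\<mu>. scaleC (cnj (\<gamma> y)) (rep X y))"

lemma elem_fun_in_L:
  assumes "group_char \<gamma>"
  shows "(\<lambda>x. scaleC (\<gamma> x) a) \<in> L"
proof (rule bounded_in_L)
  show "(\<lambda>x. scaleC (\<gamma> x) a) \<in> borel_measurable \<mu>"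
    using continuous_measurable[OF group_char_cont[OF assms]] by measurable
  show "norm (scaleC (\<gamma> x) a) \<le> norm a" for x by (simp add: norm_scaleC group_char_norm[OF assms])
qed

lemma elem_closed: "group_char \<gamma> \<Longrightarrow> elem \<gamma> a \<in> ba_carrier B"
  unfolding elem_def B_simps using elem_fun_in_L by blast

lemma rep_elem: "group_char \<gamma> \<Longrightarrow> AE x in \<mu>. rep (elem \<gamma> a) x = scaleC (\<gamma> x) a"
  using rep_cls(2) elem_closed unfolding elem_def by blast

lemma fourier_integrable:
  assumes "group_char \<gamma>" "X \<in> ba_carrier B"
  shows "integrable \<mu> (\<lambda>y. scaleC (cnj (\<gamma> y)) (rep X y))"
proof (rule Bochner_Integration.integrable_bound)
  show "integrable \<mu> (rep X)" using L_integrable[OF rep_in_L[OF assms(2)]] .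
  have "\<gamma> \<in> borel_measurable \<mu>" using continuous_measurable[OF group_char_cont[OF assms(1)]] .
  then have "(\<lambda>y. cnj (\<gamma> y)) \<in> borel_measurable \<mu>"
    by (intro continuous_measurable continuous_intros group_char_cont assms)
  then show "(\<lambda>y. scaleC (cnj (\<gamma> y)) (rep X y)) \<in> borel_measurable \<mu>"
    using L_measurable[OF rep_in_L[OF assms(2)]] by (rule borel_measurable_scaleC)
  show "AE y in \<mu>. norm (scaleC (cnj (\<gamma> y)) (rep X y)) \<le> norm (rep X y)"
    by (simp add: norm_scaleC group_char_norm[OF assms(1)])
qed

lemma fourier_cong:
  assumes "group_char \<gamma>" "X \<in> ba_carrier B" "AE x in \<mu>. rep X x = f x" "f \<in> borel_measurable \<mu>"
  shows "fourier \<gamma> X = (LINT y|\<mu>. scaleC (cnj (\<gamma> y)) (f y))"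
  unfolding fourier_def
proof (rule integral_cong_AE)
  have "(\<lambda>y. cnj (\<gamma> y)) \<in> borel_measurable \<mu>"
    by (intro continuous_measurable continuous_intros group_char_cont assms)
  then show "(\<lambda>y. scaleC (cnj (\<gamma> y)) (f y)) \<in> borel_measurable \<mu>"
    using assms(4) by (rule borel_measurable_scaleC)
  show "AE y in \<mu>. scaleC (cnj (\<gamma> y)) (rep X y) = scaleC (cnj (\<gamma> y)) (f y)"
    using assms(3) by eventually_elim simp
qed (rule borel_measurable_integrable[OF fourier_integrable[OF assms(1,2)]])

lemma integral_scaleC_left:
  fixes k :: "'g \<Rightarrow> complex"
  shows "integrable \<mu> k \<Longrightarrow> (LINT y|\<mu>. scaleC (k y) (a :: 'a)) = scaleC (LINT y|\<mu>. k y) a"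
  by (rule integral_bounded_linear[OF bounded_linear_scaleC_left])

lemma integral_scaleC_right:
  fixes f :: "'g \<Rightarrow> 'a"
  shows "integrable \<mu> f \<Longrightarrow> (LINT y|\<mu>. scaleC c (f y)) = scaleC c (LINT y|\<mu>. f y)"
  by (rule integral_bounded_linear[OF bounded_linear_scaleC])

lemma fourier_elem:
  assumes "group_char \<gamma>" "group_char \<delta>"
  shows "fourier \<gamma> (elem \<delta> a) = (if \<delta> = \<gamma> then mass *\<^sub>R a else 0)"
proof -
  have "fourier \<gamma> (elem \<delta> a) = (LINT y|\<mu>. scaleC (cnj (\<gamma> y)) (scaleC (\<delta> y) a))"
    by (intro fourier_cong assms elem_closed rep_elem L_measurable elem_fun_in_L)
  also have "\<dots> = (LINT y|\<mu>. scaleC (\<delta> y * cnj (\<gamma> y)) a)" by (simp add: scaleC_scaleC mult.commute)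
  also have "\<dots> = scaleC (LINT y|\<mu>. \<delta> y * cnj (\<gamma> y)) a"
    by (intro integral_scaleC_left continuous_integrable group_char_cont group_char_mult_cnj assms)
  finally show ?thesis
    by (simp add: group_char_orthogonal[OF assms(2,1)] scaleR_scaleC scaleC_zero)
qed

text \<open>Since \<open>\<gamma> (x - y) = \<gamma> x * cnj (\<gamma> y)\<close>, the tensors over
  one character form an ideal on which X acts through its Fourier coefficient.\<close>

lemma mult_elem:
  assumes \<gamma>: "group_char \<gamma>" and X: "X \<in> ba_carrier B"
  shows "ba_mult B X (elem \<gamma> a) = elem \<gamma> (fourier \<gamma> X * a)"
proof -
  have "convolution \<mu> (rep X) (rep (elem \<gamma> a)) x = scaleC (\<gamma> x) (fourier \<gamma> X * a)" for x
  proof -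
    have measX: "rep X \<in> borel_measurable \<mu>" using L_measurable[OF rep_in_L[OF X]] .
    have measE: "(\<lambda>y. rep (elem \<gamma> a) (x - y)) \<in> borel_measurable \<mu>"
      by (rule measurable_compose[OF measurable_point_reflect L_measurable[OF rep_in_L[OF elem_closed[OF \<gamma>]]]])
    have meas\<gamma>: "(\<lambda>y. \<gamma> (x - y)) \<in> borel_measurable \<mu>"
      by (rule measurable_compose[OF measurable_point_reflect continuous_measurable[OF group_char_cont[OF \<gamma>]]])
    have "convolution \<mu> (rep X) (rep (elem \<gamma> a)) x = (LINT y|\<mu>. rep X y * scaleC (\<gamma> (x - y)) a)"
      unfolding convolution_def
    proof (rule integral_cong_AE)
      show "AE y in \<mu>. rep X y * rep (elem \<gamma> a) (x - y) = rep X y * scaleC (\<gamma> (x - y)) a"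
        using AE_point_reflect[OF rep_elem[OF \<gamma>, of a], of x] by eventually_elim simp
    qed (intro borel_measurable_times borel_measurable_scaleC measX measE meas\<gamma> borel_measurable_const)+
    also have "\<dots> = (LINT y|\<mu>. scaleC (\<gamma> x) (scaleC (cnj (\<gamma> y)) (rep X y) * a))"
      by (simp only: group_char_diff[OF \<gamma>] mult_scaleC_left mult_scaleC_right scaleC_scaleC)
    also have "\<dots> = scaleC (\<gamma> x) (LINT y|\<mu>. scaleC (cnj (\<gamma> y)) (rep X y) * a)"
      by (intro integral_scaleC_right integrable_mult_left fourier_integrable \<gamma> X)
    also have "(LINT y|\<mu>. scaleC (cnj (\<gamma> y)) (rep X y) * a) = fourier \<gamma> X * a"
      unfolding fourier_def by (intro Bochner_Integration.integral_mult_left fourier_integrable \<gamma> X)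
    finally show ?thesis .
  qed
  then show ?thesis unfolding B_simps elem_def by (intro cls_cong) simp
qed

lemma elem_inject:
  assumes \<gamma>: "group_char \<gamma>" and eq: "elem \<gamma> a = elem \<gamma> b"
  shows "a = b"
proof -
  have "mass *\<^sub>R a = mass *\<^sub>R b"
    using fourier_elem[OF \<gamma> \<gamma>, of a] fourier_elem[OF \<gamma> \<gamma>, of b] unfolding eq by metis
  then show ?thesis using mass_pos by auto
qed

end

text \<open>The algebra axioms are assumed here because they reach L^p in two ways: as part of the
  type I property, and by direct verification for finite groups.\<close>

locale Lp_banach_algebra = Lp_setting \<mu> p B + comm_banach_algebra B
  for \<mu> :: "'g::{topological_ab_group_add, t2_space} measure"
    and p :: real
    and B :: "('g \<Rightarrow> 'a::{complex_banach_algebra, comm_ring_1, separable_metric_space}) set calgebra"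
begin

lemma fourier_add:
  assumes "group_char \<gamma>" "X \<in> ba_carrier B" "Y \<in> ba_carrier B"
  shows "fourier \<gamma> (ba_add B X Y) = fourier \<gamma> X + fourier \<gamma> Y"
proof -
  have "fourier \<gamma> (ba_add B X Y) = (LINT y|\<mu>. scaleC (cnj (\<gamma> y)) (rep X y + rep Y y))"
    using add_closed[OF assms(2,3)] assms(1) L_measurable[OF rep_in_L[OF assms(2)]]
      L_measurable[OF rep_in_L[OF assms(3)]]
    unfolding B_simps(3) by (intro fourier_cong rep_cls(2) borel_measurable_add)
  then show ?thesis
    unfolding fourier_def scaleC_add_right using fourier_integrable assms by simp
qed

lemma fourier_scale:
  assumes "group_char \<gamma>" "X \<in> ba_carrier B"
  shows "fourier \<gamma> (ba_scale B c X) = scaleC c (fourier \<gamma> X)"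
proof -
  have "fourier \<gamma> (ba_scale B c X) = (LINT y|\<mu>. scaleC (cnj (\<gamma> y)) (scaleC c (rep X y)))"
    using scale_closed[OF assms(2), of c] assms(1) L_measurable[OF rep_in_L[OF assms(2)]]
    unfolding B_simps(5) by (intro fourier_cong rep_cls(2) borel_measurable_scaleC borel_measurable_const)
  also have "\<dots> = (LINT y|\<mu>. scaleC c (scaleC (cnj (\<gamma> y)) (rep X y)))"
    by (simp add: scaleC_scaleC mult.commute)
  also have "\<dots> = scaleC c (fourier \<gamma> X)"
    unfolding fourier_def by (rule integral_scaleC_right[OF fourier_integrable[OF assms]])
  finally show ?thesis .
qed

text \<open>Associativity of the product replaces Fubini's theorem, which is not available for Borel
  functions on a group without a countable base.\<close>

lemma fourier_mult:
  assumes \<gamma>: "group_char \<gamma>" and X: "X \<in> ba_carrier B" and Y: "Y \<in> ba_carrier B"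
  shows "fourier \<gamma> (ba_mult B X Y) = fourier \<gamma> X * fourier \<gamma> Y"
proof (rule elem_inject[OF \<gamma>])
  have "elem \<gamma> (fourier \<gamma> (ba_mult B X Y)) = ba_mult B (ba_mult B X Y) (elem \<gamma> 1)"
    using mult_elem[OF \<gamma> mult_closed[OF X Y]] by simp
  also have "\<dots> = ba_mult B X (ba_mult B Y (elem \<gamma> 1))"
    by (intro mult_assoc X Y elem_closed \<gamma>)
  also have "\<dots> = elem \<gamma> (fourier \<gamma> X * fourier \<gamma> Y)"
    using mult_elem[OF \<gamma> Y, of 1] mult_elem[OF \<gamma> X] by simp
  finally show "elem \<gamma> (fourier \<gamma> (ba_mult B X Y)) = elem \<gamma> (fourier \<gamma> X * fourier \<gamma> Y)" .
qed

definition tensor_char :: "('g \<Rightarrow> complex) \<Rightarrow> ('a \<Rightarrow> complex) \<Rightarrow> ('g \<Rightarrow> 'a) set \<Rightarrow> complex" where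
  "tensor_char \<gamma> \<phi> = (\<lambda>X\<in>ba_carrier B. \<phi> (fourier \<gamma> X))"

lemma tensor_char_apply: "X \<in> ba_carrier B \<Longrightarrow> tensor_char \<gamma> \<phi> X = \<phi> (fourier \<gamma> X)"
  by (simp add: tensor_char_def)

lemma tensor_char_character:
  assumes \<gamma>: "group_char \<gamma>" and \<phi>: "\<phi> \<in> characters type_algebra"
  shows "tensor_char \<gamma> \<phi> \<in> characters B"
proof -
  have 1: "\<phi> (x + y) = \<phi> x + \<phi> y" "\<phi> (x * y) = \<phi> x * \<phi> y" "\<phi> (scaleC c x) = c * \<phi> x" for x y c
    using character_add[OF \<phi>] character_mult[OF \<phi>] character_scale[OF \<phi>] by simp_all
  obtain a where a: "\<phi> a \<noteq> 0" using character_nonzero[OF \<phi>] by auto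
  have "tensor_char \<gamma> \<phi> (elem \<gamma> a) \<noteq> 0"
    using a mass_pos by (simp add: tensor_char_apply elem_closed \<gamma> fourier_elem scaleR_scaleC 1)
  then have "\<exists>X\<in>ba_carrier B. tensor_char \<gamma> \<phi> X \<noteq> 0" using elem_closed[OF \<gamma>] by blast
  then show ?thesis
    by (simp add: characters_def tensor_char_apply add_closed scale_closed mult_closed
        fourier_add fourier_scale fourier_mult \<gamma> 1) (simp add: tensor_char_def)
qed

lemma group_char_one: "group_char (\<lambda>_. 1)"
  by (simp add: group_char_def)

text \<open>Constant functions with values a and b convolve to the mass times \<open>a * b\<close>;
  division by the mass makes this embedding of the coefficient algebra multiplicative, with the
  idempotent \<open>const 1\<close> as image of the unit.\<close>

definition const :: "'a \<Rightarrow> ('g \<Rightarrow> 'a) set" where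
  "const a = elem (\<lambda>_. 1) ((1 / mass) *\<^sub>R a)"

lemma const_closed: "const a \<in> ba_carrier B"
  unfolding const_def by (rule elem_closed[OF group_char_one])

lemma fourier_const: "fourier (\<lambda>_. 1) (const a) = a"
  using mass_pos by (simp add: const_def fourier_elem group_char_one)

lemma const_mult: "ba_mult B (const a) (const b) = const (a * b)"
  using mult_elem[OF group_char_one const_closed, of a "(1 / mass) *\<^sub>R b"]
  by (simp add: fourier_const) (simp add: const_def)

lemma const_add: "const (a + b) = ba_add B (const a) (const b)"
proof -
  have "AE x in \<mu>. scaleC 1 ((1 / mass) *\<^sub>R (a + b)) = rep (const a) x + rep (const b) x"
    using rep_elem[OF group_char_one, of "(1 / mass) *\<^sub>R a"] rep_elem[OF group_char_one, of "(1 / mass) *\<^sub>R b"]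
    unfolding const_def by eventually_elim (simp add: scaleC_one scaleR_add_right)
  then show ?thesis
    unfolding B_simps(3) unfolding const_def[of "a + b"] elem_def by (rule cls_cong)
qed

lemma const_scale: "const (scaleC c a) = ba_scale B c (const a)"
proof -
  have "AE x in \<mu>. scaleC 1 ((1 / mass) *\<^sub>R scaleC c a) = scaleC c (rep (const a) x)"
    using rep_elem[OF group_char_one, of "(1 / mass) *\<^sub>R a"]
    unfolding const_def by eventually_elim (simp add: scaleC_one scaleR_scaleC scaleC_scaleC mult.commute)
  then show ?thesis
    unfolding B_simps(5) unfolding const_def[of "scaleC c a"] elem_def by (rule cls_cong)
qed

section \<open>Restriction to the constants and the passage to the coefficient algebra\<close>

lemma character_const_one:
  assumes "\<psi> \<in> characters B"
  shows "\<psi> (const 1) = 0 \<or> \<psi> (const 1) = 1"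
  using character_mult[OF assms const_closed const_closed, of 1 1] by (auto simp: const_mult)

lemma character_const:
  assumes \<psi>: "\<psi> \<in> characters B" and one: "\<psi> (const 1) = 1"
  shows "(\<lambda>a. \<psi> (const a)) \<in> characters type_algebra"
proof -
  have "\<exists>a. \<psi> (const a) \<noteq> 0" using one by (intro exI[of _ 1]) simp
  then show ?thesis
    by (simp add: characters_def const_add const_scale const_mult[symmetric]
        character_add[OF \<psi>] character_scale[OF \<psi>] character_mult[OF \<psi>] const_closed)
qed

text \<open>The idempotent \<open>const 1\<close> splits \<open>\<Delta>(B)\<close> into two clopen parts, one of which is \<open>\<Delta>(A)\<close>; a function
  on \<open>\<Delta>(A)\<close> is extended by zero.\<close>

lemma type_I_imp_coefficients_gelfand_onto:
  assumes I: "type_I_BSE_algebra B" and \<sigma>: "\<sigma> \<in> Cb (type_algebra :: 'a calgebra)"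
  obtains a where "\<And>\<phi>. \<phi> \<in> characters type_algebra \<Longrightarrow> \<sigma> \<phi> = \<phi> a"
proof -
  note A = comm_banach_algebra_type_algebra[where 'a = 'a]
  let ?X = "gelfand_topology B"
  define \<tau> where "\<tau> = (\<lambda>\<psi>\<in>characters B. if \<psi> (const 1) = 1 then \<sigma> (\<lambda>a. \<psi> (const a)) else 0)"
  \<comment> \<open>Both sets are open as preimages of complements of points. They are
    complementary, because a character takes only the values 0 and 1 at
    \<open>const 1\<close>.\<close>
  define C1 where "C1 = {\<psi> \<in> topspace ?X. \<psi> (const 1) \<in> - {0}}"
  define C0 where "C0 = {\<psi> \<in> topspace ?X. \<psi> (const 1) \<in> - {1}}"
  have op: "openin ?X C1" "openin ?X C0"
    unfolding C1_def C0_def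
    by (rule openin_continuous_map_preimage[OF continuous_map_gelfand_eval[OF const_closed]],
        simp add: open_Compl)+
  have C1: "\<psi> \<in> characters B" "\<psi> (const 1) = 1" if "\<psi> \<in> C1" for \<psi>
    using that character_const_one by (auto simp: C1_def topspace_gelfand)
  have res: "continuous_map (subtopology ?X C1) (gelfand_topology type_algebra) (\<lambda>\<psi> a. \<psi> (const a))"
    using C1 character_const
    by (intro continuous_map_into_gelfand continuous_map_from_subtopology continuous_map_gelfand_eval)
      (auto simp: const_closed)
  have "continuous_map (gelfand_topology type_algebra) euclidean \<sigma>" using \<sigma> by (simp add: Cb_def)
  from continuous_map_compose[OF res this]
  have cont: "continuous_map (subtopology ?X C1) euclidean (\<lambda>\<psi>. \<sigma> (\<lambda>a. \<psi> (const a)))"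
    by (simp add: o_def)
  have "continuous_map ?X euclidean \<tau>"
    unfolding continuous_map_def
  proof (intro conjI allI impI)
    fix U :: "complex set" assume U: "openin euclidean U"
    have "openin (subtopology ?X C1) {\<psi> \<in> topspace (subtopology ?X C1). \<sigma> (\<lambda>a. \<psi> (const a)) \<in> U}"
      by (rule openin_continuous_map_preimage[OF cont U])
    then have "openin ?X {\<psi> \<in> topspace (subtopology ?X C1). \<sigma> (\<lambda>a. \<psi> (const a)) \<in> U}"
      using op(1) openin_open_subtopology by blast
    moreover have "{\<psi> \<in> topspace ?X. \<tau> \<psi> \<in> U}
        = {\<psi> \<in> topspace (subtopology ?X C1). \<sigma> (\<lambda>a. \<psi> (const a)) \<in> U} \<union> (if 0 \<in> U then C0 else {})"
      using C1 by (auto simp: \<tau>_def C0_def topspace_gelfand) (auto simp: C1_def topspace_gelfand)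
    ultimately show "openin ?X {\<psi> \<in> topspace ?X. \<tau> \<psi> \<in> U}" using op(2) by auto
  qed simp
  moreover have "bounded (\<tau> ` characters B)"
  proof (rule bounded_subset)
    show "bounded (insert 0 (\<sigma> ` characters type_algebra))" using \<sigma> by (simp add: Cb_def)
    show "\<tau> ` characters B \<subseteq> insert 0 (\<sigma> ` characters type_algebra)"
      using character_const by (auto simp: \<tau>_def)
  qed
  ultimately have "\<tau> \<in> Cb B" by (simp add: Cb_def \<tau>_def)
  then have "\<tau> \<in> multipliers_hat B"
    using I unfolding type_I_BSE_algebra_def BSE_algebra_def by metis
  then obtain T where T: "T \<in> multipliers B" "is_hat B T \<tau>" by (auto simp: multipliers_hat_def)
  \<comment> \<open>The algebra \<open>B\<close> need not be unital, so the multiplier is evaluated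
    at \<open>const 1\<close>; the Fourier coefficient of the result at the trivial character is the
    element sought.\<close>
  have Tc: "T (const 1) \<in> ba_carrier B" using T(1) const_closed by (auto simp: multipliers_def)
  have "\<sigma> \<phi> = \<phi> (fourier (\<lambda>_. 1) (T (const 1)))" if \<phi>: "\<phi> \<in> characters type_algebra" for \<phi>
  proof -
    let ?\<psi> = "tensor_char (\<lambda>_. 1) \<phi>"
    have \<psi>: "?\<psi> \<in> characters B" by (rule tensor_char_character[OF group_char_one \<phi>])
    have c: "?\<psi> (const a) = \<phi> a" for a by (simp add: tensor_char_apply const_closed fourier_const)
    have one: "\<phi> 1 = 1" by (rule comm_banach_algebra.character_unit[OF A \<phi>]) auto
    have "?\<psi> (T (const 1)) = \<tau> ?\<psi> * ?\<psi> (const 1)"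
      using T(2) \<psi> const_closed by (simp add: is_hat_def)
    then show ?thesis using \<psi> by (simp add: c one \<tau>_def tensor_char_apply Tc)
  qed
  then show ?thesis by (rule that)
qed

lemma type_I_imp_coefficients_type_I:
  assumes I: "type_I_BSE_algebra B"
  shows "type_I_BSE_algebra (type_algebra :: 'a calgebra)"
proof (rule comm_banach_algebra.gelfand_onto_imp_type_I[OF comm_banach_algebra_type_algebra, of 1])
  show "\<exists>K. \<forall>x\<in>ba_carrier type_algebra. cmod (\<phi> x) \<le> K * ba_norm type_algebra x"
    if "\<phi> \<in> characters (type_algebra :: 'a calgebra)" for \<phi>
    using character_type_algebra_le_norm[OF that] by (intro exI[of _ 1]) simp
  show "\<exists>a\<in>ba_carrier type_algebra. \<forall>\<phi>\<in>characters type_algebra. \<sigma> \<phi> = \<phi> a"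
    if "\<sigma> \<in> Cb (type_algebra :: 'a calgebra)" for \<sigma>
    using type_I_imp_coefficients_gelfand_onto[OF I that] by (metis UNIV_I type_algebra_simps(1))
qed auto

section \<open>Finiteness of the group from the dual norm of a trigonometric polynomial\<close>

lemma Lp_norm_le_1_D:
  assumes "X \<in> ba_carrier B" "ba_norm B X \<le> 1"
  shows "(LINT x|\<mu>. norm (rep X x) powr p) \<le> 1"
proof (rule ccontr)
  let ?I = "LINT x|\<mu>. norm (rep X x) powr p"
  assume "\<not> ?I \<le> 1"
  then have "1 powr (1 / p) < ?I powr (1 / p)" using p by (intro powr_less_mono2) auto
  then show False using assms(2) by (simp add: B_simps Lp_norm_def)
qed

text \<open>If \<open>S\<close> consists of \<open>n\<close> characters, then \<open>F = \<bar>\<Sum>S\<bar>\<^sup>2\<close> is a trigonometric polynomial with \<open>F 0 = n\<^sup>2\<close>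
  and \<open>\<integral>F = n * mass\<close>. As \<open>F \<le> n\<^sup>2\<close>, its norm in the dual of \<open>L\<^sup>p\<close> is \<open>o(n\<^sup>2)\<close>, and so the constant
  function \<open>1\<close> is a BSE-function only for a bounded number of characters.\<close>

lemma type_I_imp_group_chars_bounded:
  assumes I: "type_I_BSE_algebra B" and \<phi>: "\<phi> \<in> characters (type_algebra :: 'a calgebra)"
  obtains N where "\<And>S :: ('g \<Rightarrow> complex) set. finite S \<Longrightarrow> S \<subseteq> {\<gamma>. group_char \<gamma>} \<Longrightarrow> real (card S) \<le> N"
proof -
  define one where "one = (\<lambda>\<psi>\<in>characters B. 1 :: complex)"
  have "continuous_map (gelfand_topology B) euclidean one"
    by (rule continuous_map_eq[of _ _ "\<lambda>_. 1"]) (auto simp: one_def topspace_gelfand)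
  moreover have "bounded (one ` characters B)"
    by (rule bounded_subset[of "{1}"]) (auto simp: one_def)
  ultimately have "one \<in> Cb B" by (simp add: Cb_def one_def)
  then have "BSE_function B one"
    using I by (auto simp: type_I_BSE_algebra_def C_BSE_def)
  then obtain \<beta> where \<beta>: "\<beta> > 0" "\<And>(n::nat) (c :: nat \<Rightarrow> complex) \<psi>.
     (\<forall>j\<in>{1..n}. \<psi> j \<in> characters B) \<Longrightarrow>
     cmod (\<Sum>j=1..n. c j * one (\<psi> j)) \<le> \<beta> * dual_norm B (\<lambda>b. \<Sum>j=1..n. c j * \<psi> j b)"
    unfolding BSE_function_def by blast
  have key: "(real (card S))\<^sup>2 \<le> \<beta> * (t * (real (card S) * mass) + (real (card S))\<^sup>2 * t powr (1 - p))"
    if S: "finite S" "S \<subseteq> {\<gamma>. group_char \<gamma>}" and t: "t > 0" for S :: "('g \<Rightarrow> complex) set" and t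
  proof -
    define n where "n = card S"
    have "finite (S \<times> S)" using S by simp
    \<comment> \<open>Different pairs may give the same character; BSE sums admit repetitions, and
      these carry the multiplicities in the expansion of F.\<close>
    from ex_bij_betw_nat_finite_1[OF this] obtain h where h: "bij_betw h {1..n * n} (S \<times> S)"
      by (auto simp: n_def card_cartesian_product)
    define \<epsilon> where "\<epsilon> = (\<lambda>(\<gamma>, \<delta>) (x :: 'g). \<gamma> x * cnj (\<delta> x) :: complex)"
    have \<epsilon>: "group_char (\<epsilon> z)" if "z \<in> S \<times> S" for z :: "('g \<Rightarrow> complex) \<times> ('g \<Rightarrow> complex)"
      using that S(2) group_char_mult_cnj by (auto simp: \<epsilon>_def)
    define F where "F x = (cmod (\<Sum>\<gamma>\<in>S. \<gamma> x))\<^sup>2" for x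
    have Feq: "complex_of_real (F x) = (\<Sum>z\<in>S \<times> S. \<epsilon> z x)" for x
      unfolding F_def complex_norm_square
      by (simp add: sum_product sum.cartesian_product \<epsilon>_def case_prod_beta)
    \<comment> \<open>F is real, so the expansion may be conjugated to match the conjugates in
      \<open>fourier\<close>.\<close>
    have Fcnj: "complex_of_real (F x) = (\<Sum>z\<in>S \<times> S. cnj (\<epsilon> z x))" for x
      using arg_cong[OF Feq[of x], of cnj] by simp
    have F0: "0 \<le> F x" for x by (simp add: F_def)
    have Fn: "F x \<le> (real n)\<^sup>2" for x
    proof -
      have "cmod (\<Sum>\<gamma>\<in>S. \<gamma> x) \<le> (\<Sum>\<gamma>\<in>S. 1)"
        using S(2) by (intro sum_norm_le) (auto simp: group_char_norm)
      then show ?thesis unfolding F_def by (intro power_mono) (auto simp: n_def)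
    qed
    have Fc: "continuous_on UNIV F"
      unfolding F_def using S(2) by (intro continuous_intros) (auto simp: group_char_cont)
    \<comment> \<open>By orthogonality only the n diagonal pairs contribute.\<close>
    have Fint: "(LINT x|\<mu>. F x) = real n * mass"
    proof -
      have "complex_of_real (LINT x|\<mu>. F x) = (LINT x|\<mu>. (\<Sum>z\<in>S \<times> S. \<epsilon> z x))"
        by (simp flip: Feq)
      also have "\<dots> = (\<Sum>z\<in>S \<times> S. LINT x|\<mu>. \<epsilon> z x)"
        by (rule Bochner_Integration.integral_sum) (intro continuous_integrable group_char_cont \<epsilon>)
      also have "\<dots> = (\<Sum>z\<in>S \<times> S. if fst z = snd z then of_real mass else 0)"
      proof (intro sum.cong refl)
        fix z assume "z \<in> S \<times> S"
        then have "group_char (fst z)" "group_char (snd z)" using S(2) by auto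
        from group_char_orthogonal[OF this]
        show "(LINT x|\<mu>. \<epsilon> z x) = (if fst z = snd z then of_real mass else 0)"
          by (simp add: \<epsilon>_def case_prod_beta)
      qed
      also have "\<dots> = (\<Sum>\<gamma>\<in>S. \<Sum>\<delta>\<in>S. if \<gamma> = \<delta> then of_real mass else 0)"
        by (simp add: sum.cartesian_product case_prod_beta)
      also have "\<dots> = of_real (real n * mass)" using S(1) by (simp add: n_def)
      finally show ?thesis unfolding of_real_eq_iff .
    qed
    define \<psi> where "\<psi> j = tensor_char (\<epsilon> (h j)) \<phi>" for j
    have hj: "h j \<in> S \<times> S" if "j \<in> {1..n * n}" for j by (rule bij_betw_apply[OF h that])
    have \<psi>: "\<psi> j \<in> characters B" if "j \<in> {1..n * n}" for j
      unfolding \<psi>_def by (intro tensor_char_character \<epsilon> hj that \<phi>)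
    have "dual_norm B (\<lambda>b. \<Sum>j=1..n * n. 1 * \<psi> j b) \<le> t * (real n * mass) + (real n)\<^sup>2 * t powr (1 - p)"
      unfolding dual_norm_def
    proof (rule cSUP_least)
      have "ba_norm B (ba_zero B) = 0" using norm_eq_zero[OF zero_closed] by simp
      then show "{b \<in> ba_carrier B. ba_norm B b \<le> 1} \<noteq> {}" using zero_closed by force
      fix X assume "X \<in> {b \<in> ba_carrier B. ba_norm B b \<le> 1}"
      then have X: "X \<in> ba_carrier B" "ba_norm B X \<le> 1" by auto
      let ?f = "rep X"
      have f: "?f \<in> L" by (rule rep_in_L[OF X(1)])
      have add: "\<phi> (\<Sum>i\<in>J. x i) = (\<Sum>i\<in>J. \<phi> (x i))" if "finite J" for J :: "nat set" and x
        using that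
      proof induction
        case empty
        show ?case using character_scale[OF \<phi>, of "0 :: 'a" 0] by (simp add: scaleC_zero)
      next
        case (insert i J)
        then show ?case using character_add[OF \<phi>] by simp
      qed
      have "(\<Sum>j=1..n * n. 1 * \<psi> j X) = \<phi> (\<Sum>j=1..n * n. fourier (\<epsilon> (h j)) X)"
        by (simp add: add \<psi>_def tensor_char_apply X)
      also have "(\<Sum>j=1..n * n. fourier (\<epsilon> (h j)) X) = (\<Sum>z\<in>S \<times> S. fourier (\<epsilon> z) X)"
        by (rule sum.reindex_bij_betw[OF h])
      also have "\<dots> = (LINT y|\<mu>. (\<Sum>z\<in>S \<times> S. scaleC (cnj (\<epsilon> z y)) (?f y)))"
        unfolding fourier_def
        by (rule Bochner_Integration.integral_sum[symmetric]) (intro fourier_integrable \<epsilon> X)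
      also have "\<dots> = (LINT y|\<mu>. F y *\<^sub>R ?f y)"
        unfolding scaleR_scaleC Fcnj
        by (simp add: linear_sum[OF bounded_linear.linear[OF bounded_linear_scaleC_left]])
      finally have "cmod (\<Sum>j=1..n * n. 1 * \<psi> j X) \<le> norm (LINT y|\<mu>. F y *\<^sub>R ?f y)"
        using character_type_algebra_le_norm[OF \<phi>] by simp
      also have "\<dots> \<le> (LINT y|\<mu>. norm (F y *\<^sub>R ?f y))" by (rule integral_norm_bound)
      also have "\<dots> \<le> (LINT y|\<mu>. t * F y + (real n)\<^sup>2 * t powr (1 - p) * norm (?f y) powr p)"
      proof (rule integral_mono)
        have Ff: "norm (F y *\<^sub>R ?f y) \<le> norm ((real n)\<^sup>2 *\<^sub>R ?f y)" for y
          using F0[of y] Fn[of y] by (simp add: mult_right_mono)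
        have Fm: "(\<lambda>y. F y *\<^sub>R ?f y) \<in> borel_measurable \<mu>"
          by (rule borel_measurable_scaleR[OF continuous_measurable[OF Fc] L_measurable[OF f]])
        show "integrable \<mu> (\<lambda>y. norm (F y *\<^sub>R ?f y))"
        proof (rule integrable_norm[OF Bochner_Integration.integrable_bound[OF _ Fm]])
          show "integrable \<mu> (\<lambda>y. (real n)\<^sup>2 *\<^sub>R ?f y)" using L_integrable[OF f] by simp
          show "AE y in \<mu>. norm (F y *\<^sub>R ?f y) \<le> norm ((real n)\<^sup>2 *\<^sub>R ?f y)"
            using Ff by (intro always_eventually allI)
        qed
        show "integrable \<mu> (\<lambda>y. t * F y + (real n)\<^sup>2 * t powr (1 - p) * norm (?f y) powr p)"
          using f continuous_integrable[OF Fc] by (auto simp: Lp_functions_def)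
        fix y
        show "norm (F y *\<^sub>R ?f y) \<le> t * F y + (real n)\<^sup>2 * t powr (1 - p) * norm (?f y) powr p"
        proof (cases "norm (?f y) \<le> t")
          case True
          then have "norm (F y *\<^sub>R ?f y) \<le> t * F y"
            using F0[of y] by (simp add: mult.commute[of t] mult_left_mono)
          moreover have "0 \<le> (real n)\<^sup>2 * t powr (1 - p) * norm (?f y) powr p" by simp
          ultimately show ?thesis by linarith
        next
          case False
          then have gt: "norm (?f y) > t" by simp
          \<comment> \<open>The exponent 1 - p is negative, so above height t this factor is at most
            \<open>t powr (1 - p)\<close>.\<close>
          have "norm (?f y) = norm (?f y) powr (1 - p) * norm (?f y) powr p"
            using gt t by (simp flip: powr_add)
          also have "\<dots> \<le> t powr (1 - p) * norm (?f y) powr p"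
            using gt t p by (intro mult_right_mono powr_mono2') auto
          finally have "F y * norm (?f y) \<le> (real n)\<^sup>2 * (t powr (1 - p) * norm (?f y) powr p)"
            using F0[of y] Fn[of y] by (intro mult_mono) auto
          then show ?thesis using F0[of y] t by (simp add: mult.assoc add_increasing)
        qed
      qed
      also have "\<dots> = t * (LINT y|\<mu>. F y) + (real n)\<^sup>2 * t powr (1 - p) * (LINT y|\<mu>. norm (?f y) powr p)"
        using f continuous_integrable[OF Fc] by (auto simp: Lp_functions_def)
      also have "\<dots> \<le> t * (real n * mass) + (real n)\<^sup>2 * t powr (1 - p) * 1"
        unfolding Fint by (intro add_left_mono mult_left_mono Lp_norm_le_1_D X) simp
      finally show "cmod (\<Sum>j=1..n * n. 1 * \<psi> j X) \<le> t * (real n * mass) + (real n)\<^sup>2 * t powr (1 - p)"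
        by simp
    qed
    then have "\<beta> * dual_norm B (\<lambda>b. \<Sum>j=1..n * n. 1 * \<psi> j b)
        \<le> \<beta> * (t * (real n * mass) + (real n)\<^sup>2 * t powr (1 - p))"
      using \<beta>(1) by (intro mult_left_mono) auto
    moreover have "cmod (\<Sum>j=1..n * n. 1 * one (\<psi> j)) \<le> \<beta> * dual_norm B (\<lambda>b. \<Sum>j=1..n * n. 1 * \<psi> j b)"
      by (rule \<beta>(2)) (use \<psi> in blast)
    moreover have "(\<Sum>j=1..n * n. 1 * one (\<psi> j)) = of_real ((real n)\<^sup>2)"
      using \<psi> by (simp add: one_def power2_eq_square)
    ultimately show ?thesis by (simp add: n_def flip: of_real_power)
  qed
  \<comment> \<open>At this height the second term of \<open>key\<close> is exactly half of the left
    side, and the term linear in \<open>card S\<close> must dominate the other half.\<close>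
  define t where "t = (2 * \<beta>) powr (1 / (p - 1))"
  have t: "t > 0" using \<beta>(1) by (simp add: t_def)
  have "t powr (1 - p) = (2 * \<beta>) powr (- 1)"
  proof -
    have "1 / (p - 1) * (1 - p) = - 1" using p by (simp add: field_simps)
    then show ?thesis unfolding t_def powr_powr by simp
  qed
  then have t2: "t powr (1 - p) = 1 / (2 * \<beta>)" using \<beta>(1) by (simp add: powr_minus_divide)
  have "real (card S) \<le> 2 * \<beta> * t * mass" if S: "finite S" "S \<subseteq> {\<gamma>. group_char \<gamma>}"
    for S :: "('g \<Rightarrow> complex) set"
  proof (cases "card S = 0")
    case True
    then show ?thesis using \<beta>(1) t mass_pos by simp
  next
    case False
    moreover have "(real (card S))\<^sup>2 \<le> \<beta> * (t * (real (card S) * mass) + (real (card S))\<^sup>2 * (1 / (2 * \<beta>)))"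
      using key[OF S t] unfolding t2 .
    ultimately show ?thesis using \<beta>(1) by (simp add: field_simps power2_eq_square)
  qed
  then show ?thesis by (rule that)
qed

lemma type_I_imp_finite:
  assumes I: "type_I_BSE_algebra B" and \<phi>: "\<phi> \<in> characters (type_algebra :: 'a calgebra)"
  shows "finite (UNIV :: 'g set)"
proof (rule ccontr)
  assume "infinite (UNIV :: 'g set)"
  then have inf: "infinite {\<gamma> :: 'g \<Rightarrow> complex. group_char \<gamma>}" by (rule infinite_group_chars)
  from type_I_imp_group_chars_bounded[OF I \<phi>] obtain N where
    N: "\<And>S :: ('g \<Rightarrow> complex) set. finite S \<Longrightarrow> S \<subseteq> {\<gamma>. group_char \<gamma>} \<Longrightarrow> real (card S) \<le> N" by blast
  obtain n where n: "N < real n" using reals_Archimedean2 by blast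
  from infinite_arbitrarily_large[OF inf] show False using N n by (metis not_less)
qed

end

section \<open>Finite groups\<close>

text \<open>Adds the endpoint 0 to convexity on the positive reals; there it amounts to r^p \<le> r
  for r between 0 and 1.\<close>

lemma powr_convex_nonneg:
  fixes u v s t p :: real
  assumes p: "1 \<le> p" and "0 \<le> u" "0 \<le> v" "0 < s" "0 < t" "s + t = 1"
  shows "(s * u + t * v) powr p \<le> s * u powr p + t * v powr p"
proof (cases "u = 0 \<or> v = 0")
  case True
  have *: "(r * w) powr p \<le> r * w powr p" if "0 < r" "r < 1" "0 \<le> w" for r w :: real
  proof -
    have "r powr p \<le> r powr 1" using that p by (intro powr_mono') auto
    then show ?thesis using that by (simp add: powr_mult mult_right_mono)
  qed
  then show ?thesis using True *[of s u] *[of t v] assms by auto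
next
  case False
  then have "((1 - t) * u + t * v) powr p \<le> (1 - t) * u powr p + t * v powr p"
    using convex_onD[OF powr_convex[OF p], of t u v] assms by simp
  moreover have "1 - t = s" using assms by simp
  ultimately show ?thesis by simp
qed

text \<open>With a and b the two norms, (u + v) / (a + b) is the convex combination of u / a and v /
  b with weights a / (a + b) and b / (a + b). Convexity of the p-th power is applied termwise and
  summed.\<close>

lemma Minkowski_sum:
  fixes u v :: "'i \<Rightarrow> real"
  assumes p: "1 \<le> p" and u: "\<And>i. i \<in> I \<Longrightarrow> 0 \<le> u i" and v: "\<And>i. i \<in> I \<Longrightarrow> 0 \<le> v i"
  shows "(\<Sum>i\<in>I. (u i + v i) powr p) powr (1 / p)
    \<le> (\<Sum>i\<in>I. u i powr p) powr (1 / p) + (\<Sum>i\<in>I. v i powr p) powr (1 / p)"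
proof (cases "finite I")
  case fin: True
  define a where "a = (\<Sum>i\<in>I. u i powr p) powr (1 / p)"
  define b where "b = (\<Sum>i\<in>I. v i powr p) powr (1 / p)"
  have root: "(x powr (1 / p)) powr p = x" if "0 \<le> x" for x :: real
    using that p by (simp add: powr_powr)
  have ap: "a powr p = (\<Sum>i\<in>I. u i powr p)" and bp: "b powr p = (\<Sum>i\<in>I. v i powr p)"
    unfolding a_def b_def by (intro root sum_nonneg; simp)+
  consider "a = 0" | "b = 0" | "a > 0" "b > 0"
    by (metis a_def b_def order_le_less powr_ge_zero)
  then show ?thesis
  proof cases
    case 1
    then have "\<forall>i\<in>I. u i = 0" using ap fin by (simp add: sum_nonneg_eq_0_iff)
    then have "(\<Sum>i\<in>I. (u i + v i) powr p) = (\<Sum>i\<in>I. v i powr p)" by (intro sum.cong) auto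
    then show ?thesis by simp
  next
    case 2
    then have "\<forall>i\<in>I. v i = 0" using bp fin by (simp add: sum_nonneg_eq_0_iff)
    then have "(\<Sum>i\<in>I. (u i + v i) powr p) = (\<Sum>i\<in>I. u i powr p)" by (intro sum.cong) auto
    then show ?thesis by simp
  next
    case 3
    define s where "s = a / (a + b)"
    define t where "t = b / (a + b)"
    have st: "0 < s" "0 < t" "s + t = 1"
      using 3 by (auto simp: s_def t_def add_divide_distrib[symmetric])
    have "(\<Sum>i\<in>I. (u i + v i) powr p) \<le> (\<Sum>i\<in>I. (a + b) powr p * (s * (u i powr p / a powr p) + t * (v i powr p / b powr p)))"
    proof (rule sum_mono)
      fix i assume i: "i \<in> I"
      have "u i + v i = (a + b) * (s * (u i / a) + t * (v i / b))"
        using 3 by (simp add: s_def t_def divide_simps)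
      then have "(u i + v i) powr p = (a + b) powr p * (s * (u i / a) + t * (v i / b)) powr p"
        using 3 st u[OF i] v[OF i] by (simp add: powr_mult)
      also have "\<dots> \<le> (a + b) powr p * (s * (u i / a) powr p + t * (v i / b) powr p)"
        using 3 u[OF i] v[OF i] st by (intro mult_left_mono powr_convex_nonneg p) auto
      finally show "(u i + v i) powr p \<le> (a + b) powr p * (s * (u i powr p / a powr p) + t * (v i powr p / b powr p))"
        using 3 u[OF i] v[OF i] by (simp add: powr_divide)
    qed
    also have "\<dots> = (a + b) powr p * (s * ((\<Sum>i\<in>I. u i powr p) / a powr p) + t * ((\<Sum>i\<in>I. v i powr p) / b powr p))"
      by (simp add: sum_distrib_left sum.distrib sum_divide_distrib distrib_left)
    also have "\<dots> = (a + b) powr p" using 3 st by (simp flip: ap bp)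
    finally have "(\<Sum>i\<in>I. (u i + v i) powr p) powr (1 / p) \<le> ((a + b) powr p) powr (1 / p)"
      using p by (intro powr_mono2 sum_nonneg) auto
    also have "\<dots> = a + b" using 3 p by (simp add: powr_powr)
    finally show ?thesis by (simp add: a_def b_def)
  qed
qed simp

lemma sum_UNIV_translate: "(\<Sum>y\<in>UNIV. F (y + a)) = (\<Sum>y\<in>UNIV. F y)" for a :: "'g::ab_group_add"
  by (rule sum.reindex_bij_betw) (rule bij_betw_byWitness[of _ "\<lambda>y. y - a"], auto)

lemma sum_UNIV_reflect: "(\<Sum>y\<in>UNIV. F (a - y)) = (\<Sum>y\<in>UNIV. F y)" for a :: "'g::ab_group_add"
  by (rule sum.reindex_bij_betw) (rule bij_betw_byWitness[of _ "\<lambda>y. a - y"], auto)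

text \<open>Translating the product of all values by a shows that \<open>\<gamma> a\<close> is a
  root of unity of order dividing the group order, so only finitely many functions are
  possible.\<close>

lemma finite_group_chars:
  assumes fin: "finite (UNIV :: 'g::topological_ab_group_add set)"
  shows "finite {\<gamma> :: 'g \<Rightarrow> complex. group_char \<gamma>}"
proof -
  let ?n = "card (UNIV :: 'g set)"
  have n: "?n \<ge> 1" using fin by (simp add: Suc_le_eq card_gt_0_iff)
  have "\<gamma> a ^ ?n = 1" if \<gamma>: "group_char \<gamma>" for \<gamma> and a :: 'g
  proof -
    have "(\<Prod>y\<in>UNIV. \<gamma> (y + a)) = (\<Prod>y\<in>UNIV. \<gamma> y)"
      by (rule prod.reindex_bij_betw) (rule bij_betw_byWitness[of _ "\<lambda>y. y - a"], auto)
    then have "(\<Prod>y\<in>UNIV. \<gamma> y) * \<gamma> a ^ ?n = (\<Prod>y\<in>UNIV. \<gamma> y)"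
      by (simp add: group_char_add[OF \<gamma>] prod.distrib)
    moreover have "\<gamma> y \<noteq> 0" for y using group_char_norm[OF \<gamma>, of y] by auto
    ultimately show ?thesis using fin by simp
  qed
  then have "{\<gamma> :: 'g \<Rightarrow> complex. group_char \<gamma>} \<subseteq> UNIV \<rightarrow>\<^sub>E {z. z ^ ?n = 1}" by auto
  moreover have "finite (UNIV \<rightarrow>\<^sub>E {z :: complex. z ^ ?n = 1} :: ('g \<Rightarrow> complex) set)"
    using fin n by (intro finite_PiE finite_nth_roots) auto
  ultimately show ?thesis by (rule finite_subset)
qed

section \<open>L^p over a finite group as an algebra of all functions\<close>

locale finite_Lp_setting = Lp_setting \<mu> p B
  for \<mu> :: "'g::{topological_ab_group_add, t2_space} measure"
    and p :: real
    and B :: "('g \<Rightarrow> 'a::{complex_banach_algebra, comm_ring_1, separable_metric_space}) set calgebra" +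
  assumes fin: "finite (UNIV :: 'g set)"
begin

lemma open_any: "open (S :: 'g set)"
  using finite_imp_closed[OF finite_subset[OF subset_UNIV fin], of "- S"] by (simp add: closed_def)

lemma in_sets_any: "S \<in> sets \<mu>"
  by (simp add: sets_borel open_any)

lemma measurable_any: "f \<in> measurable \<mu> N \<longleftrightarrow> range f \<subseteq> space N"
  by (auto simp: measurable_def in_sets_any)

lemma borel_measurable_any: "(f :: 'g \<Rightarrow> 'b::topological_space) \<in> borel_measurable \<mu>"
  by (simp add: measurable_any)

lemma continuous_on_any: "continuous_on UNIV (f :: 'g \<Rightarrow> 'b::topological_space)"
  by (simp add: continuous_on_open_vimage open_any)

abbreviation weight :: real where "weight \<equiv> measure \<mu> {0}"

lemma weight_pos: "weight > 0"
  by (rule open_measure_pos) (auto intro: open_any)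

lemma measure_singleton: "measure \<mu> {x} = weight"
  using measure_translate[of "{0}" x] by (simp add: emeasure_eq_measure)

text \<open>A finite Hausdorff group is discrete, so every nonempty set is open and has positive
  measure. Classes in L^p are therefore singletons.\<close>

lemma AE_iff_all: "(AE x in \<mu>. P x) \<longleftrightarrow> (\<forall>x. P x)"
proof
  assume "AE x in \<mu>. P x"
  then have "emeasure \<mu> {x. \<not> P x} = 0"
    by (subst (asm) AE_iff_measurable[of "{x. \<not> P x}"]) (auto simp: in_sets_any)
  then show "\<forall>x. P x"
    using open_measure_pos[OF open_any, of "{x. \<not> P x}"] by (auto simp: emeasure_eq_measure)
qed simp

lemma integrable_any:
  fixes f :: "'g \<Rightarrow> 'b::{banach, second_countable_topology}"
  shows "integrable \<mu> f"
  by (rule continuous_integrable[OF continuous_on_any])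

lemma integral_eq_sum:
  fixes f :: "'g \<Rightarrow> 'b::{banach, second_countable_topology}"
  shows "(LINT x|\<mu>. f x) = weight *\<^sub>R (\<Sum>x\<in>UNIV. f x)"
proof -
  have "f x = (\<Sum>y\<in>UNIV. indicat_real {y} x *\<^sub>R f y)" for x
  proof -
    have "(\<Sum>y\<in>UNIV. indicator {y} x *\<^sub>R f y) = (\<Sum>y\<in>UNIV. if x = y then f y else 0)"
      by (intro sum.cong) auto
    then show ?thesis using fin by simp
  qed
  then have "(LINT x|\<mu>. f x) = (LINT x|\<mu>. (\<Sum>y\<in>UNIV. indicator {y} x *\<^sub>R f y))"
    by (rule Bochner_Integration.integral_cong[OF refl])
  also have "\<dots> = (\<Sum>y\<in>UNIV. LINT x|\<mu>. indicator {y} x *\<^sub>R f y)"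
    by (rule Bochner_Integration.integral_sum) (rule integrable_any)
  also have "\<dots> = (\<Sum>y\<in>UNIV. weight *\<^sub>R f y)"
  proof (rule sum.cong)
    fix y
    have "(LINT x|\<mu>. indicator {y} x *\<^sub>R f y) = measure \<mu> {y} *\<^sub>R f y"
    proof (subst Bochner_Integration.integral_scaleR_left)
      show "(LINT x|\<mu>. indicat_real {y} x) *\<^sub>R f y = measure \<mu> {y} *\<^sub>R f y"
        by (simp add: in_sets_any)
    qed (rule integrable_any)
    then show "(LINT x|\<mu>. indicator {y} x *\<^sub>R f y) = weight *\<^sub>R f y" using measure_singleton[of y] by simp
  qed simp
  finally show ?thesis by (simp add: scaleR_sum_right)
qed

lemma L_UNIV: "L = UNIV"
proof -
  have "f \<in> L" for f
  proof (rule bounded_in_L[OF borel_measurable_any])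
    show "norm (f x) \<le> (\<Sum>y\<in>UNIV. norm (f y))" for x
      by (rule member_le_sum) (auto simp: fin)
  qed
  then show ?thesis by auto
qed

lemma cls_eq: "cls f = {f}"
  by (auto simp: Lp_class_def L_UNIV AE_iff_all)

lemma rep_singleton: "rep {f} = f"
  by (simp add: rep_def)

lemma carrier_eq: "ba_carrier B = range (\<lambda>f. {f})"
  by (simp add: B_simps L_UNIV cls_eq)

lemma singleton_closed: "{f} \<in> ba_carrier B"
  by (simp add: carrier_eq)

lemma convolution_eq: "convolution \<mu> f g x = weight *\<^sub>R (\<Sum>y\<in>UNIV. f y * (g (x - y) :: 'a))"
  by (simp add: convolution_def integral_eq_sum)

lemma Lp_norm_eq: "Lp_norm p \<mu> f = weight powr (1 / p) * (\<Sum>x\<in>UNIV. norm (f x) powr p) powr (1 / p)"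
  for f :: "'g \<Rightarrow> 'a"
  unfolding Lp_norm_def integral_eq_sum using weight_pos by (simp add: powr_mult sum_nonneg)

lemma minus_scaleC: "scaleC (- 1) (x :: 'a) = - x"
  using scaleR_scaleC[of "- 1" x] by simp

lemma ops:
  "ba_zero B = {\<lambda>_. 0}" "ba_add B {f} {g} = {\<lambda>x. f x + g x}"
  "ba_mult B {f} {g} = {convolution \<mu> f g}" "ba_scale B c {f} = {\<lambda>x. scaleC c (f x)}"
  "ba_norm B {f} = Lp_norm p \<mu> f" "ba_diff B {f} {g} = {\<lambda>x. f x - g x}"
  by (simp_all add: B_simps cls_eq rep_singleton ba_diff_def minus_scaleC)

text \<open>A single summand of the p-norm carries the weight of one point. Together with
  \<open>Lp_norm_le\<close> this makes the norm equivalent to the maximum norm, from which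
  boundedness of the product and completeness follow.\<close>

lemma norm_le_Lp_norm: "norm (f x) \<le> weight powr (- 1 / p) * Lp_norm p \<mu> f" for f :: "'g \<Rightarrow> 'a"
proof -
  have "norm (f x) = (norm (f x) powr p) powr (1 / p)" using p by (simp add: powr_powr)
  also have "\<dots> \<le> (\<Sum>x\<in>UNIV. norm (f x) powr p) powr (1 / p)"
    using p by (intro powr_mono2 member_le_sum) (auto simp: fin)
  also have "\<dots> = weight powr (- 1 / p) * Lp_norm p \<mu> f"
    using weight_pos by (simp add: Lp_norm_eq powr_minus divide_inverse flip: powr_add mult.assoc)
  finally show ?thesis .
qed

lemma Lp_norm_le:
  fixes f :: "'g \<Rightarrow> 'a"
  assumes "\<And>x. norm (f x) \<le> K"
  shows "Lp_norm p \<mu> f \<le> mass powr (1 / p) * K"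
proof -
  have K: "0 \<le> K" using order_trans[OF norm_ge_zero assms] .
  have "(LINT x|\<mu>. norm (f x) powr p) \<le> (LINT x|\<mu>. K powr p)"
    using p by (intro integral_mono integrable_any powr_mono2 assms) auto
  then have "Lp_norm p \<mu> f \<le> (mass * K powr p) powr (1 / p)"
    unfolding Lp_norm_def using p by (intro powr_mono2) (auto simp: integral_nonneg)
  also have "\<dots> = mass powr (1 / p) * K" using p K mass_pos by (simp add: powr_mult powr_powr)
  finally show ?thesis .
qed

lemma Lp_norm_triangle: "Lp_norm p \<mu> (\<lambda>x. f x + g x) \<le> Lp_norm p \<mu> f + Lp_norm p \<mu> g"
  for f g :: "'g \<Rightarrow> 'a"
proof -
  have "(\<Sum>x\<in>UNIV. norm (f x + g x) powr p) powr (1 / p)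
      \<le> (\<Sum>x\<in>UNIV. (norm (f x) + norm (g x)) powr p) powr (1 / p)"
    using p by (intro powr_mono2 sum_mono sum_nonneg norm_triangle_ineq) auto
  also have "\<dots> \<le> (\<Sum>x\<in>UNIV. norm (f x) powr p) powr (1 / p) + (\<Sum>x\<in>UNIV. norm (g x) powr p) powr (1 / p)"
    using p by (intro Minkowski_sum) auto
  finally show ?thesis
    unfolding Lp_norm_eq distrib_left[symmetric] by (rule mult_left_mono) simp
qed

lemma Lp_norm_scaleC: "Lp_norm p \<mu> (\<lambda>x. scaleC c (f x)) = cmod c * Lp_norm p \<mu> f" for f :: "'g \<Rightarrow> 'a"
proof -
  have "(\<Sum>x\<in>UNIV. norm (scaleC c (f x)) powr p) = cmod c powr p * (\<Sum>x\<in>UNIV. norm (f x) powr p)"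
    by (simp add: norm_scaleC powr_mult sum_distrib_left)
  then show ?thesis
    unfolding Lp_norm_eq using p by (simp add: powr_mult powr_powr sum_nonneg)
qed

lemma Lp_norm_nonneg: "0 \<le> Lp_norm p \<mu> f" for f :: "'g \<Rightarrow> 'a"
  by (simp add: Lp_norm_def)

lemma Lp_norm_eq_0: "Lp_norm p \<mu> f = 0 \<longleftrightarrow> f = (\<lambda>_. 0)" for f :: "'g \<Rightarrow> 'a"
proof
  assume "Lp_norm p \<mu> f = 0"
  then have "norm (f x) \<le> 0" for x using norm_le_Lp_norm[of f x] by simp
  then show "f = (\<lambda>_. 0)" by auto
qed (simp add: Lp_norm_def)

lemma Lp_norm_convolution_le:
  fixes f g :: "'g \<Rightarrow> 'a"
  defines "K \<equiv> weight powr (- 1 / p)"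
  shows "Lp_norm p \<mu> (convolution \<mu> f g) \<le> (mass powr (1 / p) * (mass * K * K)) * Lp_norm p \<mu> f * Lp_norm p \<mu> g"
proof -
  have "norm (convolution \<mu> f g x) \<le> mass * ((K * Lp_norm p \<mu> f) * (K * Lp_norm p \<mu> g))" for x
    unfolding convolution_def
  proof (rule norm_integral_le_const)
    fix y
    have "norm (f y * g (x - y)) \<le> norm (f y) * norm (g (x - y))" by (rule norm_mult_ineq)
    also have "\<dots> \<le> (K * Lp_norm p \<mu> f) * (K * Lp_norm p \<mu> g)"
      unfolding K_def
      by (intro mult_mono norm_le_Lp_norm mult_nonneg_nonneg Lp_norm_nonneg) auto
    finally show "norm (f y * g (x - y)) \<le> (K * Lp_norm p \<mu> f) * (K * Lp_norm p \<mu> g)" .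
  qed
  then have "Lp_norm p \<mu> (convolution \<mu> f g) \<le> mass powr (1 / p) * (mass * ((K * Lp_norm p \<mu> f) * (K * Lp_norm p \<mu> g)))"
    by (rule Lp_norm_le)
  then show ?thesis by (simp add: mult_ac)
qed

lemma convolution_commute: "convolution \<mu> f g = convolution \<mu> g (f :: 'g \<Rightarrow> 'a)"
proof
  fix x
  show "convolution \<mu> f g x = convolution \<mu> g f x"
    unfolding convolution_eq using sum_UNIV_reflect[of "\<lambda>y. f y * g (x - y)" x]
    by (simp add: mult.commute)
qed

lemma convolution_assoc:
  "convolution \<mu> (convolution \<mu> f g) h = convolution \<mu> f (convolution \<mu> g (h :: 'g \<Rightarrow> 'a))"
proof
  fix x
  have "(\<Sum>y\<in>UNIV. (\<Sum>z\<in>UNIV. f z * g (y - z)) * h (x - y))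
      = (\<Sum>z\<in>UNIV. \<Sum>y\<in>UNIV. f z * (g (y - z) * h (x - y)))"
    unfolding sum_distrib_right by (subst sum.swap) (simp add: mult.assoc)
  also have "\<dots> = (\<Sum>z\<in>UNIV. f z * (\<Sum>y\<in>UNIV. g y * h (x - z - y)))"
  proof (rule sum.cong)
    fix z
    show "(\<Sum>y\<in>UNIV. f z * (g (y - z) * h (x - y))) = f z * (\<Sum>y\<in>UNIV. g y * h (x - z - y))"
      using sum_UNIV_translate[of "\<lambda>y. g y * h (x - z - y)" "- z"]
      by (simp add: sum_distrib_left[symmetric])
  qed simp
  finally show "convolution \<mu> (convolution \<mu> f g) h x = convolution \<mu> f (convolution \<mu> g h) x"
    unfolding convolution_eq by (simp add: scaleR_sum_right[symmetric])
qed

lemma convolution_left_commute: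
  "convolution \<mu> f (convolution \<mu> g h) = convolution \<mu> g (convolution \<mu> f (h :: 'g \<Rightarrow> 'a))"
  by (metis convolution_assoc convolution_commute)

lemma convolution_add_right:
  "convolution \<mu> f (\<lambda>x. g x + h x) = (\<lambda>x. convolution \<mu> f g x + convolution \<mu> f h x)" for f g h :: "'g \<Rightarrow> 'a"
  by (simp add: fun_eq_iff convolution_eq distrib_left sum.distrib scaleR_add_right)

lemma convolution_scale_right:
  "convolution \<mu> f (\<lambda>x. scaleC c (g x)) = (\<lambda>x. scaleC c (convolution \<mu> f g x))" for f g :: "'g \<Rightarrow> 'a"
  by (simp add: fun_eq_iff convolution_eq mult_scaleC_right linear_sum[OF bounded_linear.linear[OF bounded_linear_scaleC]]
      linear_scale[OF bounded_linear.linear[OF bounded_linear_scaleC]])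

end

text \<open>For completeness, a Cauchy sequence converges at each point, and on a finite group the
  sum of the pointwise errors dominates the L^p error.\<close>

sublocale finite_Lp_setting \<subseteq> Lp_banach_algebra
proof (intro Lp_banach_algebra.intro Lp_setting_axioms)
  show "comm_banach_algebra B"
  proof
    fix s :: "nat \<Rightarrow> ('g \<Rightarrow> 'a) set"
    assume s: "\<And>n. s n \<in> ba_carrier B"
      and cauchy: "\<And>e. e > 0 \<Longrightarrow> \<exists>N. \<forall>m\<ge>N. \<forall>n\<ge>N. ba_norm B (ba_diff B (s m) (s n)) < e"
    obtain F where F: "\<And>n. s n = {F n}" using s unfolding carrier_eq image_iff by metis
    let ?K = "weight powr (- 1 / p)"
    have K: "?K > 0" using weight_pos by simp
    have "convergent (\<lambda>n. F n x)" for x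
    proof (rule Cauchy_convergent, rule metric_CauchyI)
      fix e :: real assume "e > 0"
      then have "e / ?K > 0" using K by simp
      from cauchy[OF this] obtain N where N: "\<And>m n. m \<ge> N \<Longrightarrow> n \<ge> N \<Longrightarrow>
          Lp_norm p \<mu> (\<lambda>x. F m x - F n x) < e / ?K" by (auto simp: F ops)
      have "dist (F m x) (F n x) < e" if "m \<ge> N" "n \<ge> N" for m n
      proof -
        have "dist (F m x) (F n x) \<le> ?K * Lp_norm p \<mu> (\<lambda>x. F m x - F n x)"
          using norm_le_Lp_norm[of "\<lambda>x. F m x - F n x" x] by (simp add: dist_norm)
        also have "\<dots> < e" using N[OF that] K by (simp add: field_simps)
        finally show ?thesis .
      qed
      then show "\<exists>M. \<forall>m\<ge>M. \<forall>n\<ge>M. dist (F m x) (F n x) < e" by blast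
    qed
    then obtain f where f: "\<And>x. (\<lambda>n. F n x) \<longlonglongrightarrow> f x" unfolding convergent_def by metis
    have "(\<lambda>n. mass powr (1 / p) * (\<Sum>x\<in>UNIV. norm (F n x - f x))) \<longlonglongrightarrow> mass powr (1 / p) * (\<Sum>x\<in>(UNIV :: 'g set). 0)"
      using f by (intro tendsto_mult tendsto_const tendsto_sum tendsto_norm_zero LIM_zero)
    then have lim: "(\<lambda>n. mass powr (1 / p) * (\<Sum>x\<in>UNIV. norm (F n x - f x))) \<longlonglongrightarrow> 0" by simp
    have "Lp_norm p \<mu> (\<lambda>x. F n x - f x) \<le> mass powr (1 / p) * (\<Sum>x\<in>UNIV. norm (F n x - f x))" for n
      by (rule Lp_norm_le, rule member_le_sum) (auto simp: fin)
    then have "(\<lambda>n. Lp_norm p \<mu> (\<lambda>x. F n x - f x)) \<longlonglongrightarrow> 0"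
      by (intro Lim_null_comparison[OF _ lim]) (simp add: Lp_norm_nonneg)
    then show "\<exists>x\<in>ba_carrier B. (\<lambda>n. ba_norm B (ba_diff B (s n) x)) \<longlonglongrightarrow> 0"
      by (intro bexI[of _ "{f}"]) (simp_all add: F ops singleton_closed)
  next
    show "\<exists>C. \<forall>x\<in>ba_carrier B. \<forall>y\<in>ba_carrier B. ba_norm B (ba_mult B x y) \<le> C * ba_norm B x * ba_norm B y"
      using Lp_norm_convolution_le unfolding carrier_eq by (auto simp: ops)
  qed (auto simp: carrier_eq ops image_iff add.assoc add.commute add.left_commute scaleC_add_right scaleC_add_left
      scaleC_scaleC scaleC_one convolution_assoc Lp_norm_nonneg Lp_norm_eq_0 Lp_norm_triangle
      Lp_norm_scaleC convolution_commute convolution_left_commute convolution_add_right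
      convolution_scale_right)
qed

section \<open>Characters over a finite group and Fourier inversion\<close>

context finite_Lp_setting
begin

text \<open>The Dirac mass at x with coefficient a: dividing by the weight of a point cancels the
  weight in the convolution, so \<open>point 0 1\<close> is the unit and \<open>point x 1\<close>
  acts by translation.\<close>

definition point :: "'g \<Rightarrow> 'a \<Rightarrow> 'g \<Rightarrow> 'a" where
  "point x a = (\<lambda>y. if y = x then (1 / weight) *\<^sub>R a else 0)"

lemma convolution_point: "convolution \<mu> (point x a) f y = a * f (y - x)"
proof -
  have "(\<Sum>z\<in>UNIV. point x a z * f (y - z)) = (\<Sum>z\<in>UNIV. if z = x then (1 / weight) *\<^sub>R (a * f (y - x)) else 0)"
    by (intro sum.cong) (auto simp: point_def)
  then show ?thesis unfolding convolution_eq using weight_pos fin by simp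
qed

lemma convolution_point_point: "convolution \<mu> (point x a) (point y b) = point (x + y) (a * b)"
  unfolding fun_eq_iff convolution_point by (auto simp: point_def algebra_simps)

lemma fourier_singleton: "fourier \<gamma> {f} = weight *\<^sub>R (\<Sum>y\<in>UNIV. scaleC (cnj (\<gamma> y)) (f y))"
  by (simp add: fourier_def rep_singleton integral_eq_sum)

text \<open>A character is determined by its values on Dirac masses, and \<open>point x a\<close>
  factors as \<open>point x 1\<close> times \<open>point 0 a\<close>. The second factor gives a
  character of the coefficient algebra, the first a homomorphism from the group to the nonzero
  complex numbers.\<close>

lemma character_eq_tensor_char:
  assumes \<psi>: "\<psi> \<in> characters B"
  obtains \<gamma> \<phi> where "group_char \<gamma>" "\<phi> \<in> characters type_algebra" "\<psi> = tensor_char \<gamma> \<phi>"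
proof -
  have add: "\<psi> {\<lambda>x. f x + g x} = \<psi> {f} + \<psi> {g}" for f g
    using character_add[OF \<psi> singleton_closed singleton_closed, of f g] by (simp add: ops)
  have mult: "\<psi> {convolution \<mu> f g} = \<psi> {f} * \<psi> {g}" for f g
    using character_mult[OF \<psi> singleton_closed singleton_closed, of f g] by (simp add: ops)
  have scale: "\<psi> {\<lambda>x. scaleC c (f x)} = c * \<psi> {f}" for c f
    using character_scale[OF \<psi> singleton_closed, of c f] by (simp add: ops)
  have zero: "\<psi> {\<lambda>x. 0} = 0" using scale[of 0 "\<lambda>_. 0"] by (simp add: scaleC_zero)
  have one: "\<psi> {point 0 1} = 1"
  proof (rule character_unit[OF \<psi> singleton_closed])
    fix X assume "X \<in> ba_carrier B"
    then obtain f where "X = {f}" by (auto simp: carrier_eq)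
    then show "ba_mult B {point 0 1} X = X" by (simp add: ops fun_eq_iff convolution_point)
  qed
  define \<phi> where "\<phi> a = \<psi> {point 0 a}" for a
  define \<eta> where "\<eta> x = \<psi> {point x 1}" for x
  have \<eta>\<phi>: "\<psi> {point x a} = \<eta> x * \<phi> a" for x a
    using mult[of "point x 1" "point 0 a"] by (simp add: convolution_point_point \<eta>_def \<phi>_def)
  have \<phi>: "\<phi> \<in> characters type_algebra"
  proof -
    have "point 0 (a + b) = (\<lambda>x. point 0 a x + point 0 b x)" for a b
      by (auto simp: point_def scaleR_add_right)
    then have "\<phi> (a + b) = \<phi> a + \<phi> b" for a b by (simp add: \<phi>_def add)
    moreover have "point 0 (scaleC c a) = (\<lambda>x. scaleC c (point 0 a x))" for c a
      by (auto simp: point_def scaleR_scaleC scaleC_scaleC mult.commute scaleC_zero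
          linear_0[OF bounded_linear.linear[OF bounded_linear_scaleC]])
    then have "\<phi> (scaleC c a) = c * \<phi> a" for c a by (simp add: \<phi>_def scale)
    moreover have "\<phi> (a * b) = \<phi> a * \<phi> b" for a b
      using mult[of "point 0 a" "point 0 b"] by (simp add: \<phi>_def convolution_point_point)
    moreover have "\<exists>a. \<phi> a \<noteq> 0" using one by (intro exI[of _ 1]) (simp add: \<phi>_def)
    ultimately show ?thesis by (simp add: characters_def)
  qed
  have \<eta>_add: "\<eta> (x + y) = \<eta> x * \<eta> y" for x y
    using mult[of "point x 1" "point y 1"] by (simp add: \<eta>_def convolution_point_point)
  have \<eta>0: "\<eta> 0 = 1" using one by (simp add: \<eta>_def)
  \<comment> \<open>On a finite group |\<eta>| attains its maximum M, and |\<eta> x| M is again a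
    value of |\<eta>|, hence at most M.\<close>
  have le1: "cmod (\<eta> x) \<le> 1" for x
  proof -
    define M where "M = Max (range (\<lambda>x. cmod (\<eta> x)))"
    have M: "cmod (\<eta> y) \<le> M" for y unfolding M_def by (intro Max_ge) (auto simp: fin)
    have "M \<in> range (\<lambda>x. cmod (\<eta> x))" unfolding M_def by (intro Max_in) (auto simp: fin)
    then obtain y where y: "M = cmod (\<eta> y)" by blast
    have "cmod (\<eta> x) * M \<le> 1 * M"
      using M[of "x + y"] by (simp add: \<eta>_add y Real_Vector_Spaces.norm_mult)
    moreover have "M > 0" using M[of 0] by (simp add: \<eta>0)
    ultimately show ?thesis by simp
  qed
  have "cmod (\<eta> x) = 1" for x
  proof -
    have "cmod (\<eta> x) * cmod (\<eta> (- x)) = 1"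
      using \<eta>_add[of x "- x"] \<eta>0 by (simp flip: Real_Vector_Spaces.norm_mult)
    then have "1 \<le> cmod (\<eta> x)"
      using mult_left_mono[OF le1[of "- x"] norm_ge_zero[of "\<eta> x"]] by simp
    then show ?thesis using le1[of x] by simp
  qed
  \<comment> \<open>The conjugate is taken because \<open>fourier\<close> integrates against the
    conjugate character.\<close>
  then have \<gamma>: "group_char (\<lambda>x. cnj (\<eta> x))"
    by (simp add: group_char_def continuous_on_any \<eta>_add)
  have expand: "\<psi> {\<lambda>y. if y \<in> J then f y else 0} = (\<Sum>x\<in>J. \<eta> x * \<phi> (weight *\<^sub>R f x))" for f J
  proof -
    have "finite J" by (rule finite_subset[OF subset_UNIV fin])
    then show ?thesis
    proof induction
      case empty
      then show ?case by (simp add: zero)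
    next
      case (insert x J)
      have "(\<lambda>y. if y \<in> insert x J then f y else 0)
          = (\<lambda>y. point x (weight *\<^sub>R f x) y + (if y \<in> J then f y else 0))"
        using insert.hyps weight_pos by (auto simp: point_def)
      then show ?case using insert by (simp add: add \<eta>\<phi>)
    qed
  qed
  have \<phi>_sum: "\<phi> (\<Sum>x\<in>J. h x) = (\<Sum>x\<in>J. \<phi> (h x))" for h :: "'g \<Rightarrow> 'a" and J
  proof -
    have \<phi>0: "\<phi> 0 = 0" using character_scale[OF \<phi>, of 0 0] by (simp add: scaleC_zero)
    have "finite J" by (rule finite_subset[OF subset_UNIV fin])
    then show ?thesis using character_add[OF \<phi>] by induction (simp_all add: \<phi>0)
  qed
  have "\<psi> = tensor_char (\<lambda>x. cnj (\<eta> x)) \<phi>"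
  proof (rule extensionalityI[of _ "ba_carrier B"])
    show "\<psi> \<in> extensional (ba_carrier B)" by (rule character_extensional[OF \<psi>])
    show "tensor_char (\<lambda>x. cnj (\<eta> x)) \<phi> \<in> extensional (ba_carrier B)" by (simp add: tensor_char_def)
    fix X assume X: "X \<in> ba_carrier B"
    then obtain f where f: "X = {f}" by (auto simp: carrier_eq)
    have "\<psi> X = (\<Sum>x\<in>UNIV. \<eta> x * \<phi> (weight *\<^sub>R f x))" using expand[of UNIV f] by (simp add: f)
    also have "\<dots> = (\<Sum>x\<in>UNIV. \<phi> (weight *\<^sub>R scaleC (\<eta> x) (f x)))"
    proof (rule sum.cong)
      fix x
      have "weight *\<^sub>R scaleC (\<eta> x) (f x) = scaleC (\<eta> x) (weight *\<^sub>R f x)"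
        by (simp add: scaleR_scaleC scaleC_scaleC mult.commute)
      then show "\<eta> x * \<phi> (weight *\<^sub>R f x) = \<phi> (weight *\<^sub>R scaleC (\<eta> x) (f x))"
        using character_scale[OF \<phi>, of "weight *\<^sub>R f x" "\<eta> x"] by simp
    qed simp
    also have "\<dots> = \<phi> (fourier (\<lambda>x. cnj (\<eta> x)) X)"
      by (simp add: f fourier_singleton scaleR_sum_right \<phi>_sum)
    finally show "\<psi> X = tensor_char (\<lambda>x. cnj (\<eta> x)) \<phi> X" using X by (simp add: tensor_char_apply)
  qed
  then show ?thesis using that[OF \<gamma> \<phi>] by blast
qed

text \<open>For each group character, \<sigma> restricts to a bounded continuous function on the
  character space of the coefficient algebra and so is the Gelfand transform of some
  \<open>a \<gamma>\<close>. The function f is built by Fourier inversion to have these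
  coefficients.\<close>

lemma coefficients_type_I_imp_gelfand_onto:
  assumes I: "type_I_BSE_algebra (type_algebra :: 'a calgebra)" and \<sigma>: "\<sigma> \<in> Cb B"
  obtains f where "\<And>\<psi>. \<psi> \<in> characters B \<Longrightarrow> \<sigma> \<psi> = \<psi> {f}"
proof -
  note A = comm_banach_algebra_type_algebra[where 'a = 'a]
  let ?G = "{\<gamma> :: 'g \<Rightarrow> complex. group_char \<gamma>}"
  have "\<exists>a. \<forall>\<phi>\<in>characters (type_algebra :: 'a calgebra). \<sigma> (tensor_char \<gamma> \<phi>) = \<phi> a" if \<gamma>: "group_char \<gamma>" for \<gamma>
  proof -
    define \<tau> where "\<tau> = (\<lambda>\<phi>\<in>characters (type_algebra :: 'a calgebra). \<sigma> (tensor_char \<gamma> \<phi>))"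
    have "continuous_map (gelfand_topology type_algebra) (gelfand_topology B) (tensor_char \<gamma>)"
      by (rule continuous_map_into_gelfand)
        (simp_all add: topspace_gelfand tensor_char_character[OF \<gamma>] tensor_char_apply continuous_map_gelfand_eval)
    moreover have "continuous_map (gelfand_topology B) euclidean \<sigma>" using \<sigma> by (simp add: Cb_def)
    ultimately have "continuous_map (gelfand_topology type_algebra) euclidean (\<sigma> \<circ> tensor_char \<gamma>)"
      by (rule continuous_map_compose)
    then have "continuous_map (gelfand_topology type_algebra) euclidean \<tau>"
      by (rule continuous_map_eq) (simp add: \<tau>_def topspace_gelfand)
    moreover have "bounded (\<tau> ` characters type_algebra)"
    proof (rule bounded_subset)
      show "bounded (\<sigma> ` characters B)" using \<sigma> by (simp add: Cb_def)
      show "\<tau> ` characters type_algebra \<subseteq> \<sigma> ` characters B"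
        using tensor_char_character[OF \<gamma>] by (auto simp: \<tau>_def)
    qed
    ultimately have "\<tau> \<in> Cb type_algebra" by (simp add: Cb_def \<tau>_def)
    then have "\<exists>a\<in>ba_carrier type_algebra. \<forall>\<phi>\<in>characters type_algebra. \<tau> \<phi> = \<phi> a"
      by (intro comm_banach_algebra.type_I_imp_gelfand_onto[OF A I, of 1]) auto
    then show ?thesis by (auto simp: \<tau>_def)
  qed
  then obtain a where a: "\<And>\<gamma> \<phi>. group_char \<gamma> \<Longrightarrow> \<phi> \<in> characters (type_algebra :: 'a calgebra) \<Longrightarrow>
      \<sigma> (tensor_char \<gamma> \<phi>) = \<phi> (a \<gamma>)" by metis
  \<comment> \<open>The factor \<open>1 / mass\<close> compensates the squared norm of a
    character.\<close>
  define f where "f x = (\<Sum>\<gamma>\<in>?G. scaleC (\<gamma> x) ((1 / mass) *\<^sub>R a \<gamma>))" for x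
  have f: "fourier \<delta> {f} = a \<delta>" if \<delta>: "group_char \<delta>" for \<delta>
  proof -
    have "fourier \<delta> {f} = (LINT y|\<mu>. (\<Sum>\<gamma>\<in>?G. scaleC (cnj (\<delta> y)) (scaleC (\<gamma> y) ((1 / mass) *\<^sub>R a \<gamma>))))"
      unfolding fourier_def rep_singleton f_def
      by (simp add: linear_sum[OF bounded_linear.linear[OF bounded_linear_scaleC]])
    also have "\<dots> = (\<Sum>\<gamma>\<in>?G. LINT y|\<mu>. scaleC (cnj (\<delta> y)) (scaleC (\<gamma> y) ((1 / mass) *\<^sub>R a \<gamma>)))"
      by (rule Bochner_Integration.integral_sum) (rule integrable_any)
    also have "\<dots> = (\<Sum>\<gamma>\<in>?G. fourier \<delta> (elem \<gamma> ((1 / mass) *\<^sub>R a \<gamma>)))"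
      by (simp add: fourier_def elem_def cls_eq rep_singleton)
    also have "\<dots> = (\<Sum>\<gamma>\<in>?G. if \<gamma> = \<delta> then a \<gamma> else 0)"
      using mass_pos by (intro sum.cong) (auto simp: fourier_elem \<delta>)
    also have "\<dots> = a \<delta>" using finite_group_chars[OF fin] \<delta> by simp
    finally show ?thesis .
  qed
  have "\<sigma> \<psi> = \<psi> {f}" if \<psi>: "\<psi> \<in> characters B" for \<psi>
  proof -
    from \<psi> obtain \<gamma> \<phi> where "group_char \<gamma>" "\<phi> \<in> characters type_algebra" "\<psi> = tensor_char \<gamma> \<phi>"
      by (rule character_eq_tensor_char)
    then show ?thesis by (simp add: a f tensor_char_apply singleton_closed)
  qed
  then show ?thesis by (rule that)
qed

lemma coefficients_type_I_imp_type_I: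
  assumes I: "type_I_BSE_algebra (type_algebra :: 'a calgebra)"
  shows "type_I_BSE_algebra B"
proof (rule gelfand_onto_imp_type_I)
  show "{point 0 1} \<in> ba_carrier B" by (rule singleton_closed)
  show "ba_mult B {point 0 1} X = X" if "X \<in> ba_carrier B" for X
    using that by (auto simp: carrier_eq ops fun_eq_iff convolution_point)
next
  fix \<psi> assume "\<psi> \<in> characters B"
  then obtain \<gamma> \<phi> where \<psi>: "group_char \<gamma>" "\<phi> \<in> characters type_algebra" "\<psi> = tensor_char \<gamma> \<phi>"
    by (rule character_eq_tensor_char)
  let ?K = "weight powr (- 1 / p)"
  have "cmod (\<psi> X) \<le> (mass * ?K) * ba_norm B X" if X: "X \<in> ba_carrier B" for X
  proof -
    obtain f where f: "X = {f}" using X by (auto simp: carrier_eq)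
    have "cmod (\<psi> X) \<le> norm (fourier \<gamma> X)"
      using X by (simp add: \<psi>(3) tensor_char_apply character_type_algebra_le_norm[OF \<psi>(2)])
    also have "\<dots> \<le> mass * (?K * Lp_norm p \<mu> f)"
      unfolding fourier_def f rep_singleton
      using norm_le_Lp_norm[of f]
      by (intro norm_integral_le_const) (simp add: norm_scaleC group_char_norm[OF \<psi>(1)])
    finally show ?thesis by (simp add: f ops mult.assoc)
  qed
  then show "\<exists>K. \<forall>X\<in>ba_carrier B. cmod (\<psi> X) \<le> K * ba_norm B X" by blast
next
  fix \<sigma> assume "\<sigma> \<in> Cb B"
  then show "\<exists>X\<in>ba_carrier B. \<forall>\<psi>\<in>characters B. \<sigma> \<psi> = \<psi> X"
    using coefficients_type_I_imp_gelfand_onto[OF I] singleton_closed by metis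
qed

end

theorem theorem4p4:
  fixes \<mu> :: "'g::{topological_ab_group_add, t2_space} measure"
    and p :: real
  assumes "compact (UNIV :: 'g set)"
    and "haar_measure \<mu>"
    and "semisimple_algebra
      (type_algebra :: 'a::{complex_banach_algebra, comm_ring_1, separable_metric_space} calgebra)"
    and "1 < p"
  shows "type_I_BSE_algebra (Lp_algebra p \<mu> :: ('g \<Rightarrow> 'a) set calgebra) \<longleftrightarrow>
    finite (UNIV :: 'g set) \<and> type_I_BSE_algebra (type_algebra :: 'a calgebra)"
proof -
  let ?B = "Lp_algebra p \<mu> :: ('g \<Rightarrow> 'a) set calgebra"
  have sets: "sets \<mu> = sets borel" using assms(2) by (simp add: haar_measure_def)
  from this have space: "space \<mu> = UNIV" using sets_eq_imp_space_eq by fastforce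
  have "emeasure \<mu> UNIV < \<infinity>"
    using assms(1,2) unfolding haar_measure_def by (metis sets.top space_borel)
  then have "compact_borel_measure \<mu>"
    using assms(1) sets space
    by (intro compact_borel_measure.intro finite_measureI compact_borel_measure_axioms.intro) simp_all
  then have B: "Lp_setting \<mu> p ?B"
    using assms by (simp add: Lp_setting_def Lp_setting_axioms_def compact_haar_def compact_haar_axioms_def)
  \<comment> \<open>By semisimplicity some character does not vanish at the nonzero element 1; it is
    needed to lift group characters to characters of L^p.\<close>
  obtain \<phi> where \<phi>: "\<phi> \<in> characters (type_algebra :: 'a calgebra)"
  proof -
    have "(1 :: 'a) \<notin> {b \<in> ba_carrier type_algebra. \<forall>\<phi>\<in>characters type_algebra. \<phi> b = 0}"
      using assms(3) unfolding semisimple_algebra_def by simp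
    then show ?thesis using that by auto
  qed
  show ?thesis
  proof
    assume I: "type_I_BSE_algebra ?B"
    then have "Lp_banach_algebra \<mu> p ?B"
      using B by (simp add: Lp_banach_algebra_def type_I_BSE_algebra_def BSE_algebra_def)
    with I \<phi> show "finite (UNIV :: 'g set) \<and> type_I_BSE_algebra (type_algebra :: 'a calgebra)"
      using Lp_banach_algebra.type_I_imp_finite Lp_banach_algebra.type_I_imp_coefficients_type_I by blast
  next
    assume R: "finite (UNIV :: 'g set) \<and> type_I_BSE_algebra (type_algebra :: 'a calgebra)"
    then have "finite_Lp_setting \<mu> p ?B"
      using B by (simp add: finite_Lp_setting_def finite_Lp_setting_axioms_def)
    then show "type_I_BSE_algebra ?B"
      using finite_Lp_setting.coefficients_type_I_imp_type_I R by blast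
  qed
qed

end
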